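(* Let $I=(-1,1)$ and let $g\in \dot H^{\frac12,2}(\mathbb{R},\mathbb{S}^1)$ be non-constant in $\mathbb{R}\setminus I$. Let $u_0\in\mathcal{E}_g$ be a minimizer of the functional $E:\mathcal{E}_g\to\mathbb{R}$, where $\mathcal{E}_g=\{u\in \dot H^{\frac12,2}(\mathbb{R},\mathbb{S}^1): u=g \text{ in }\mathbb{R}\setminus I\}$. Then $E$ has a second critical point $u^*\in\mathcal{E}_g$, $u^*\neq u_0$.
   Context: Identify $\mathbb{C}\simeq\mathbb{R}^2$; $\mathbb{S}^1\subset\mathbb{C}$ is the unit circle. $\dot H^{\frac12,2}(\mathbb{R},\mathbb{C})$ is the space of measurable $u:\mathbb{R}\to\mathbb{C}$ with $[u]^2_{H^{\frac12,2}(\mathbb{R})}:=\int_{\mathbb{R}}\int_{\mathbb{R}}\frac{|u(x)-u(\xi)|^2}{(x-\xi)^2}\,dx\,d\xi<\infty$, and $\dot H^{\frac12,2}(\mathbb{R},\mathbb{S}^1)$ is the subset of those $u$ with $|u(x)|=1$ for a.e. $x$. Functions are identified when equal a.e., and equalities and "(non-)constant" are understood up to null sets. The energy is $E(u):=\int_{\mathbb{R}}|(-\Delta)^{\frac14}u|^2dx=\frac{1}{2\pi}[u]^2_{H^{\frac12,2}(\mathbb{R})}=\int_{\mathbb{R}^2_+}|\nabla\tilde u|^2\,dx\,dy$, where $\mathbb{R}^2_+=\mathbb{R}\times(0,\infty)$ and $\tilde u(x,y)=\frac1\pi\int_{\mathbb{R}}\frac{y\,u(\xi)}{y^2+(x-\xi)^2}d\xi$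 is the Poisson harmonic extension. A critical point of $E$ in $\mathcal{E}_g$ is a map $u\in\mathcal{E}_g$ that is half-harmonic in $I$, i.e. satisfies $(-\Delta)^{\frac12}u\perp T_u\mathbb{S}^1$ in $I$ in the weak sense; equivalently, $\frac{d}{dt}\big|_{t=0}E\big(\frac{u+t\varphi}{|u+t\varphi|}\big)=0$ for every $\varphi\in C^\infty_c(I,\mathbb{C})$. *)

theory Defs
  imports "HOL-Analysis.Analysis"
begin

(* Maps are total functions standing for their a.e. classes, and "measurable" means Lebesgue
   measurable, so all integrals are taken over lebesgue rather than lborel.  On the diagonal the
   quotient below is 0/0 = 0, which is harmless. *)

definition gagliardo_sq :: "(real \<Rightarrow> complex) \<Rightarrow> ennreal" where
  "gagliardo_sq u =
     (\<integral>\<^sup>+x. (\<integral>\<^sup>+\<xi>. ennreal ((cmod (u x - u \<xi>))\<^sup>2 / (x - \<xi>)\<^sup>2) \<partial>lebesgue) \<partial>lebesgue)"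

definition Hdot_half :: "(real \<Rightarrow> complex) set" where
  "Hdot_half = {u. u \<in> borel_measurable lebesgue \<and> gagliardo_sq u < \<infinity>}"

definition Hdot_half_circle :: "(real \<Rightarrow> complex) set" where
  "Hdot_half_circle = {u \<in> Hdot_half. AE x in lebesgue. u x \<in> sphere 0 1}"

(* The value is the half-Dirichlet energy only for u in Hdot_half (enn2real sends infinity to 0). *)

definition energy :: "(real \<Rightarrow> complex) \<Rightarrow> real" where
  "energy u = 1 / (2 * pi) * enn2real (gagliardo_sq u)"

definition admissible :: "real set \<Rightarrow> (real \<Rightarrow> complex) \<Rightarrow> (real \<Rightarrow> complex) set" where
  "admissible I g = {u \<in> Hdot_half_circle. AE x in lebesgue. x \<notin> I \<longrightarrow> u x = g x}"

definition ae_constant_on :: "real set \<Rightarrow> (real \<Rightarrow> complex) \<Rightarrow> bool" where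
  "ae_constant_on S u \<longleftrightarrow> (\<exists>c. AE x in lebesgue. x \<in> S \<longrightarrow> u x = c)"

definition minimizer :: "real set \<Rightarrow> (real \<Rightarrow> complex) \<Rightarrow> (real \<Rightarrow> complex) \<Rightarrow> bool" where
  "minimizer I g u \<longleftrightarrow> u \<in> admissible I g \<and> (\<forall>v \<in> admissible I g. energy u \<le> energy v)"

definition smooth :: "(real \<Rightarrow> complex) \<Rightarrow> bool" where
  "smooth \<phi> \<longleftrightarrow> (\<forall>k x. ((\<lambda>f t. vector_derivative f (at t)) ^^ k) \<phi> differentiable (at x))"

definition test_functions :: "real set \<Rightarrow> (real \<Rightarrow> complex) set" where
  "test_functions I =
     {\<phi>. smooth \<phi> \<and> compact (closure {x. \<phi> x \<noteq> 0}) \<and> closure {x. \<phi> x \<noteq> 0} \<subseteq> I}"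

(* Weak half-harmonicity in I, expressed by the first variation of the energy under projected
   perturbations.  For |t| small, |u + t phi| >= 1/2 a.e., so the variations are again in
   Hdot_half_circle and the derivative at 0 only sees finite energies. *)

definition half_harmonic_in :: "real set \<Rightarrow> (real \<Rightarrow> complex) \<Rightarrow> bool" where
  "half_harmonic_in I u \<longleftrightarrow>
     (\<forall>\<phi> \<in> test_functions I.
        ((\<lambda>t::real. energy (\<lambda>x. (u x + of_real t * \<phi> x) / of_real (cmod (u x + of_real t * \<phi> x))))
           has_real_derivative 0) (at 0))"

definition critical_point :: "real set \<Rightarrow> (real \<Rightarrow> complex) \<Rightarrow> (real \<Rightarrow> complex) \<Rightarrow> bool" where
  "critical_point I g u \<longleftrightarrow> u \<in> admissible I g \<and> half_harmonic_in I u"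

end

theory Submission
  imports Defs "HOL-Probability.Probability_Measure"
    "HOL-Computational_Algebra.Fundamental_Theorem_Algebra" "HOL-Real_Asymp.Real_Asymp"
begin

text \<open>
  The proof compares the infima of the energy in the different degree classes of admissible maps. Through the
  Cayley transform the line becomes the unit circle, and the energy of a map \<open>u\<close> becomes \<open>2\<pi>\<close> times
  \<open>dirichlet u = \<Sum> \<bar>n\<bar> \<bar>c n\<bar>\<^sup>2\<close>, where \<open>c n\<close> are the Fourier coefficients of \<open>u\<close>. For unimodular \<open>u\<close> the signed sum
  \<open>deg u = \<Sum> n \<bar>c n\<bar>\<^sup>2\<close> is the degree; it is an integer. The positive and the negative frequencies contribute
  \<open>(dirichlet u \<plusminus> deg u) / 2\<close>, and both are lower semicontinuous. Hence a sequence of maps of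
  degree \<open>d\<close> that converges almost everywhere to \<open>u\<close> satisfies \<open>dirichlet u + \<bar>deg u - d\<bar> \<le> liminf\<close>: every unit
  of degree lost in the limit costs a full unit of \<open>dirichlet\<close>. If the class of degree \<open>d\<close> contains a map with energy
  below \<open>dirichlet u\<^sub>0 + 1\<close>, then no degree is lost, and the class has a minimizer (\<open>minimizer_in_degree_class\<close>).
  Small projected perturbations preserve the degree, so this minimizer is half-harmonic; for \<open>d \<noteq> deg u\<^sub>0\<close> it differs
  from \<open>u\<^sub>0\<close>.

  A competitor is obtained by multiplying \<open>u\<^sub>0\<close> by a bubble or by its conjugate. For unimodular \<open>\<beta>\<close> the cross terms
  cancel in the sum of the two energies (\<open>dirichlet_mult_add_mult_cnj\<close>):
  \<open>dirichlet (\<beta> u) + dirichlet (cnj \<beta> u) = 2 dirichlet u + 2 dirichlet \<beta>\<close> minus the nonnegative interaction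
  \<open>\<integral>\<integral> \<bar>\<beta> x - \<beta> y\<bar>\<^sup>2 \<bar>u x - u y\<bar>\<^sup>2 / \<bar>b x - b y\<bar>\<^sup>2\<close>, where \<open>b\<close> is the coordinate on the circle. The explicit degree-one bubble
  at scale \<open>e\<close> equals \<open>1\<close> outside the interval and has \<open>dirichlet \<le> 1 + 3 e\<^sup>2\<close> (\<open>dirichlet_bubble_le\<close>), whereas its
  interaction with \<open>u\<^sub>0\<close> is at least a constant times \<open>e\<close> (\<open>bubble_interaction\<close>): on a set of measure of order \<open>e\<close> it is far from \<open>1\<close>,
  and the data outside the interval, being non-constant, has a positive mean square distance to every value of \<open>u\<^sub>0\<close>. For small \<open>e\<close>
  one of the two products has energy below \<open>dirichlet u\<^sub>0 + 1\<close>, and its degree is \<open>deg u\<^sub>0 + 1\<close> or \<open>deg u\<^sub>0 - 1\<close>.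

  The degree is handled without derivatives. It is multiplicative (\<open>deg_mult\<close>), because the error in its integral
  representation is of third order in the differences, and it vanishes on maps into a half plane (\<open>deg_half_plane\<close>), because such
  maps have roots of every order with small energy. For a normalized trigonometric polynomial the degree is therefore an integer, by
  factorization into linear factors. An arbitrary map is approximated by truncations of its Poisson extension, whose modulus is uniformly
  close to one near the circle.\<close>

section \<open>Kernels on the unit disc\<close>

text \<open>For \<open>r < 1\<close> this is \<open>\<Sum> n (r z)\<^sup>n\<close>, the generating function of the weights of the energy; on the unit
  circle the limit \<open>r \<rightarrow> 1\<close> is the kernel \<open>- 1 / \<bar>1 - z\<bar>\<^sup>2\<close> of the Gagliardo seminorm.\<close>

definition koebe :: "real \<Rightarrow> complex \<Rightarrow> complex" where
  "koebe r z = of_real r * z / (1 - of_real r * z)\<^sup>2"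

definition poisson :: "real \<Rightarrow> complex \<Rightarrow> real" where
  "poisson r z = (1 - r\<^sup>2) / (cmod (1 - of_real r * z))\<^sup>2"

lemma cmod_one_minus_sq:
  assumes "cmod z = 1"
  shows "(cmod (1 - of_real r * z))\<^sup>2 = (1 - r)\<^sup>2 + r * (cmod (1 - z))\<^sup>2"
proof -
  have z: "(Re z)\<^sup>2 + (Im z)\<^sup>2 = 1" using assms by (simp add: cmod_def)
  have e1: "(cmod (1 - of_real r * z))\<^sup>2 = 1 - 2 * r * Re z + r\<^sup>2 * ((Re z)\<^sup>2 + (Im z)\<^sup>2)"
    unfolding cmod_power2 by (simp add: power2_eq_square algebra_simps)
  have e2: "(cmod (1 - z))\<^sup>2 = 1 - 2 * Re z + ((Re z)\<^sup>2 + (Im z)\<^sup>2)"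
    unfolding cmod_power2 by (simp add: power2_eq_square algebra_simps)
  show ?thesis unfolding e1 e2 z by (simp add: power2_eq_square algebra_simps)
qed

text \<open>By \<open>cmod_one_minus_sq\<close> the kernel is dominated by its limit uniformly in \<open>r\<close>; this is the domination behind every
  passage \<open>r \<rightarrow> 1\<close> below. The point \<open>z = 1\<close>, where the bound reads \<open>1 / 0\<close>, corresponds to the diagonal.\<close>

lemma norm_koebe_le:
  assumes "cmod z = 1" "0 \<le> r"
  shows "cmod (koebe r z) \<le> 1 / (cmod (1 - z))\<^sup>2 \<or> z = 1"
proof (cases "z = 1")
  case False
  then have d: "(cmod (1 - z))\<^sup>2 > 0" by simp
  have "r * (cmod (1 - z))\<^sup>2 \<le> (cmod (1 - of_real r * z))\<^sup>2"
    using cmod_one_minus_sq[OF assms(1), of r] by simp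
  moreover have "cmod (koebe r z) = r / (cmod (1 - of_real r * z))\<^sup>2"
    using assms by (simp add: koebe_def norm_divide norm_mult norm_power)
  ultimately have "cmod (koebe r z) * (cmod (1 - z))\<^sup>2 \<le> 1"
    using d by (cases "cmod (1 - of_real r * z) = 0") (simp_all add: divide_le_eq_1)
  then show ?thesis using d by (simp add: pos_le_divide_eq)
qed simp

lemma koebe_unit:
  assumes "cmod z = 1" "z \<noteq> 1"
  shows "z / (1 - z)\<^sup>2 = - of_real (1 / (cmod (1 - z))\<^sup>2)"
proof -
  have zz: "z * cnj z = 1" using assms by (metis complex_norm_square of_real_1 power_one)
  have "complex_of_real ((cmod (1 - z))\<^sup>2) = (1 - z) * (1 - cnj z)"
    by (metis complex_norm_square complex_cnj_diff complex_cnj_one)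
  moreover have "z * ((1 - z) * (1 - cnj z)) = - (1 - z)\<^sup>2"
  proof -
    have "z * ((1 - z) * (1 - cnj z)) = (1 - z) * (z - z * cnj z)" by algebra
    also have "\<dots> = - (1 - z)\<^sup>2" unfolding zz by algebra
    finally show ?thesis .
  qed
  moreover have "1 - z \<noteq> 0" using assms by auto
  moreover have "cnj z \<noteq> 1" using assms by (metis complex_cnj_cnj complex_cnj_one)
  then have "1 - cnj z \<noteq> 0" by auto
  ultimately show ?thesis by (simp only: of_real_divide of_real_1) (simp add: divide_simps mult_ac)
qed

lemma koebe_tendsto:
  assumes "cmod z = 1" "z \<noteq> 1" "s \<longlonglongrightarrow> 1"
  shows "(\<lambda>k. koebe (s k) z) \<longlonglongrightarrow> - of_real (1 / (cmod (1 - z))\<^sup>2)"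
proof -
  have "(\<lambda>k. complex_of_real (s k)) \<longlonglongrightarrow> of_real 1" by (rule tendsto_of_real[OF assms(3)])
  then have "(\<lambda>k. koebe (s k) z) \<longlonglongrightarrow> of_real 1 * z / (1 - of_real 1 * z)\<^sup>2"
    unfolding koebe_def using assms by (intro tendsto_intros) auto
  then show ?thesis using koebe_unit[OF assms(1,2)] by simp
qed

lemma koebe_sums:
  assumes "cmod z = 1" "0 \<le> r" "r < 1"
  shows "(\<lambda>n. of_nat n * of_real (r ^ n) * z ^ n) sums koebe r z"
proof -
  have n: "norm (of_real r * z) < 1" using assms by (simp add: norm_mult)
  have "(\<lambda>n. (of_real r * z) * (of_nat (Suc n) * (of_real r * z) ^ n)) sums
        ((of_real r * z) * (1 / (1 - of_real r * z)\<^sup>2))"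
    by (intro sums_mult geometric_deriv_sums n)
  then have "(\<lambda>n. of_nat (Suc n) * of_real (r ^ Suc n) * z ^ Suc n) sums koebe r z"
    by (simp add: koebe_def power_mult_distrib mult_ac)
  then show ?thesis by (subst (asm) sums_Suc_iff) simp
qed

lemma poisson_alt:
  assumes "cmod z = 1" "0 \<le> r" "r < 1"
  shows "poisson r z = 2 * Re (1 / (1 - of_real r * z)) - 1"
proof -
  let ?w = "1 - of_real r * z"
  have "cmod (of_real r * z) < 1" using assms by (simp add: norm_mult)
  then have w0: "?w \<noteq> 0" by auto
  have "Re (1 / ?w) = Re ?w / (cmod ?w)\<^sup>2"
    by (simp add: Re_divide cmod_power2)
  moreover have "2 * Re ?w - (cmod ?w)\<^sup>2 = 1 - r\<^sup>2"
  proof -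
    have z: "(Re z)\<^sup>2 + (Im z)\<^sup>2 = 1" using assms by (simp add: cmod_def)
    have "2 * Re ?w - (cmod ?w)\<^sup>2 = 1 - r\<^sup>2 * ((Re z)\<^sup>2 + (Im z)\<^sup>2)"
      unfolding cmod_power2 by (simp add: power2_eq_square algebra_simps)
    then show ?thesis using z by simp
  qed
  moreover have "(cmod ?w)\<^sup>2 > 0" using w0 by simp
  ultimately show ?thesis unfolding poisson_def by (simp add: field_simps)
qed

lemma poisson_sums:
  assumes "cmod z = 1" "0 \<le> r" "r < 1"
  shows "(\<lambda>n. (if n = 0 then 1 else 2 * r ^ n * Re (z ^ n))) sums poisson r z"
proof -
  have n: "norm (of_real r * z) < 1" using assms by (simp add: norm_mult)
  have "(\<lambda>n. 2 * Re ((of_real r * z) ^ n)) sums (2 * Re (1 / (1 - of_real r * z)))"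
    by (intro sums_mult sums_Re geometric_sums n)
  moreover have "(\<lambda>n::nat. if n = 0 then -1 else (0::real)) sums (-1)"
    using sums_single[of 0 "\<lambda>_. -1::real"] by simp
  ultimately have "(\<lambda>n. 2 * Re ((of_real r * z) ^ n) + (if n = 0 then -1 else 0)) sums
      (2 * Re (1 / (1 - of_real r * z)) + -1)" by (rule sums_add)
  moreover have "2 * Re ((of_real r * z) ^ n) + (if n = 0 then -1 else 0) =
      (if n = 0 then 1 else 2 * r ^ n * Re (z ^ n))" for n
    by (simp add: power_mult_distrib flip: of_real_power)
  ultimately show ?thesis using poisson_alt[OF assms] by simp
qed

lemma poisson_nonneg: "0 \<le> r \<Longrightarrow> r \<le> 1 \<Longrightarrow> 0 \<le> poisson r z"
  by (simp add: poisson_def power_le_one)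

lemma poisson_le:
  assumes "cmod z = 1" "0 < r" "r < 1" "z \<noteq> 1"
  shows "poisson r z \<le> (1 - r\<^sup>2) / (r * (cmod (1 - z))\<^sup>2)"
proof -
  have "r * (cmod (1 - z))\<^sup>2 \<le> (cmod (1 - of_real r * z))\<^sup>2"
    using cmod_one_minus_sq[OF assms(1), of r] by simp
  moreover have "0 < r * (cmod (1 - z))\<^sup>2" using assms by simp
  moreover have "0 \<le> 1 - r\<^sup>2" using assms by (simp add: power_le_one)
  ultimately show ?thesis unfolding poisson_def by (intro divide_left_mono) (auto intro!: mult_pos_pos)
qed

lemma poisson_bound:
  assumes "cmod z = 1" "0 \<le> r" "r < 1"
  shows "poisson r z \<le> 2 / (1 - r)"
proof -
  have d: "1 - r \<le> cmod (1 - of_real r * z)"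
    using norm_triangle_ineq2[of 1 "of_real r * z"] assms by (simp add: norm_mult)
  have "(1 - r)\<^sup>2 \<le> (cmod (1 - of_real r * z))\<^sup>2" using d assms by (intro power_mono) auto
  moreover have "0 < (1 - r)\<^sup>2" using assms by simp
  moreover have "0 \<le> 1 - r\<^sup>2" using assms by (simp add: power_le_one)
  ultimately have "poisson r z \<le> (1 - r\<^sup>2) / (1 - r)\<^sup>2"
    unfolding poisson_def by (intro divide_left_mono mult_pos_pos) linarith+
  also have "\<dots> = (1 + r) / (1 - r)" proof -
    have "1 - r\<^sup>2 = (1 + r) * (1 - r)" "(1 - r)\<^sup>2 = (1 - r) * (1 - r)"
      by (simp_all add: power2_eq_square algebra_simps)
    then show ?thesis using assms by simp
  qed
  also have "\<dots> \<le> 2 / (1 - r)" using assms by (intro divide_right_mono) auto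
  finally show ?thesis .
qed

lemma cnj_borel_measurable [measurable]:
  "f \<in> borel_measurable M \<Longrightarrow> (\<lambda>x. cnj (f x)) \<in> borel_measurable M"
  by (rule borel_measurable_continuous_on[where f = cnj]) (intro continuous_intros)

text \<open>The triangle inequality gives \<open>r \<bar>y - z\<bar> \<le> 2 max(\<bar>1 - r y\<bar>, \<bar>1 - r z\<bar>)\<close>, while the smaller of the two
  is at least \<open>1 - r\<close>, which absorbs the numerators.\<close>

lemma poisson_mult_le:
  assumes "cmod y = 1" "cmod z = 1" "0 < r" "r < 1"
  shows "poisson r y * poisson r z * (r * cmod (y - z))\<^sup>2 \<le> 16"
proof -
  have *: "poisson r y * poisson r z * (r * cmod (y - z))\<^sup>2 \<le> 16"
    if yz: "cmod y = 1" "cmod z = 1" and le: "cmod (1 - of_real r * y) \<le> cmod (1 - of_real r * z)" for y z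
  proof -
    define p where "p = cmod (1 - of_real r * y)"
    define q where "q = cmod (1 - of_real r * z)"
    have p: "1 - r \<le> p" unfolding p_def
      using norm_triangle_ineq2[of 1 "of_real r * y"] assms yz by (simp add: norm_mult)
    then have p0: "p > 0" and q0: "q > 0" using assms le by (auto simp: p_def q_def)
    have "r * cmod (y - z) = cmod ((1 - of_real r * z) - (1 - of_real r * y))"
      using assms by (simp add: norm_mult flip: right_diff_distrib)
    also have "\<dots> \<le> q + p" unfolding p_def q_def by (rule norm_triangle_ineq4)
    also have "\<dots> \<le> 2 * q" using le by (simp add: p_def q_def)
    finally have "(r * cmod (y - z))\<^sup>2 \<le> (2 * q)\<^sup>2" using assms by (intro power_mono) auto
    moreover have "1 - r\<^sup>2 \<le> 2 * (1 - r)"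
      using zero_le_power2[of "1 - r"] by (simp add: power2_eq_square algebra_simps)
    then have "1 - r\<^sup>2 \<le> 2 * p" using mult_left_mono[OF p, of 2] by linarith
    then have "(1 - r\<^sup>2)\<^sup>2 \<le> (2 * p)\<^sup>2" using assms by (intro power_mono) (auto simp: power_le_one)
    ultimately have "(1 - r\<^sup>2)\<^sup>2 * (r * cmod (y - z))\<^sup>2 \<le> (2 * p)\<^sup>2 * (2 * q)\<^sup>2"
      by (intro mult_mono) auto
    then have "(1 - r\<^sup>2)\<^sup>2 * (r * cmod (y - z))\<^sup>2 / (p\<^sup>2 * q\<^sup>2) \<le> 16"
      using p0 q0 by (simp add: divide_simps power_mult_distrib mult_ac)
    then show ?thesis unfolding poisson_def p_def[symmetric] q_def[symmetric]
      by (simp add: power2_eq_square)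
  qed
  show ?thesis
  proof (cases "cmod (1 - of_real r * y) \<le> cmod (1 - of_real r * z)")
    case True with *[of y z] assms show ?thesis by simp
  next
    case False with *[of z y] assms show ?thesis by (simp add: norm_minus_commute mult_ac)
  qed
qed

text \<open>For nonnegative terms a bound on the Abel means is a bound on the partial sums.\<close>

lemma sum_nonneg_limit_summable:
  fixes a :: "nat \<Rightarrow> real" and s :: "nat \<Rightarrow> real"
  assumes a: "\<And>n. 0 \<le> a n" and s: "s \<longlonglongrightarrow> 1" "\<And>k. 0 \<le> s k" "\<And>k. s k < 1"
    and sum: "\<And>k. summable (\<lambda>n. s k ^ n * a n)" and le: "\<And>k. (\<Sum>n. s k ^ n * a n) \<le> B k"
    and B: "B \<longlonglongrightarrow> C"
  shows "summable a \<and> suminf a \<le> C"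
proof -
  have "(\<Sum>n<N. a n) \<le> C" for N
  proof (rule LIMSEQ_le)
    show "(\<lambda>k. \<Sum>n<N. s k ^ n * a n) \<longlonglongrightarrow> (\<Sum>n<N. a n)"
    proof (intro tendsto_sum)
      fix n
      have "(\<lambda>k. s k ^ n * a n) \<longlonglongrightarrow> 1 ^ n * a n" by (intro tendsto_intros s)
      then show "(\<lambda>k. s k ^ n * a n) \<longlonglongrightarrow> a n" by simp
    qed
    show "B \<longlonglongrightarrow> C" by fact
    show "\<exists>K. \<forall>k\<ge>K. (\<Sum>n<N. s k ^ n * a n) \<le> B k"
      using sum_le_suminf[OF sum] a s(2) le by (meson order_trans finite_lessThan mult_nonneg_nonneg zero_le_power)
  qed
  then show ?thesis
    using summableI_nonneg_bounded[of a C] suminf_le_const[of a C] a by blast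
qed

lemma abel_suminf:
  fixes a :: "nat \<Rightarrow> real" and s :: "nat \<Rightarrow> real"
  assumes a: "\<And>n. 0 \<le> a n" and s: "s \<longlonglongrightarrow> 1" "\<And>k. 0 \<le> s k" "\<And>k. s k < 1" and sum: "summable a"
  shows "(\<lambda>k. \<Sum>n. s k ^ n * a n) \<longlonglongrightarrow> suminf a"
proof -
  have "eventually (\<lambda>n. summable (\<lambda>k. norm (s n ^ k * a k))) sequentially \<and>
           summable (\<lambda>n. norm (a n)) \<and>
           ((\<lambda>n. \<Sum>k. s n ^ k * a k) \<longlonglongrightarrow> suminf a)"
  proof (rule tannerys_theorem[where M = a])
    show "(\<lambda>n. s n ^ k * a k) \<longlonglongrightarrow> a k" for k
    proof -
      have "(\<lambda>n. s n ^ k * a k) \<longlonglongrightarrow> 1 ^ k * a k" by (intro tendsto_intros s)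
      then show ?thesis by simp
    qed
    have "norm (s n ^ k * a k) \<le> a k" for k n
      using a[of k] s(2,3)[of n] by (simp add: abs_mult mult_left_le_one_le power_le_one)
    then show "\<forall>\<^sub>F (k, n) in at_top \<times>\<^sub>F sequentially. norm (s n ^ k * a k) \<le> a k"
      by (intro always_eventually) auto
  qed (use sum in auto)
  then show ?thesis by blast
qed

section \<open>Fourier analysis\<close>

text \<open>A model of the unit circle with normalized length: the point \<open>x\<close> is described by its coordinate \<open>b x\<close>, and
  the vanishing moments say that \<open>b\<close> is uniformly distributed. Fourier analysis then works directly on the line, with the Cauchy
  distribution and the Cayley transform.\<close>

locale circle_space = prob_space M for M :: "'a measure" +
  fixes b :: "'a \<Rightarrow> complex"
  assumes b_measurable [measurable]: "b \<in> borel_measurable M"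
    and norm_b [simp]: "cmod (b x) = 1"
    and inj_b: "b x = b y \<Longrightarrow> x = y"
    and moment: "n \<ge> 1 \<Longrightarrow> (\<integral>x. b x ^ n \<partial>M) = 0"
begin

sublocale P: pair_prob_space M M ..

abbreviation N where "N \<equiv> M \<Otimes>\<^sub>M M"

text \<open>The measure is finite, so boundedness is all that the Fourier coefficients need; a bound at every point keeps
  the kernel estimates free of null sets.\<close>

definition bounded_map :: "('a \<Rightarrow> complex) \<Rightarrow> bool" where
  "bounded_map u \<longleftrightarrow> u \<in> borel_measurable M \<and> (\<exists>C. \<forall>x. cmod (u x) \<le> C)"

definition omega :: "'a \<times> 'a \<Rightarrow> complex" where
  "omega p = b (fst p) * cnj (b (snd p))"

text \<open>On the diagonal the value is \<open>0 / 0 = 0\<close>.\<close>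

definition quot :: "('a \<Rightarrow> complex) \<Rightarrow> 'a \<times> 'a \<Rightarrow> real" where
  "quot u p = (cmod (u (fst p) - u (snd p)))\<^sup>2 / (cmod (b (fst p) - b (snd p)))\<^sup>2"

definition dirichlet :: "('a \<Rightarrow> complex) \<Rightarrow> real" where
  "dirichlet u = (\<integral>p. quot u p \<partial>N)"

definition finite_dirichlet :: "('a \<Rightarrow> complex) \<Rightarrow> bool" where
  "finite_dirichlet u \<longleftrightarrow> bounded_map u \<and> integrable N (quot u)"

definition fourier :: "('a \<Rightarrow> complex) \<Rightarrow> nat \<Rightarrow> complex" where
  "fourier u n = (\<integral>x. u x * cnj (b x) ^ n \<partial>M)"

text \<open>The energy of the positive frequencies; the negative frequencies of \<open>u\<close> are the positive ones of its conjugate.\<close>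

definition hardy :: "('a \<Rightarrow> complex) \<Rightarrow> real" where
  "hardy u = (\<Sum>n. real n * (cmod (fourier u n))\<^sup>2)"

definition deg :: "('a \<Rightarrow> complex) \<Rightarrow> real" where
  "deg u = hardy u - hardy (\<lambda>x. cnj (u x))"

lemma norm_omega [simp]: "cmod (omega p) = 1"
  by (simp add: omega_def norm_mult)

lemma omega_measurable [measurable]: "omega \<in> borel_measurable N"
  unfolding omega_def by measurable

lemma omega_eq_1_iff: "omega p = 1 \<longleftrightarrow> fst p = snd p"
proof
  assume *: "omega p = 1"
  have "cnj (b (snd p)) * b (snd p) = 1"
    by (metis complex_norm_square mult.commute norm_b of_real_1 power_one)
  then have "b (fst p) = omega p * b (snd p)" by (simp add: omega_def mult.assoc)
  then show "fst p = snd p" using * inj_b by simp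
next
  assume "fst p = snd p"
  then show "omega p = 1"
    by (simp add: omega_def) (metis complex_norm_square norm_b of_real_1 power_one)
qed

lemma norm_one_minus_omega: "cmod (1 - omega p) = cmod (b (fst p) - b (snd p))"
proof -
  have "b (snd p) * cnj (b (snd p)) = 1"
    by (metis complex_norm_square norm_b of_real_1 power_one)
  then have "1 - omega p = (b (snd p) - b (fst p)) * cnj (b (snd p))"
    by (simp add: omega_def algebra_simps)
  then show ?thesis by (simp add: norm_mult norm_minus_commute)
qed

lemma bounded_mapI: "u \<in> borel_measurable M \<Longrightarrow> (\<And>x. cmod (u x) \<le> C) \<Longrightarrow> bounded_map u"
  unfolding bounded_map_def by blast

lemma bounded_map_measurable [measurable_dest]: "bounded_map u \<Longrightarrow> u \<in> borel_measurable M"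
  unfolding bounded_map_def by blast

lemma bounded_mapE:
  assumes "bounded_map u"
  obtains C where "C \<ge> 0" "\<And>x. cmod (u x) \<le> C"
proof -
  obtain C where C: "\<And>x. cmod (u x) \<le> C" using assms unfolding bounded_map_def by blast
  show thesis using that[of C] C order_trans[OF norm_ge_zero C] by blast
qed

lemma bounded_map_integrable: "bounded_map u \<Longrightarrow> integrable M u"
  unfolding bounded_map_def by (auto intro: integrable_const_bound)

lemma bounded_map_cnj: "bounded_map u \<Longrightarrow> bounded_map (\<lambda>x. cnj (u x))"
  unfolding bounded_map_def by (auto intro: cnj_borel_measurable)

lemma bounded_map_const: "bounded_map (\<lambda>x. c)"
  by (rule bounded_mapI[of _ "cmod c"]) auto

lemma bounded_map_mult:
  assumes "bounded_map u" "bounded_map v"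
  shows "bounded_map (\<lambda>x. u x * v x)"
proof -
  obtain C D where C: "C \<ge> 0" "\<And>x. cmod (u x) \<le> C" and D: "\<And>x. cmod (v x) \<le> D"
    using assms by (metis bounded_mapE)
  show ?thesis
  proof (rule bounded_mapI[of _ "C * D"])
    show "(\<lambda>x. u x * v x) \<in> borel_measurable M" using assms by measurable
    show "cmod (u x * v x) \<le> C * D" for x
      unfolding norm_mult using C D by (intro mult_mono) auto
  qed
qed

lemma bounded_map_add:
  assumes "bounded_map u" "bounded_map v"
  shows "bounded_map (\<lambda>x. u x + v x)"
proof -
  obtain C D where C: "\<And>x. cmod (u x) \<le> C" and D: "\<And>x. cmod (v x) \<le> D"
    using assms by (metis bounded_mapE)
  show ?thesis
  proof (rule bounded_mapI[of _ "C + D"])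
    show "(\<lambda>x. u x + v x) \<in> borel_measurable M" using assms by measurable
    show "cmod (u x + v x) \<le> C + D" for x
      using norm_triangle_ineq[of "u x" "v x"] C[of x] D[of x] by linarith
  qed
qed

lemma bounded_map_diff:
  "bounded_map u \<Longrightarrow> bounded_map v \<Longrightarrow> bounded_map (\<lambda>x. u x - v x)"
  using bounded_map_add[of u "\<lambda>x. (-1) * v x"] bounded_map_mult[OF bounded_map_const[of "-1"], of v]
  by simp

lemma bounded_map_b: "bounded_map b"
  by (rule bounded_mapI[of _ 1]) auto

lemma bounded_map_power:
  "bounded_map u \<Longrightarrow> bounded_map (\<lambda>x. u x ^ n)"
  by (induction n) (auto intro: bounded_map_mult bounded_map_const)

lemma integrable_pairI:
  fixes F :: "'a \<times> 'a \<Rightarrow> 'b::{banach,second_countable_topology}"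
  assumes "F \<in> borel_measurable N" "\<And>p. norm (F p) \<le> C"
  shows "integrable N F"
  using assms by (intro P.integrable_const_bound[of _ C]) auto

lemma pair_integral_mult:
  assumes f: "bounded_map f" and g: "bounded_map g"
  shows "integrable N (\<lambda>p. f (fst p) * g (snd p))"
    and "(\<integral>p. f (fst p) * g (snd p) \<partial>N) = (\<integral>x. f x \<partial>M) * (\<integral>x. g x \<partial>M)"
proof -
  obtain C D where C: "C \<ge> 0" "\<And>x. cmod (f x) \<le> C" and D: "\<And>x. cmod (g x) \<le> D"
    using assms by (metis bounded_mapE)
  show i: "integrable N (\<lambda>p. f (fst p) * g (snd p))"
  proof (rule integrable_pairI[of _ "C * D"])
    have [measurable]: "f \<in> borel_measurable M" "g \<in> borel_measurable M"
      using assms by (simp_all add: bounded_map_measurable)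
    show "(\<lambda>p. f (fst p) * g (snd p)) \<in> borel_measurable N" by measurable
    show "cmod (f (fst p) * g (snd p)) \<le> C * D" for p
      unfolding norm_mult using C D by (intro mult_mono) auto
  qed
  show "(\<integral>p. f (fst p) * g (snd p) \<partial>N) = (\<integral>x. f x \<partial>M) * (\<integral>x. g x \<partial>M)"
    using P.integral_fst'[OF i] by simp
qed

lemma fourier_norm_sq:
  assumes "bounded_map u"
  shows "(cmod (fourier u n))\<^sup>2 = (\<integral>p. Re (u (fst p) * cnj (u (snd p)) * cnj (omega p ^ n)) \<partial>N)"
    and "integrable N (\<lambda>p. u (fst p) * cnj (u (snd p)) * cnj (omega p ^ n))"
proof -
  have f: "bounded_map (\<lambda>x. u x * cnj (b x) ^ n)"
    by (intro bounded_map_mult assms bounded_map_power bounded_map_cnj bounded_map_b)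
  then have g: "bounded_map (\<lambda>x. cnj (u x * cnj (b x) ^ n))" by (rule bounded_map_cnj)
  have eq: "u (fst p) * cnj (u (snd p)) * cnj (omega p ^ n) =
        (u (fst p) * cnj (b (fst p)) ^ n) * cnj (u (snd p) * cnj (b (snd p)) ^ n)" for p
    by (simp add: omega_def power_mult_distrib mult_ac)
  show i: "integrable N (\<lambda>p. u (fst p) * cnj (u (snd p)) * cnj (omega p ^ n))"
    unfolding eq by (rule pair_integral_mult(1)[OF f g])
  have "(\<integral>p. u (fst p) * cnj (u (snd p)) * cnj (omega p ^ n) \<partial>N) = fourier u n * cnj (fourier u n)"
    unfolding eq pair_integral_mult(2)[OF f g] fourier_def Bochner_Integration.integral_cnj ..
  also have "\<dots> = of_real ((cmod (fourier u n))\<^sup>2)" by (rule complex_norm_square[symmetric])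
  finally show "(cmod (fourier u n))\<^sup>2 = (\<integral>p. Re (u (fst p) * cnj (u (snd p)) * cnj (omega p ^ n)) \<partial>N)"
    using integral_Re[OF i] by simp
qed

lemma omega_power_mean_zero:
  assumes "bounded_map f" "n \<ge> 1"
  shows "(\<integral>p. f (fst p) * omega p ^ n \<partial>N) = 0" "(\<integral>p. f (snd p) * omega p ^ n \<partial>N) = 0"
proof -
  have m: "(\<integral>x. cnj (b x) ^ n \<partial>M) = 0"
    using moment[OF assms(2)] Bochner_Integration.integral_cnj[of M "\<lambda>x. b x ^ n"] by simp
  have "(\<integral>p. (f (fst p) * b (fst p) ^ n) * cnj (b (snd p)) ^ n \<partial>N) = 0"
    using assms bounded_map_power[OF bounded_map_b, of n] bounded_map_power[OF bounded_map_cnj[OF bounded_map_b], of n]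
    by (subst pair_integral_mult(2)) (auto intro: bounded_map_mult simp: m)
  then show "(\<integral>p. f (fst p) * omega p ^ n \<partial>N) = 0"
    by (simp add: omega_def power_mult_distrib mult_ac)
  have "(\<integral>p. b (fst p) ^ n * (f (snd p) * cnj (b (snd p)) ^ n) \<partial>N) = 0"
    using assms bounded_map_power[OF bounded_map_b, of n] bounded_map_power[OF bounded_map_cnj[OF bounded_map_b], of n]
    by (subst pair_integral_mult(2)) (auto intro: bounded_map_mult simp: moment)
  then show "(\<integral>p. f (snd p) * omega p ^ n \<partial>N) = 0"
    by (simp add: omega_def power_mult_distrib mult_ac)
qed

text \<open>The product of two coefficients is a double integral against a power of \<open>b x cnj (b y)\<close>. In the sum
  the terms \<open>\<bar>u x\<bar>\<^sup>2\<close> and \<open>\<bar>u y\<bar>\<^sup>2\<close> integrate to zero, which leaves the differences.\<close>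

lemma fourier_sum_formula:
  assumes u: "bounded_map u" and n: "n \<ge> 1"
  shows "(cmod (fourier u n))\<^sup>2 + (cmod (fourier (\<lambda>x. cnj (u x)) n))\<^sup>2
       = - (\<integral>p. (cmod (u (fst p) - u (snd p)))\<^sup>2 * Re (omega p ^ n) \<partial>N)"
    and "(cmod (fourier u n))\<^sup>2 - (cmod (fourier (\<lambda>x. cnj (u x)) n))\<^sup>2
       = (\<integral>p. 2 * Im (u (fst p) * cnj (u (snd p))) * Im (omega p ^ n) \<partial>N)"
proof -
  let ?v = "\<lambda>x. cnj (u x)"
  have v: "bounded_map ?v" by (rule bounded_map_cnj[OF u])
  note iu = integrable_Re[OF fourier_norm_sq(2)[OF u, of n]]
  note iv = integrable_Re[OF fourier_norm_sq(2)[OF v, of n]]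
  obtain C where C: "\<And>x. cmod (u x) \<le> C" using u by (metis bounded_mapE)
  define s where "s x = complex_of_real ((cmod (u x))\<^sup>2)" for x
  have s: "bounded_map s" unfolding s_def
  proof (rule bounded_mapI[of _ "C\<^sup>2"])
    show "(\<lambda>x. complex_of_real ((cmod (u x))\<^sup>2)) \<in> borel_measurable M" using u by measurable
    show "cmod (complex_of_real ((cmod (u x))\<^sup>2)) \<le> C\<^sup>2" for x
      unfolding norm_of_real using C[of x] by (simp add: power_mono)
  qed
  have cn: "bounded_map (\<lambda>x. cnj (b x) ^ n)" "bounded_map (\<lambda>x. b x ^ n)"
    by (intro bounded_map_power bounded_map_cnj bounded_map_b)+
  have i1: "integrable N (\<lambda>p. s (fst p) * omega p ^ n)"
    using pair_integral_mult(1)[OF bounded_map_mult[OF s cn(2)] cn(1)]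
    by (simp add: omega_def power_mult_distrib mult_ac)
  have i2: "integrable N (\<lambda>p. s (snd p) * omega p ^ n)"
    using pair_integral_mult(1)[OF cn(2) bounded_map_mult[OF s cn(1)]]
    by (simp add: omega_def power_mult_distrib mult_ac)
  have i3: "integrable N (\<lambda>p. (cmod (u (fst p) - u (snd p)))\<^sup>2 * Re (omega p ^ n))"
  proof (rule integrable_pairI[of _ "(C + C)\<^sup>2 * 1"])
    show "(\<lambda>p. (cmod (u (fst p) - u (snd p)))\<^sup>2 * Re (omega p ^ n)) \<in> borel_measurable N"
      using bounded_map_measurable[OF u] by measurable
    fix p
    have "cmod (u (fst p) - u (snd p)) \<le> C + C"
      using norm_triangle_ineq4[of "u (fst p)" "u (snd p)"] C[of "fst p"] C[of "snd p"] by linarith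
    moreover have "\<bar>Re (omega p ^ n)\<bar> \<le> 1"
      using abs_Re_le_cmod[of "omega p ^ n"] by (simp add: norm_power)
    ultimately show "norm ((cmod (u (fst p) - u (snd p)))\<^sup>2 * Re (omega p ^ n)) \<le> (C + C)\<^sup>2 * 1"
      unfolding real_norm_def abs_mult abs_power2 by (intro mult_mono power_mono) simp_all
  qed
  have "(cmod (fourier u n))\<^sup>2 + (cmod (fourier ?v n))\<^sup>2 =
      (\<integral>p. Re (u (fst p) * cnj (u (snd p)) * cnj (omega p ^ n)) + Re (?v (fst p) * cnj (?v (snd p)) * cnj (omega p ^ n)) \<partial>N)"
    unfolding fourier_norm_sq(1)[OF u] fourier_norm_sq(1)[OF v] using iu iv by (rule Bochner_Integration.integral_add[symmetric])
  also have "\<dots> = (\<integral>p. (Re (s (fst p) * omega p ^ n) + Re (s (snd p) * omega p ^ n)) -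
       (cmod (u (fst p) - u (snd p)))\<^sup>2 * Re (omega p ^ n) \<partial>N)"
    by (intro Bochner_Integration.integral_cong refl)
       (simp add: s_def cmod_power2 del: complex_cnj_power, simp add: power2_eq_square algebra_simps)
  also have "\<dots> = (Re (\<integral>p. s (fst p) * omega p ^ n \<partial>N) + Re (\<integral>p. s (snd p) * omega p ^ n \<partial>N))
       - (\<integral>p. (cmod (u (fst p) - u (snd p)))\<^sup>2 * Re (omega p ^ n) \<partial>N)"
    using integrable_Re[OF i1] integrable_Re[OF i2] i3
    by (simp add: Bochner_Integration.integral_diff Bochner_Integration.integral_add
        integral_Re[OF i1, symmetric] integral_Re[OF i2, symmetric])
  finally show "(cmod (fourier u n))\<^sup>2 + (cmod (fourier ?v n))\<^sup>2
       = - (\<integral>p. (cmod (u (fst p) - u (snd p)))\<^sup>2 * Re (omega p ^ n) \<partial>N)"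
    using omega_power_mean_zero[OF s n] by simp
  have "(cmod (fourier u n))\<^sup>2 - (cmod (fourier ?v n))\<^sup>2 =
      (\<integral>p. Re (u (fst p) * cnj (u (snd p)) * cnj (omega p ^ n)) - Re (?v (fst p) * cnj (?v (snd p)) * cnj (omega p ^ n)) \<partial>N)"
    unfolding fourier_norm_sq(1)[OF u] fourier_norm_sq(1)[OF v] using iu iv by (rule Bochner_Integration.integral_diff[symmetric])
  also have "\<dots> = (\<integral>p. 2 * Im (u (fst p) * cnj (u (snd p))) * Im (omega p ^ n) \<partial>N)"
    by (intro Bochner_Integration.integral_cong refl) (simp add: algebra_simps del: complex_cnj_power)
  finally show "(cmod (fourier u n))\<^sup>2 - (cmod (fourier ?v n))\<^sup>2 =
     (\<integral>p. 2 * Im (u (fst p) * cnj (u (snd p))) * Im (omega p ^ n) \<partial>N)" .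
qed

lemma koebe_measurable [measurable]: "(\<lambda>p. koebe r (omega p)) \<in> borel_measurable N"
  unfolding koebe_def by measurable

lemma summable_nat_power:
  assumes "0 \<le> r" "r < (1::real)"
  shows "summable (\<lambda>n. real n * r ^ n)"
  using sums_summable[OF sums_mult[OF geometric_deriv_sums[of r], of r]] assms
  by (subst summable_Suc_iff[symmetric]) (simp add: mult_ac)

lemma koebe_integral_sums:
  fixes F :: "'a \<times> 'a \<Rightarrow> real"
  assumes [measurable]: "F \<in> borel_measurable N" and F: "\<And>p. \<bar>F p\<bar> \<le> C" and r: "0 \<le> r" "r < 1"
  shows "(\<lambda>n. \<integral>p. of_real (F p) * (of_nat n * of_real (r ^ n) * omega p ^ n) \<partial>N) sums
         (\<integral>p. of_real (F p) * koebe r (omega p) \<partial>N)"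
    and "integrable N (\<lambda>p. of_real (F p) * koebe r (omega p))"
proof -
  let ?f = "\<lambda>n p. complex_of_real (F p) * (of_nat n * of_real (r ^ n) * omega p ^ n)"
  have nf: "norm (?f n p) = \<bar>F p\<bar> * (real n * r ^ n)" for n p
    using r by (simp add: norm_mult norm_power)
  have i: "integrable N (?f n)" for n
  proof (rule integrable_pairI[of _ "C * (real n * r ^ n)"])
    show "norm (?f n p) \<le> C * (real n * r ^ n)" for p
      unfolding nf using F r by (intro mult_right_mono) auto
  qed measurable
  have s: "AE p in N. summable (\<lambda>n. norm (?f n p))"
    unfolding nf using summable_nat_power[OF r] by (intro always_eventually) (auto intro: summable_mult)
  have s2: "summable (\<lambda>n. \<integral>p. norm (?f n p) \<partial>N)"
  proof (rule summable_comparison_test'[OF summable_mult[OF summable_nat_power[OF r], of C]])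
    fix n
    have "(\<integral>p. norm (?f n p) \<partial>N) \<le> (\<integral>p. C * (real n * r ^ n) \<partial>N)"
      unfolding nf using F r integrable_norm[OF i[of n]] unfolding nf
      by (intro integral_mono) (auto intro: mult_right_mono)
    then show "norm (\<integral>p. norm (?f n p) \<partial>N) \<le> C * (real n * r ^ n)"
      by (simp add: P.prob_space integral_nonneg_AE)
  qed
  have eq: "(\<Sum>n. ?f n p) = of_real (F p) * koebe r (omega p)" for p
    using sums_unique[OF sums_mult[OF koebe_sums[OF norm_omega r]]] by metis
  show "(\<lambda>n. \<integral>p. ?f n p \<partial>N) sums (\<integral>p. of_real (F p) * koebe r (omega p) \<partial>N)"
    using sums_integral[OF i s s2] unfolding eq .
  show "integrable N (\<lambda>p. of_real (F p) * koebe r (omega p))"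
    using integrable_suminf[OF i s s2] unfolding eq .
qed

lemma koebe_integral_sums_Re:
  fixes F :: "'a \<times> 'a \<Rightarrow> real"
  assumes F: "F \<in> borel_measurable N" "\<And>p. \<bar>F p\<bar> \<le> C" and r: "0 \<le> r" "r < 1"
  shows "(\<lambda>n. r ^ n * (real n * (\<integral>p. F p * Re (omega p ^ n) \<partial>N))) sums (\<integral>p. F p * Re (koebe r (omega p)) \<partial>N)"
    and "(\<lambda>n. r ^ n * (real n * (\<integral>p. F p * Im (omega p ^ n) \<partial>N))) sums (\<integral>p. F p * Im (koebe r (omega p)) \<partial>N)"
proof -
  have i: "integrable N (\<lambda>p. of_real (F p) * (of_nat n * of_real (r ^ n) * omega p ^ n))" for n
  proof (rule integrable_pairI[of _ "C * (real n * r ^ n)"])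
    show "norm (complex_of_real (F p) * (of_nat n * of_real (r ^ n) * omega p ^ n)) \<le> C * (real n * r ^ n)" for p
      using F r by (simp add: norm_mult norm_power mult_right_mono)
  qed (use F in measurable)
  have e: "Re (of_real (F p) * (of_nat n * of_real (r ^ n) * omega p ^ n)) = (r ^ n * real n) * (F p * Re (omega p ^ n))"
       "Im (of_real (F p) * (of_nat n * of_real (r ^ n) * omega p ^ n)) = (r ^ n * real n) * (F p * Im (omega p ^ n))" for p n
  proof -
    have "of_real (F p) * (of_nat n * of_real (r ^ n) * omega p ^ n) = (r ^ n * real n * F p) *\<^sub>R (omega p ^ n)"
      by (simp add: scaleR_conv_of_real mult_ac)
    then show "Re (of_real (F p) * (of_nat n * of_real (r ^ n) * omega p ^ n)) = (r ^ n * real n) * (F p * Re (omega p ^ n))"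
       "Im (of_real (F p) * (of_nat n * of_real (r ^ n) * omega p ^ n)) = (r ^ n * real n) * (F p * Im (omega p ^ n))"
      by (simp_all only: scaleR_complex.sel mult.assoc)
  qed
  show "(\<lambda>n. r ^ n * (real n * (\<integral>p. F p * Re (omega p ^ n) \<partial>N))) sums (\<integral>p. F p * Re (koebe r (omega p)) \<partial>N)"
    using sums_Re[OF koebe_integral_sums(1)[OF F r]] integral_Re[OF koebe_integral_sums(2)[OF F r]]
    unfolding integral_Re[OF i, symmetric] e by (simp add: mult.assoc)
  show "(\<lambda>n. r ^ n * (real n * (\<integral>p. F p * Im (omega p ^ n) \<partial>N))) sums (\<integral>p. F p * Im (koebe r (omega p)) \<partial>N)"
    using sums_Im[OF koebe_integral_sums(1)[OF F r]] integral_Im[OF koebe_integral_sums(2)[OF F r]]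
    unfolding integral_Im[OF i, symmetric] e by (simp add: mult.assoc)
qed

end

definition rad :: "nat \<Rightarrow> real" where "rad k = real k / real (Suc k)"

lemma rad: "0 \<le> rad k" "rad k < 1" "rad \<longlonglongrightarrow> 1"
  using LIMSEQ_n_over_Suc_n[where 'a = real] by (auto simp: rad_def[abs_def])

lemma norm_cis_diff: "cmod (cis a - cis b) \<le> \<bar>a - b\<bar>"
proof -
  have "(cmod (cis a - cis b))\<^sup>2 = 2 - 2 * cos (a - b)"
    unfolding cmod_power2 using sin_cos_squared_add[of a] sin_cos_squared_add[of b]
    by (simp add: cos_diff power2_eq_square algebra_simps)
  also have "\<dots> = 4 * (sin ((a - b) / 2))\<^sup>2"
  proof -
    have "2 * ((a - b) / 2) = a - b" by simp
    with cos_double_sin[of "(a - b) / 2"] show ?thesis by (simp only:) simp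
  qed
  also have "\<dots> \<le> 4 * ((a - b) / 2)\<^sup>2"
    using power_mono[OF abs_sin_x_le_abs_x[of "(a - b) / 2"], of 2] by (simp only: power2_abs abs_ge_zero) simp
  also have "\<dots> = \<bar>a - b\<bar>\<^sup>2" by (simp add: power_divide)
  finally show ?thesis by (rule power2_le_imp_le) simp
qed

lemma Ln_lipschitz:
  assumes "c > 0" "Re z \<ge> c" "Re w \<ge> c"
  shows "cmod (Ln z - Ln w) \<le> cmod (z - w) / c"
proof -
  have "cmod (Ln z - Ln w) \<le> (1 / c) * cmod (z - w)"
  proof (rule field_differentiable_bound[OF convex_halfspace_Re_ge[of c], where f' = inverse])
    fix z assume "z \<in> {z. c \<le> Re z}"
    then have z: "c \<le> Re z" by simp
    then have "z \<notin> \<real>\<^sub>\<le>\<^sub>0" using assms by (auto simp: complex_nonpos_Reals_iff)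
    then show "(Ln has_field_derivative inverse z) (at z within {z. c \<le> Re z})"
      by (rule has_field_derivative_at_within[OF has_field_derivative_Ln])
    have "c \<le> cmod z" using z complex_Re_le_cmod[of z] by linarith
    then show "cmod (inverse z) \<le> 1 / c"
      unfolding norm_inverse using assms by (simp add: le_imp_inverse_le divide_inverse)
  qed (use assms in auto)
  then show ?thesis by simp
qed

context circle_space
begin

section \<open>The energy identity and the degree\<close>

lemma quot_nonneg: "0 \<le> quot u p"
  by (simp add: quot_def)

lemma quot_measurable [measurable (raw)]:
  assumes [measurable]: "u \<in> borel_measurable M"
  shows "quot u \<in> borel_measurable N"
  unfolding quot_def[abs_def] by measurable

lemma koebe_quot_le:
  assumes "0 \<le> r"
  shows "(cmod (u (fst p) - u (snd p)))\<^sup>2 * cmod (koebe r (omega p)) \<le> quot u p"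
proof (cases "omega p = 1")
  case True
  then have "fst p = snd p" by (simp add: omega_eq_1_iff)
  then show ?thesis by (simp add: quot_def)
next
  case False
  then have "cmod (koebe r (omega p)) \<le> 1 / (cmod (b (fst p) - b (snd p)))\<^sup>2"
    using norm_koebe_le[OF norm_omega assms, of p] norm_one_minus_omega[of p] by simp
  then show ?thesis unfolding quot_def
    by (metis mult_left_mono times_divide_eq_right mult.right_neutral zero_le_power2)
qed

lemma finite_dirichlet_bounded: "finite_dirichlet u \<Longrightarrow> bounded_map u"
  by (simp add: finite_dirichlet_def)

lemma bounded_diff_sq:
  assumes "bounded_map u"
  obtains C where "\<And>p. \<bar>(cmod (u (fst p) - u (snd p)))\<^sup>2\<bar> \<le> C"
proof -
  obtain C where C: "C \<ge> 0" "\<And>x. cmod (u x) \<le> C" using assms by (metis bounded_mapE)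
  show thesis
  proof (rule that[of "(C + C)\<^sup>2"])
    fix p
    have "cmod (u (fst p) - u (snd p)) \<le> C + C"
      using norm_triangle_ineq4[of "u (fst p)" "u (snd p)"] C(2)[of "fst p"] C(2)[of "snd p"] by linarith
    then show "\<bar>(cmod (u (fst p) - u (snd p)))\<^sup>2\<bar> \<le> (C + C)\<^sup>2"
      unfolding abs_power2 by (intro power_mono) simp_all
  qed
qed

text \<open>Abel summation of \<open>fourier_sum_formula\<close> gives integrals against the Koebe function, and dominated convergence
  evaluates their limits: the sum of the two series is the energy, and their difference is a limit of integrals in which only the phase
  differences of \<open>u\<close> enter.\<close>

lemma hardy_sum:
  assumes u: "finite_dirichlet u"
  shows "summable (\<lambda>n. real n * (cmod (fourier u n))\<^sup>2)"
    and "summable (\<lambda>n. real n * (cmod (fourier (\<lambda>x. cnj (u x)) n))\<^sup>2)"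
    and "hardy u + hardy (\<lambda>x. cnj (u x)) = dirichlet u"
    and "(\<lambda>k. \<integral>p. 2 * Im (u (fst p) * cnj (u (snd p))) * Im (koebe (rad k) (omega p)) \<partial>N) \<longlonglongrightarrow> deg u"
proof -
  have bu: "bounded_map u" and [measurable]: "u \<in> borel_measurable M" and iq: "integrable N (quot u)"
    using u by (auto simp: finite_dirichlet_def bounded_map_def)
  let ?A = "\<lambda>n. real n * (cmod (fourier u n))\<^sup>2"
  let ?B = "\<lambda>n. real n * (cmod (fourier (\<lambda>x. cnj (u x)) n))\<^sup>2"
  let ?F = "\<lambda>p. (cmod (u (fst p) - u (snd p)))\<^sup>2"
  let ?I = "\<lambda>p. 2 * Im (u (fst p) * cnj (u (snd p)))"
  obtain C where C: "\<And>p. \<bar>?F p\<bar> \<le> C" using bounded_diff_sq[OF bu] by blast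
  obtain D where D: "D \<ge> 0" "\<And>x. cmod (u x) \<le> D" using bu by (metis bounded_mapE)
  have E: "\<bar>?I p\<bar> \<le> 2 * (D * D)" for p
  proof -
    have "\<bar>Im (u (fst p) * cnj (u (snd p)))\<bar> \<le> cmod (u (fst p)) * cmod (u (snd p))"
      by (metis abs_Im_le_cmod complex_mod_cnj norm_mult)
    also have "\<dots> \<le> D * D" using D by (intro mult_mono) auto
    finally show ?thesis by (simp add: abs_mult)
  qed
  have Fm: "?F \<in> borel_measurable N" "?I \<in> borel_measurable N" by measurable
  have sum_AB: "(\<lambda>n. r ^ n * (?A n + ?B n)) sums (- (\<integral>p. ?F p * Re (koebe r (omega p)) \<partial>N))"
    if r: "0 \<le> r" "r < 1" for r
  proof -
    have eq: "?A n + ?B n = - (real n * (\<integral>p. ?F p * Re (omega p ^ n) \<partial>N))" for n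
    proof (cases "n = 0")
      case False
      then have "?A n + ?B n = real n * ((cmod (fourier u n))\<^sup>2 + (cmod (fourier (\<lambda>x. cnj (u x)) n))\<^sup>2)"
        by (simp add: distrib_left)
      then show ?thesis using fourier_sum_formula(1)[OF bu, of n] False by simp
    qed simp
    show ?thesis using sums_minus[OF koebe_integral_sums_Re(1)[OF Fm(1) C r]] unfolding eq by simp
  qed
  have diff_AB: "(\<lambda>n. r ^ n * (?A n - ?B n)) sums (\<integral>p. ?I p * Im (koebe r (omega p)) \<partial>N)"
    if r: "0 \<le> r" "r < 1" for r
  proof -
    have eq: "?A n - ?B n = real n * (\<integral>p. ?I p * Im (omega p ^ n) \<partial>N)" for n
    proof (cases "n = 0")
      case False
      then have "?A n - ?B n = real n * ((cmod (fourier u n))\<^sup>2 - (cmod (fourier (\<lambda>x. cnj (u x)) n))\<^sup>2)"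
        by (simp add: right_diff_distrib)
      then show ?thesis using fourier_sum_formula(2)[OF bu, of n] False by simp
    qed simp
    show ?thesis using koebe_integral_sums_Re(2)[OF Fm(2) E r] unfolding eq .
  qed
  have lim: "(\<lambda>k. - (\<integral>p. ?F p * Re (koebe (rad k) (omega p)) \<partial>N)) \<longlonglongrightarrow> dirichlet u"
  proof -
    have "(\<lambda>k. \<integral>p. - (?F p * Re (koebe (rad k) (omega p))) \<partial>N) \<longlonglongrightarrow> (\<integral>p. quot u p \<partial>N)"
    proof (rule integral_dominated_convergence[where w = "quot u"])
      show "AE p in N. (\<lambda>k. - (?F p * Re (koebe (rad k) (omega p)))) \<longlonglongrightarrow> quot u p"
      proof (intro always_eventually allI)
        fix p
        show "(\<lambda>k. - (?F p * Re (koebe (rad k) (omega p)))) \<longlonglongrightarrow> quot u p"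
        proof (cases "omega p = 1")
          case True
          then have "fst p = snd p" by (simp add: omega_eq_1_iff)
          then show ?thesis by (simp add: quot_def)
        next
          case False
          have "(\<lambda>k. - (?F p * Re (koebe (rad k) (omega p)))) \<longlonglongrightarrow> - (?F p * Re (- of_real (1 / (cmod (1 - omega p))\<^sup>2)))"
            by (intro tendsto_intros koebe_tendsto False norm_omega rad)
          then show ?thesis unfolding norm_one_minus_omega by (simp add: quot_def)
        qed
      qed
      show "AE p in N. norm (- (?F p * Re (koebe (rad k) (omega p)))) \<le> quot u p" for k
      proof (intro always_eventually allI)
        fix p
        have "norm (- (?F p * Re (koebe (rad k) (omega p)))) \<le> ?F p * cmod (koebe (rad k) (omega p))"
          by (simp add: abs_mult mult_left_mono abs_Re_le_cmod)
        then show "norm (- (?F p * Re (koebe (rad k) (omega p)))) \<le> quot u p"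
          using koebe_quot_le[OF rad(1)] by (rule order_trans)
      qed
    qed (use iq in measurable)
    then show ?thesis by (simp add: dirichlet_def)
  qed
  have nn: "0 \<le> ?A n" "0 \<le> ?B n" "0 \<le> ?A n + ?B n" for n by auto
  have sAB: "summable (\<lambda>n. ?A n + ?B n)"
  proof -
    have "summable (\<lambda>n. ?A n + ?B n) \<and> (\<Sum>n. ?A n + ?B n) \<le> dirichlet u"
    proof (rule sum_nonneg_limit_summable[OF nn(3) rad(3) rad(1) rad(2) _ _ lim])
      fix k
      show "summable (\<lambda>n. rad k ^ n * (?A n + ?B n))"
        by (rule sums_summable[OF sum_AB[OF rad(1,2)]])
      show "(\<Sum>n. rad k ^ n * (?A n + ?B n)) \<le> - (\<integral>p. ?F p * Re (koebe (rad k) (omega p)) \<partial>N)"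
        using sums_unique[OF sum_AB[OF rad(1,2)[of k]]] by linarith
    qed
    then show ?thesis ..
  qed
  show sA: "summable ?A" by (rule summable_comparison_test'[OF sAB]) auto
  show sB: "summable ?B" by (rule summable_comparison_test'[OF sAB]) auto
  have "(\<lambda>k. \<Sum>n. rad k ^ n * (?A n + ?B n)) \<longlonglongrightarrow> (\<Sum>n. ?A n + ?B n)"
    by (rule abel_suminf) (use nn rad sAB in auto)
  then have "(\<lambda>k. - (\<integral>p. ?F p * Re (koebe (rad k) (omega p)) \<partial>N)) \<longlonglongrightarrow> (\<Sum>n. ?A n + ?B n)"
    using sums_unique[OF sum_AB] rad by simp
  then have "(\<Sum>n. ?A n + ?B n) = dirichlet u" using lim LIMSEQ_unique by blast
  then show "hardy u + hardy (\<lambda>x. cnj (u x)) = dirichlet u"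
    unfolding hardy_def using suminf_add[OF sA sB] by simp
  have sr: "summable (\<lambda>n. rad k ^ n * ?A n)" "summable (\<lambda>n. rad k ^ n * ?B n)" for k
  proof -
    have p: "rad k ^ n \<le> 1" for n using rad by (simp add: power_le_one less_imp_le)
    show "summable (\<lambda>n. rad k ^ n * ?A n)"
      by (rule summable_comparison_test'[OF sA]) (use p rad in \<open>simp add: abs_mult mult_left_le_one_le\<close>)
    show "summable (\<lambda>n. rad k ^ n * ?B n)"
      by (rule summable_comparison_test'[OF sB]) (use p rad in \<open>simp add: abs_mult mult_left_le_one_le\<close>)
  qed
  have "(\<lambda>k. (\<Sum>n. rad k ^ n * ?A n) - (\<Sum>n. rad k ^ n * ?B n)) \<longlonglongrightarrow> suminf ?A - suminf ?B"
    by (intro tendsto_diff abel_suminf sA sB) (use rad in auto)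
  moreover have "(\<Sum>n. rad k ^ n * ?A n) - (\<Sum>n. rad k ^ n * ?B n) = (\<integral>p. ?I p * Im (koebe (rad k) (omega p)) \<partial>N)" for k
    using suminf_diff[OF sr(1)[of k] sr(2)[of k]] sums_unique[OF diff_AB[OF rad(1,2)[of k]]]
    by (simp add: right_diff_distrib)
  ultimately show "(\<lambda>k. \<integral>p. ?I p * Im (koebe (rad k) (omega p)) \<partial>N) \<longlonglongrightarrow> deg u"
    by (simp add: deg_def hardy_def)
qed

lemma hardy_nonneg:
  assumes "finite_dirichlet u"
  shows "0 \<le> hardy u" "0 \<le> hardy (\<lambda>x. cnj (u x))"
  unfolding hardy_def using hardy_sum(1,2)[OF assms] by (auto intro: suminf_nonneg)


lemma dirichlet_nonneg: "0 \<le> dirichlet u"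
  unfolding dirichlet_def by (intro integral_nonneg_AE always_eventually) (simp add: quot_nonneg)

lemma abs_deg_le: "finite_dirichlet u \<Longrightarrow> \<bar>deg u\<bar> \<le> dirichlet u"
  using hardy_nonneg[of u] hardy_sum(3)[of u] by (simp add: deg_def)

lemma deg_cnj: "deg (\<lambda>x. cnj (u x)) = - deg u"
  by (simp add: deg_def)

lemma finite_dirichletI:
  assumes v: "bounded_map v" and w: "integrable N w" and le: "\<And>p. quot v p \<le> w p"
  shows "finite_dirichlet v" "dirichlet v \<le> (\<integral>p. w p \<partial>N)"
proof -
  have [measurable]: "v \<in> borel_measurable M" using v by (rule bounded_map_measurable)
  have i: "integrable N (quot v)"
    by (rule Bochner_Integration.integrable_bound[OF w])
       (measurable, use le quot_nonneg[of v] in \<open>auto intro: order_trans[OF le abs_ge_self]\<close>)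
  then show "finite_dirichlet v" using v by (simp add: finite_dirichlet_def)
  show "dirichlet v \<le> (\<integral>p. w p \<partial>N)" unfolding dirichlet_def by (intro integral_mono i w le)
qed

lemma quot_lipschitz:
  assumes "\<And>x y. cmod (v x - v y) \<le> C * cmod (u x - u y)"
  shows "quot v p \<le> C\<^sup>2 * quot u p"
proof -
  have "(cmod (v (fst p) - v (snd p)))\<^sup>2 \<le> (C * cmod (u (fst p) - u (snd p)))\<^sup>2"
    using assms by (intro power_mono) auto
  then show ?thesis unfolding quot_def power_mult_distrib times_divide_eq_right
    by (rule divide_right_mono) simp
qed

lemma finite_dirichlet_lipschitz:
  assumes v: "bounded_map v" and u: "finite_dirichlet u"
    and le: "\<And>x y. cmod (v x - v y) \<le> C * cmod (u x - u y)"
  shows "finite_dirichlet v" "dirichlet v \<le> C\<^sup>2 * dirichlet u"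
proof -
  have i: "integrable N (\<lambda>p. C\<^sup>2 * quot u p)" using u by (simp add: finite_dirichlet_def)
  show "finite_dirichlet v" "dirichlet v \<le> C\<^sup>2 * dirichlet u"
    using finite_dirichletI[OF v i quot_lipschitz[of v C u]] le by (simp_all add: dirichlet_def)
qed

lemma finite_dirichlet_cnj:
  assumes "finite_dirichlet u"
  shows "finite_dirichlet (\<lambda>x. cnj (u x))"
proof (rule finite_dirichlet_lipschitz(1)[OF bounded_map_cnj assms, where C = 1])
  show "bounded_map u" using assms by (rule finite_dirichlet_bounded)
  show "cmod (cnj (u x) - cnj (u y)) \<le> 1 * cmod (u x - u y)" for x y
    by (metis complex_cnj_diff complex_mod_cnj mult_1 order_refl)
qed

lemma quot_b_le: "quot b p \<le> 1"
  by (simp add: quot_def divide_le_eq_1)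

lemma finite_dirichlet_b: "finite_dirichlet b"
  by (rule finite_dirichletI(1)[OF bounded_map_b _ quot_b_le]) simp

lemma finite_dirichlet_chord_lipschitz:
  assumes "bounded_map v" "\<And>x y. cmod (v x - v y) \<le> C * cmod (b x - b y)"
  shows "finite_dirichlet v"
  by (rule finite_dirichlet_lipschitz(1)[OF assms(1) finite_dirichlet_b assms(2)])

lemma finite_dirichlet_const: "finite_dirichlet (\<lambda>x. c)" "dirichlet (\<lambda>x. c) = 0"
  using finite_dirichlet_lipschitz[OF bounded_map_const[of c] finite_dirichlet_b, where C = 0] dirichlet_nonneg[of "\<lambda>x. c"]
  by auto

lemma quot_mult_le:
  assumes "\<And>x. cmod (u x) \<le> C" "\<And>x. cmod (v x) \<le> D"
  shows "quot (\<lambda>x. u x * v x) p \<le> 2 * C\<^sup>2 * quot v p + 2 * D\<^sup>2 * quot u p"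
proof -
  have C: "C \<ge> 0" and D: "D \<ge> 0" using order_trans[OF norm_ge_zero] assms by blast+
  obtain x y where p: "p = (x, y)" by (cases p)
  have "u x * v x - u y * v y = u x * (v x - v y) + v y * (u x - u y)" by algebra
  then have "cmod (u x * v x - u y * v y) \<le> cmod (u x) * cmod (v x - v y) + cmod (v y) * cmod (u x - u y)"
    by (metis norm_mult norm_triangle_ineq)
  also have "\<dots> \<le> C * cmod (v x - v y) + D * cmod (u x - u y)"
    using assms by (intro add_mono mult_right_mono) auto
  finally have "(cmod (u x * v x - u y * v y))\<^sup>2 \<le> (C * cmod (v x - v y) + D * cmod (u x - u y))\<^sup>2"
    by (intro power_mono) auto
  also have "\<dots> \<le> 2 * (C * cmod (v x - v y))\<^sup>2 + 2 * (D * cmod (u x - u y))\<^sup>2"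
    using zero_le_power2[of "C * cmod (v x - v y) - D * cmod (u x - u y)"]
    by (simp add: power2_sum power2_diff)
  finally have "(cmod (u x * v x - u y * v y))\<^sup>2 / (cmod (b x - b y))\<^sup>2 \<le>
     (2 * (C * cmod (v x - v y))\<^sup>2 + 2 * (D * cmod (u x - u y))\<^sup>2) / (cmod (b x - b y))\<^sup>2"
    by (rule divide_right_mono) simp
  then show ?thesis by (simp add: quot_def p power_mult_distrib add_divide_distrib mult.assoc)
qed

lemma finite_dirichlet_mult:
  assumes u: "finite_dirichlet u" and v: "finite_dirichlet v"
  shows "finite_dirichlet (\<lambda>x. u x * v x)"
proof -
  obtain C D where C: "\<And>x. cmod (u x) \<le> C" and D: "\<And>x. cmod (v x) \<le> D"
    using assms finite_dirichlet_bounded bounded_mapE by metis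
  show ?thesis
  proof (rule finite_dirichletI(1)[OF bounded_map_mult _ quot_mult_le[OF C D]])
    show "integrable N (\<lambda>p. 2 * C\<^sup>2 * quot v p + 2 * D\<^sup>2 * quot u p)"
      using assms by (simp add: finite_dirichlet_def)
  qed (use assms finite_dirichlet_bounded in auto)
qed

lemma finite_dirichlet_diff:
  assumes u: "finite_dirichlet u" and v: "finite_dirichlet v"
  shows "finite_dirichlet (\<lambda>x. u x - v x)" "dirichlet (\<lambda>x. u x - v x) \<le> 2 * dirichlet u + 2 * dirichlet v"
proof -
  have le: "quot (\<lambda>x. u x - v x) p \<le> 2 * quot u p + 2 * quot v p" for p
  proof -
    obtain x y where p: "p = (x, y)" by (cases p)
    have "cmod (u x - v x - (u y - v y)) \<le> cmod (u x - u y) + cmod (v x - v y)"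
      using norm_triangle_ineq4[of "u x - u y" "v x - v y"] by (simp add: algebra_simps)
    then have "(cmod (u x - v x - (u y - v y)))\<^sup>2 \<le> (cmod (u x - u y) + cmod (v x - v y))\<^sup>2"
      by (intro power_mono) auto
    also have "\<dots> \<le> 2 * (cmod (u x - u y))\<^sup>2 + 2 * (cmod (v x - v y))\<^sup>2"
      using zero_le_power2[of "cmod (u x - u y) - cmod (v x - v y)"]
      by (simp add: power2_sum power2_diff)
    finally have "(cmod (u x - v x - (u y - v y)))\<^sup>2 / (cmod (b x - b y))\<^sup>2 \<le>
       (2 * (cmod (u x - u y))\<^sup>2 + 2 * (cmod (v x - v y))\<^sup>2) / (cmod (b x - b y))\<^sup>2"
      by (rule divide_right_mono) simp
    then show ?thesis by (simp add: quot_def p add_divide_distrib)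
  qed
  have i: "integrable N (\<lambda>p. 2 * quot u p + 2 * quot v p)" using u v by (simp add: finite_dirichlet_def)
  have bm: "bounded_map (\<lambda>x. u x - v x)"
    by (intro bounded_map_diff finite_dirichlet_bounded u v)
  show "finite_dirichlet (\<lambda>x. u x - v x)" by (rule finite_dirichletI(1)[OF bm i le])
  show "dirichlet (\<lambda>x. u x - v x) \<le> 2 * dirichlet u + 2 * dirichlet v"
    using finite_dirichletI(2)[OF bm i le] u v by (simp add: finite_dirichlet_def dirichlet_def)
qed

lemma finite_dirichlet_add:
  assumes u: "finite_dirichlet u" and v: "finite_dirichlet v"
  shows "finite_dirichlet (\<lambda>x. u x + v x)"
  using finite_dirichlet_diff(1)[OF u finite_dirichlet_mult[OF finite_dirichlet_const(1)[of "-1"] v]] by simp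

lemma finite_dirichlet_sum:
  "finite A \<Longrightarrow> (\<And>i. i \<in> A \<Longrightarrow> finite_dirichlet (f i)) \<Longrightarrow> finite_dirichlet (\<lambda>x. \<Sum>i\<in>A. f i x)"
  by (induction A rule: finite_induct) (auto intro: finite_dirichlet_const finite_dirichlet_add)

lemma finite_dirichlet_power: "finite_dirichlet u \<Longrightarrow> finite_dirichlet (\<lambda>x. u x ^ n)"
  by (induction n) (auto intro: finite_dirichlet_const finite_dirichlet_mult)

definition circle_map :: "('a \<Rightarrow> complex) \<Rightarrow> bool" where
  "circle_map u \<longleftrightarrow> finite_dirichlet u \<and> (\<forall>x. cmod (u x) = 1)"

lemma circle_mapD:
  assumes "circle_map u"
  shows "finite_dirichlet u" "bounded_map u" "u \<in> borel_measurable M" "integrable N (quot u)" "cmod (u x) = 1"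
  using assms by (auto simp: circle_map_def finite_dirichlet_def bounded_map_def)

lemma circle_map_mult: "circle_map u \<Longrightarrow> circle_map v \<Longrightarrow> circle_map (\<lambda>x. u x * v x)"
  by (simp add: circle_map_def finite_dirichlet_mult norm_mult)

lemma circle_map_cnj: "circle_map u \<Longrightarrow> circle_map (\<lambda>x. cnj (u x))"
  by (simp add: circle_map_def finite_dirichlet_cnj)

lemma circle_map_const: "cmod c = 1 \<Longrightarrow> circle_map (\<lambda>x. c)"
  by (simp add: circle_map_def finite_dirichlet_const)

lemma circle_map_b: "circle_map b"
  by (simp add: circle_map_def finite_dirichlet_b)

lemma deg_const: "deg (\<lambda>x. c) = 0"
  using abs_deg_le[OF finite_dirichlet_const(1)[of c]] finite_dirichlet_const(2)[of c] by force

lemma unimodular_cross: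
  assumes "cmod z = 1" "cmod w = 1"
  shows "1 - Re (z * cnj w) = (cmod (z - w))\<^sup>2 / 2"
proof -
  have "(Re z)\<^sup>2 + (Im z)\<^sup>2 = 1" "(Re w)\<^sup>2 + (Im w)\<^sup>2 = 1"
    using assms cmod_power2[of z] cmod_power2[of w] by simp_all
  then show ?thesis unfolding cmod_power2 by (simp add: power2_eq_square algebra_simps)
qed

text \<open>For unimodular maps the integrand of \<open>deg (f g)\<close> splits into those of the two factors plus a
  remainder that is quadratic in the differences, hence integrable against \<open>1 / \<bar>b x - b y\<bar>\<^sup>2\<close>; since the
  imaginary part of the Koebe function vanishes in the limit, so does the remainder.\<close>

lemma deg_mult:
  assumes f: "circle_map f" and g: "circle_map g"
  shows "deg (\<lambda>x. f x * g x) = deg f + deg g"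
proof -
  let ?h = "\<lambda>x. f x * g x"
  have h: "circle_map ?h" by (rule circle_map_mult[OF f g])
  note [measurable] = circle_mapD(3)[OF f] circle_mapD(3)[OF g]
  let ?I = "\<lambda>u p. 2 * Im (u (fst p) * cnj (u (snd p)))"
  let ?R = "\<lambda>p. ?I ?h p - ?I f p - ?I g p"
  have R: "\<bar>?R p\<bar> \<le> (cmod (f (fst p) - f (snd p)))\<^sup>2 + (cmod (g (fst p) - g (snd p)))\<^sup>2" for p
  proof -
    define z where "z = f (fst p) * cnj (f (snd p))"
    define w where "w = g (fst p) * cnj (g (snd p))"
    have n: "cmod z = 1" "cmod w = 1" using f g by (simp_all add: z_def w_def norm_mult circle_mapD)
    have z: "1 - Re z = (cmod (f (fst p) - f (snd p)))\<^sup>2 / 2" and w: "1 - Re w = (cmod (g (fst p) - g (snd p)))\<^sup>2 / 2"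
      unfolding z_def w_def using f g by (intro unimodular_cross; simp add: circle_mapD)+
    have "?R p = 2 * Im (z * w) - 2 * Im z - 2 * Im w" by (simp add: z_def w_def algebra_simps)
    also have "\<dots> = - 2 * (Im z * (1 - Re w) + Im w * (1 - Re z))" by (simp add: algebra_simps)
    finally have "\<bar>?R p\<bar> = 2 * \<bar>Im z * (1 - Re w) + Im w * (1 - Re z)\<bar>" by (simp only: abs_mult)
    also have "\<dots> \<le> 2 * (\<bar>Im z\<bar> * \<bar>1 - Re w\<bar> + \<bar>Im w\<bar> * \<bar>1 - Re z\<bar>)"
      using abs_triangle_ineq[of "Im z * (1 - Re w)" "Im w * (1 - Re z)"] by (simp add: abs_mult)
    also have "\<dots> \<le> 2 * (1 * \<bar>1 - Re w\<bar> + 1 * \<bar>1 - Re z\<bar>)"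
      using abs_Im_le_cmod[of z] abs_Im_le_cmod[of w] n
      by (intro mult_left_mono add_mono mult_right_mono) auto
    finally show ?thesis using z w by simp
  qed
  have i: "integrable N (\<lambda>p. ?I u p * Im (koebe (rad k) (omega p)))" if u: "circle_map u" for u k
  proof (rule Bochner_Integration.integrable_bound)
    show "integrable N (\<lambda>p. of_real (?I u p) * koebe (rad k) (omega p))"
    proof (rule koebe_integral_sums(2)[OF _ _ rad(1,2)])
      note [measurable] = circle_mapD(3)[OF u]
      show "(\<lambda>p. ?I u p) \<in> borel_measurable N" by measurable
      show "\<bar>?I u p\<bar> \<le> 2" for p
        using abs_Im_le_cmod[of "u (fst p) * cnj (u (snd p))"] u by (simp add: norm_mult circle_mapD abs_mult)
    qed
    show "(\<lambda>p. ?I u p * Im (koebe (rad k) (omega p))) \<in> borel_measurable N"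
      using circle_mapD(3)[OF u] by measurable
    show "AE p in N. norm (?I u p * Im (koebe (rad k) (omega p))) \<le> norm (of_real (?I u p) * koebe (rad k) (omega p))"
    proof (intro always_eventually allI)
      have "norm (a * Im z) \<le> norm (of_real a * z)" for a :: real and z
        by (simp add: norm_mult abs_mult mult_left_mono abs_Im_le_cmod)
      then show "norm (?I u p * Im (koebe (rad k) (omega p))) \<le> norm (of_real (?I u p) * koebe (rad k) (omega p))" for p .
    qed
  qed
  have l1: "(\<lambda>k. \<integral>p. ?R p * Im (koebe (rad k) (omega p)) \<partial>N) \<longlonglongrightarrow> (\<integral>p. 0 \<partial>N)"
  proof (rule integral_dominated_convergence[where w = "\<lambda>p. quot f p + quot g p"])
    show "AE p in N. (\<lambda>k. ?R p * Im (koebe (rad k) (omega p))) \<longlonglongrightarrow> 0"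
    proof (intro always_eventually allI)
      fix p
      show "(\<lambda>k. ?R p * Im (koebe (rad k) (omega p))) \<longlonglongrightarrow> 0"
      proof (cases "omega p = 1")
        case True
        then have "fst p = snd p" by (simp add: omega_eq_1_iff)
        then have "?R p = 0" using R[of p] by simp
        then show ?thesis by (simp del: times_complex.sel)
      next
        case False
        have "(\<lambda>k. ?R p * Im (koebe (rad k) (omega p))) \<longlonglongrightarrow> ?R p * Im (- of_real (1 / (cmod (1 - omega p))\<^sup>2))"
          by (intro tendsto_intros koebe_tendsto False norm_omega rad)
        then show ?thesis by simp
      qed
    qed
    show "AE p in N. norm (?R p * Im (koebe (rad k) (omega p))) \<le> quot f p + quot g p" for k
    proof (intro always_eventually allI)
      fix p
      have "norm (?R p * Im (koebe (rad k) (omega p))) \<le>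
        ((cmod (f (fst p) - f (snd p)))\<^sup>2 + (cmod (g (fst p) - g (snd p)))\<^sup>2) * cmod (koebe (rad k) (omega p))"
        unfolding real_norm_def abs_mult by (intro mult_mono R abs_Im_le_cmod) auto
      also have "\<dots> \<le> quot f p + quot g p"
        using koebe_quot_le[OF rad(1), of f p k] koebe_quot_le[OF rad(1), of g p k] by (simp add: distrib_right)
      finally show "norm (?R p * Im (koebe (rad k) (omega p))) \<le> quot f p + quot g p" .
    qed
    show "integrable N (\<lambda>p. quot f p + quot g p)" using f g by (simp add: circle_mapD)
  qed measurable
  have eq: "(\<integral>p. ?R p * Im (koebe (rad k) (omega p)) \<partial>N) =
      (\<integral>p. ?I ?h p * Im (koebe (rad k) (omega p)) \<partial>N) - (\<integral>p. ?I f p * Im (koebe (rad k) (omega p)) \<partial>N)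
      - (\<integral>p. ?I g p * Im (koebe (rad k) (omega p)) \<partial>N)" for k
    using i[OF h, of k] i[OF f, of k] i[OF g, of k]
    by (simp add: left_diff_distrib del: times_complex.sel)
  have l2: "(\<lambda>k. (\<integral>p. ?I ?h p * Im (koebe (rad k) (omega p)) \<partial>N) - (\<integral>p. ?I f p * Im (koebe (rad k) (omega p)) \<partial>N)
      - (\<integral>p. ?I g p * Im (koebe (rad k) (omega p)) \<partial>N)) \<longlonglongrightarrow> deg ?h - deg f - deg g"
    using f g h by (intro tendsto_diff hardy_sum(4)) (simp_all add: circle_mapD)
  have "deg ?h - deg f - deg g = (\<integral>p. 0 \<partial>N)"
    by (rule LIMSEQ_unique[OF l2 l1[unfolded eq]])
  then show ?thesis by simp
qed

lemma deg_power:
  assumes "circle_map u"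
  shows "circle_map (\<lambda>x. u x ^ n)" "deg (\<lambda>x. u x ^ n) = real n * deg u"
proof (induction n)
  case 0
  show "circle_map (\<lambda>x. u x ^ 0)" "deg (\<lambda>x. u x ^ 0) = real 0 * deg u"
    using circle_map_const[of 1] deg_const[of 1] by simp_all
next
  case (Suc n)
  show "circle_map (\<lambda>x. u x ^ Suc n)" using circle_map_mult[OF assms Suc(1)] by simp
  show "deg (\<lambda>x. u x ^ Suc n) = real (Suc n) * deg u"
    using deg_mult[OF assms Suc(1)] Suc(2) by (simp add: algebra_simps)
qed

text \<open>A map into a half plane has a \<open>k\<close>-th root whose energy is \<open>O(1/k\<^sup>2)\<close>; multiplicativity turns the bound
  of the degree by the energy into \<open>\<bar>deg w\<bar> \<le> O(1/k)\<close>.\<close>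

lemma deg_half_plane:
  assumes w: "circle_map w" and c: "c > 0" "\<And>x. c \<le> Re (w x)"
  shows "deg w = 0"
proof -
  define L where "L z = (if z \<in> {z. c \<le> Re z} then Ln z else 0)" for z
  define \<theta> where "\<theta> x = Im (L (w x))" for x
  have "L \<in> borel_measurable borel" unfolding L_def[abs_def]
  proof (rule borel_measurable_continuous_on_if)
    show "{z. c \<le> Re z} \<in> sets borel" by (simp add: closed_halfspace_Re_ge)
    show "continuous_on {z. c \<le> Re z} Ln"
      using c by (intro continuous_on_Ln continuous_intros) (auto simp: complex_nonpos_Reals_iff)
  qed auto
  then have th [measurable]: "\<theta> \<in> borel_measurable M"
    unfolding \<theta>_def[abs_def] using circle_mapD(3)[OF w] by measurable
  have th_lip: "\<bar>\<theta> x - \<theta> y\<bar> \<le> cmod (w x - w y) / c" for x y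
  proof -
    have "\<bar>\<theta> x - \<theta> y\<bar> \<le> cmod (Ln (w x) - Ln (w y))"
      using c abs_Im_le_cmod[of "Ln (w x) - Ln (w y)"] by (simp add: \<theta>_def L_def)
    also have "\<dots> \<le> cmod (w x - w y) / c" by (rule Ln_lipschitz) (use c in auto)
    finally show ?thesis .
  qed
  have w_eq: "w x = cis (\<theta> x)" for x
  proof -
    have "w x \<noteq> 0" using circle_mapD(5)[OF w, of x] by auto
    moreover from this have "Ln (w x) = \<i> * of_real (\<theta> x)"
      using circle_mapD(5)[OF w, of x] c by (simp add: complex_eq_iff \<theta>_def L_def)
    ultimately show ?thesis by (metis exp_Ln cis_conv_exp)
  qed
  have bound: "real k * \<bar>deg w\<bar> \<le> (1 / c)\<^sup>2 * dirichlet w" if k: "k > 0" for k :: nat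
  proof -
    define v where "v x = cis (\<theta> x / real k)" for x
    have vb: "bounded_map v"
      by (rule bounded_mapI[of _ 1]) (simp_all add: v_def[abs_def] cis.code borel_measurable_complex_iff)
    have lip: "cmod (v x - v y) \<le> (1 / (c * real k)) * cmod (w x - w y)" for x y
    proof -
      have "cmod (v x - v y) \<le> \<bar>\<theta> x / real k - \<theta> y / real k\<bar>" unfolding v_def by (rule norm_cis_diff)
      also have "\<dots> = \<bar>\<theta> x - \<theta> y\<bar> / real k" by (simp flip: diff_divide_distrib)
      also have "\<dots> \<le> (cmod (w x - w y) / c) / real k" by (intro divide_right_mono th_lip) simp
      finally show ?thesis by simp
    qed
    note v = finite_dirichlet_lipschitz[OF vb circle_mapD(1)[OF w] lip]
    have "cmod (v x) = 1" for x by (simp add: v_def)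
    then have vc: "circle_map v" using v(1) unfolding circle_map_def by blast
    have "(\<lambda>x. v x ^ k) = w" by (rule ext) (use k in \<open>simp add: v_def w_eq Complex.DeMoivre\<close>)
    then have "deg w = real k * deg v" using deg_power(2)[OF vc, of k] by simp
    then have "real k * \<bar>deg w\<bar> = (real k)\<^sup>2 * \<bar>deg v\<bar>" by (simp add: abs_mult power2_eq_square)
    also have "\<dots> \<le> (real k)\<^sup>2 * ((1 / (c * real k))\<^sup>2 * dirichlet w)"
      by (intro mult_left_mono order_trans[OF abs_deg_le[OF v(1)] v(2)]) simp
    also have "\<dots> = (1 / c)\<^sup>2 * dirichlet w" using k by (simp add: power_divide power_mult_distrib)
    finally show ?thesis .
  qed
  show ?thesis
  proof (rule ccontr)
    assume "deg w \<noteq> 0"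
    then have "\<bar>deg w\<bar> > 0" by simp
    then obtain k :: nat where "(1 / c)\<^sup>2 * dirichlet w < real k * \<bar>deg w\<bar>"
      using reals_Archimedean3 by blast
    moreover have "0 \<le> (1 / c)\<^sup>2 * dirichlet w" by (simp add: dirichlet_nonneg)
    ultimately show False using bound[of k] by (cases "k = 0") auto
  qed
qed

end

text \<open>Multiplied by \<open>\<bar>z\<bar> \<bar>w\<bar>\<close>, the two sides differ by \<open>(\<bar>z\<bar> - \<bar>w\<bar>)\<^sup>2\<close>.\<close>

lemma sgn_diff_sq_le:
  fixes z w :: complex
  assumes "z \<noteq> 0" "w \<noteq> 0"
  shows "(cmod (sgn z - sgn w))\<^sup>2 \<le> (cmod (z - w))\<^sup>2 / (cmod z * cmod w)"
proof -
  have p: "cmod z * cmod w > 0" using assms by simp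
  have sz: "cmod (sgn z) = 1" "cmod (sgn w) = 1" using assms by (simp_all add: norm_sgn)
  have e: "(cmod (a - c))\<^sup>2 = (cmod a)\<^sup>2 + (cmod c)\<^sup>2 - 2 * Re (a * cnj c)" for a c
    unfolding cmod_power2 by (simp add: power2_eq_square algebra_simps)
  have "Re (sgn z * cnj (sgn w)) = Re (z * cnj w) / (cmod z * cmod w)"
    by (simp add: sgn_eq Re_divide_of_real flip: of_real_mult)
  then have "(cmod (sgn z - sgn w))\<^sup>2 = (2 * (cmod z * cmod w) - 2 * Re (z * cnj w)) / (cmod z * cmod w)"
    unfolding e[of "sgn z"] sz using assms by (simp add: diff_divide_distrib del: times_complex.sel)
  also have "\<dots> \<le> (cmod (z - w))\<^sup>2 / (cmod z * cmod w)"
    unfolding e[of z w] using p zero_le_power2[of "cmod z - cmod w"]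
    by (intro divide_right_mono) (auto simp: power2_diff)
  finally show ?thesis .
qed

lemma sgn_lipschitz:
  fixes z w :: complex
  assumes "\<rho> > 0" "\<rho> \<le> cmod z" "\<rho> \<le> cmod w"
  shows "cmod (sgn z - sgn w) \<le> (1 / \<rho>) * cmod (z - w)"
proof (rule power2_le_imp_le)
  have "z \<noteq> 0" "w \<noteq> 0" using assms by auto
  then have "(cmod (sgn z - sgn w))\<^sup>2 \<le> (cmod (z - w))\<^sup>2 / (cmod z * cmod w)" by (rule sgn_diff_sq_le)
  also have "\<dots> \<le> (cmod (z - w))\<^sup>2 / (\<rho> * \<rho>)"
    using assms by (intro divide_left_mono mult_mono mult_pos_pos) auto
  finally show "(cmod (sgn z - sgn w))\<^sup>2 \<le> (1 / \<rho> * cmod (z - w))\<^sup>2"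
    by (simp add: power2_eq_square)
qed (use assms in simp)

lemma poisson_remainder:
  assumes "cmod z = 1" "0 \<le> r" "r < 1"
  shows "\<bar>poisson r z - (1 + (\<Sum>n=1..K. 2 * r ^ n * Re (z ^ n)))\<bar> \<le> 2 * r ^ Suc K / (1 - r)"
proof -
  let ?f = "\<lambda>n. (if n = 0 then 1 else 2 * r ^ n * Re (z ^ n))"
  note s = poisson_sums[OF assms]
  have "(\<lambda>n. ?f (n + Suc K)) sums (poisson r z - (\<Sum>n<Suc K. ?f n))"
    using sums_split_initial_segment[OF s] .
  moreover have "(\<Sum>n<Suc K. ?f n) = 1 + (\<Sum>n=1..K. 2 * r ^ n * Re (z ^ n))"
    by (subst sum.lessThan_Suc_shift) (simp add: sum.atLeast1_atMost_eq)
  ultimately have *: "(\<lambda>n. ?f (n + Suc K)) sums (poisson r z - (1 + (\<Sum>n=1..K. 2 * r ^ n * Re (z ^ n))))"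
    by simp
  have g: "(\<lambda>n. 2 * r ^ Suc K * r ^ n) sums (2 * r ^ Suc K * (1 / (1 - r)))"
    using assms by (intro sums_mult geometric_sums) simp
  have b: "norm (?f (n + Suc K)) \<le> 2 * r ^ Suc K * r ^ n" for n
  proof -
    have "\<bar>Re (z ^ (n + Suc K))\<bar> \<le> 1"
      using abs_Re_le_cmod[of "z ^ (n + Suc K)"] assms by (simp add: norm_power norm_mult)
    then have "2 * r ^ (n + Suc K) * \<bar>Re (z ^ (n + Suc K))\<bar> \<le> 2 * r ^ (n + Suc K) * 1"
      using assms by (intro mult_left_mono) auto
    then show ?thesis using assms by (simp add: abs_mult power_add mult_ac)
  qed
  have "norm (\<Sum>n. ?f (n + Suc K)) \<le> (\<Sum>n. 2 * r ^ Suc K * r ^ n)"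
    by (rule norm_suminf_le[OF b sums_summable[OF g]])
  then show ?thesis using sums_unique[OF *] sums_unique[OF g] by simp
qed

context circle_space
begin

section \<open>Poisson extension\<close>

definition poisson_ext :: "('a \<Rightarrow> complex) \<Rightarrow> real \<Rightarrow> complex \<Rightarrow> complex" where
  "poisson_ext u r a = (\<integral>y. of_real (poisson r (a * cnj (b y))) * u y \<partial>M)"

text \<open>The frequencies up to \<open>K\<close> of the Poisson extension. It is a trigonometric polynomial in \<open>a\<close>, to which the
  fundamental theorem of algebra applies.\<close>

definition trunc :: "('a \<Rightarrow> complex) \<Rightarrow> real \<Rightarrow> nat \<Rightarrow> complex \<Rightarrow> complex" where
  "trunc u r K a = fourier u 0 + (\<Sum>n=1..K. of_real (r ^ n) *
     (fourier u n * a ^ n + cnj (fourier (\<lambda>x. cnj (u x)) n) * cnj a ^ n))"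

lemma b_cnj: "b x * cnj (b x) = 1"
  by (metis complex_norm_square norm_b of_real_1 power_one)

lemma fourier_b_power:
  "fourier (\<lambda>x. b x ^ j) n = (if j = n then 1 else 0)"
proof -
  have c: "(\<integral>x. cnj (b x) ^ n \<partial>M) = 0" if "n \<ge> 1" for n
    using moment[OF that] Bochner_Integration.integral_cnj[of M "\<lambda>x. b x ^ n"] by simp
  consider "j = n" | "j < n" | "n < j" by linarith
  then show ?thesis
  proof cases
    case 1
    then show ?thesis by (simp add: fourier_def b_cnj prob_space flip: power_mult_distrib)
  next
    case 2
    have "b x ^ j * cnj (b x) ^ n = cnj (b x) ^ (n - j)" for x
    proof -
      have "cnj (b x) ^ n = cnj (b x) ^ j * cnj (b x) ^ (n - j)" using 2 by (simp flip: power_add)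
      then show ?thesis by (simp add: b_cnj mult.assoc[symmetric] flip: power_mult_distrib)
    qed
    then show ?thesis using 2 c[of "n - j"] by (simp add: fourier_def)
  next
    case 3
    have "b x ^ j * cnj (b x) ^ n = b x ^ (j - n)" for x
    proof -
      have "b x ^ j = b x ^ (j - n) * b x ^ n" using 3 by (simp flip: power_add)
      then show ?thesis by (simp add: b_cnj mult.assoc flip: power_mult_distrib)
    qed
    then show ?thesis using 3 moment[of "j - n"] by (simp add: fourier_def)
  qed
qed

lemma fourier_cnj_b_power:
  "fourier (\<lambda>x. cnj (b x) ^ j) n = (if j = 0 \<and> n = 0 then 1 else 0)"
proof (cases "j + n = 0")
  case False
  have "(\<integral>x. cnj (b x) ^ (j + n) \<partial>M) = 0"
    using moment[of "j + n"] False Bochner_Integration.integral_cnj[of M "\<lambda>x. b x ^ (j + n)"] by simp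
  then show ?thesis using False by (auto simp: fourier_def power_add)
qed (simp add: fourier_def prob_space)

lemma fourier_add:
  assumes "bounded_map u" "bounded_map v"
  shows "fourier (\<lambda>x. u x + v x) n = fourier u n + fourier v n"
  unfolding fourier_def distrib_right
  using assms by (intro Bochner_Integration.integral_add bounded_map_integrable bounded_map_mult bounded_map_power
      bounded_map_cnj bounded_map_b)

lemma fourier_diff:
  assumes "bounded_map u" "bounded_map v"
  shows "fourier (\<lambda>x. u x - v x) n = fourier u n - fourier v n"
  unfolding fourier_def left_diff_distrib
  using assms by (intro Bochner_Integration.integral_diff bounded_map_integrable bounded_map_mult bounded_map_power
      bounded_map_cnj bounded_map_b)

lemma fourier_scale: "fourier (\<lambda>x. c * u x) n = c * fourier u n"
  by (simp add: fourier_def mult.assoc)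

lemma bounded_map_sum:
  "finite A \<Longrightarrow> (\<And>i. i \<in> A \<Longrightarrow> bounded_map (f i)) \<Longrightarrow> bounded_map (\<lambda>x. \<Sum>i\<in>A. f i x)"
  by (induction A rule: finite_induct) (auto intro: bounded_map_const bounded_map_add)

lemma fourier_sum:
  assumes "finite A" "\<And>i. i \<in> A \<Longrightarrow> bounded_map (f i)"
  shows "fourier (\<lambda>x. \<Sum>i\<in>A. f i x) n = (\<Sum>i\<in>A. fourier (f i) n)"
  using assms
proof (induction A rule: finite_induct)
  case empty then show ?case by (simp add: fourier_def)
next
  case (insert a A)
  then show ?case by (simp add: fourier_add bounded_map_sum)
qed

lemma norm_integral_le:
  fixes f :: "'a \<Rightarrow> complex"
  assumes "integrable M f" "\<And>x. cmod (f x) \<le> C"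
  shows "cmod (\<integral>x. f x \<partial>M) \<le> C"
proof -
  have "cmod (\<integral>x. f x \<partial>M) \<le> (\<integral>x. cmod (f x) \<partial>M)" by (rule integral_norm_bound)
  also have "\<dots> \<le> (\<integral>x. C \<partial>M)" using assms by (intro integral_mono) auto
  finally show ?thesis by (simp add: prob_space)
qed

lemma norm_fourier_le:
  assumes u: "bounded_map u" "\<And>x. cmod (u x) \<le> C"
  shows "cmod (fourier u n) \<le> C"
proof -
  show ?thesis unfolding fourier_def
  proof (rule norm_integral_le)
    show "integrable M (\<lambda>x. u x * cnj (b x) ^ n)"
      by (intro bounded_map_integrable bounded_map_mult bounded_map_power bounded_map_cnj bounded_map_b u)
    show "cmod (u x * cnj (b x) ^ n) \<le> C" for x using u(2) by (simp add: norm_mult norm_power)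
  qed
qed

lemma poisson_b_measurable [measurable]:
  "(\<lambda>y. poisson r (a * cnj (b y))) \<in> borel_measurable M"
  unfolding poisson_def by measurable

lemma bounded_map_poisson:
  assumes "cmod a = 1" "0 \<le> r" "r < 1"
  shows "bounded_map (\<lambda>y. of_real (poisson r (a * cnj (b y))))"
proof (rule bounded_mapI[of _ "2 / (1 - r)"])
  show "cmod (of_real (poisson r (a * cnj (b y)))) \<le> 2 / (1 - r)" for y
    using poisson_bound[of "a * cnj (b y)" r] poisson_nonneg[of r "a * cnj (b y)"] assms by (simp add: norm_mult)
qed measurable

lemma ext_trunc:
  assumes u: "bounded_map u" "\<And>x. cmod (u x) \<le> C" and a: "cmod a = 1" and r: "0 \<le> r" "r < 1"
  shows "cmod (poisson_ext u r a - trunc u r K a) \<le> C * (2 * r ^ Suc K / (1 - r))"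
proof -
  let ?z = "\<lambda>y. a * cnj (b y)"
  let ?S = "\<lambda>y. 1 + (\<Sum>n=1..K. 2 * r ^ n * Re (?z y ^ n))"
  have z: "cmod (?z y) = 1" for y using a by (simp add: norm_mult)
  have t: "of_real (?S y) * u y = u y + (\<Sum>n=1..K. of_real (r ^ n) *
       (a ^ n * (u y * cnj (b y) ^ n) + cnj a ^ n * (u y * b y ^ n)))" for y
  proof -
    have "of_real (2 * r ^ n * Re (?z y ^ n)) * u y = of_real (r ^ n) *
       (a ^ n * (u y * cnj (b y) ^ n) + cnj a ^ n * (u y * b y ^ n))" for n
    proof -
      have "complex_of_real (2 * Re (?z y ^ n)) = ?z y ^ n + cnj (?z y ^ n)"
        by (rule complex_add_cnj[symmetric])
      also have "\<dots> = a ^ n * cnj (b y) ^ n + cnj a ^ n * b y ^ n" by (simp add: power_mult_distrib)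
      finally have "complex_of_real (r ^ n) * complex_of_real (2 * Re (?z y ^ n)) * u y =
        of_real (r ^ n) * (a ^ n * cnj (b y) ^ n + cnj a ^ n * b y ^ n) * u y" by simp
      then show ?thesis by (simp only: of_real_mult) (simp add: algebra_simps)
    qed
    then show ?thesis
      by (simp only: of_real_add of_real_sum of_real_1 distrib_right sum_distrib_right mult_1)
  qed
  have cb: "bounded_map (\<lambda>x. cnj (b x) ^ n)" "bounded_map (\<lambda>x. b x ^ n)" for n
    by (intro bounded_map_power bounded_map_cnj bounded_map_b)+
  have i: "integrable M (\<lambda>y. u y * cnj (b y) ^ n)" "integrable M (\<lambda>y. u y * b y ^ n)" for n
    by (intro bounded_map_integrable bounded_map_mult cb u)+
  have iS: "integrable M (\<lambda>y. of_real (?S y) * u y)" unfolding t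
    by (intro Bochner_Integration.integrable_add bounded_map_integrable[OF u(1)] Bochner_Integration.integrable_sum
       integrable_mult_right i)
  have bf: "(\<integral>y. u y * b y ^ n \<partial>M) = cnj (fourier (\<lambda>x. cnj (u x)) n)" for n
    unfolding fourier_def Bochner_Integration.integral_cnj[symmetric] by simp
  have iP: "integrable M (\<lambda>y. of_real (poisson r (?z y)) * u y)"
    by (intro bounded_map_integrable bounded_map_mult u bounded_map_poisson a r)
  let ?T = "\<lambda>n y. of_real (r ^ n) * (a ^ n * (u y * cnj (b y) ^ n) + cnj a ^ n * (u y * b y ^ n))"
  have iT: "integrable M (?T n)" for n
    by (intro integrable_mult_right Bochner_Integration.integrable_add i)
  have "(\<integral>y. ?T n y \<partial>M) = of_real (r ^ n) * (fourier u n * a ^ n + cnj (fourier (\<lambda>x. cnj (u x)) n) * cnj a ^ n)" for n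
    unfolding bf[symmetric] integral_mult_right_zero
      Bochner_Integration.integral_add[OF integrable_mult_right[OF i(1)] integrable_mult_right[OF i(2)]]
    by (simp add: fourier_def mult.commute)
  moreover have "(\<integral>y. u y + (\<Sum>n=1..K. ?T n y) \<partial>M) = fourier u 0 + (\<Sum>n=1..K. (\<integral>y. ?T n y \<partial>M))"
    by (simp only: Bochner_Integration.integral_add[OF bounded_map_integrable[OF u(1)] Bochner_Integration.integrable_sum[OF iT]]
        Bochner_Integration.integral_sum[OF iT]) (simp add: fourier_def)
  ultimately have "(\<integral>y. of_real (?S y) * u y \<partial>M) = trunc u r K a"
    unfolding t trunc_def by (simp only:)
  then have "poisson_ext u r a - trunc u r K a = (\<integral>y. of_real (poisson r (?z y)) * u y - of_real (?S y) * u y \<partial>M)"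
    unfolding poisson_ext_def using iP iS by simp
  also have "\<dots> = (\<integral>y. of_real (poisson r (?z y) - ?S y) * u y \<partial>M)"
    by (simp only: of_real_diff left_diff_distrib)
  also have "cmod \<dots> \<le> C * (2 * r ^ Suc K / (1 - r))"
  proof (rule norm_integral_le)
    show "integrable M (\<lambda>y. of_real (poisson r (?z y) - ?S y) * u y)"
      using Bochner_Integration.integrable_diff[OF iP iS] by (simp only: of_real_diff left_diff_distrib)
    fix y
    have "cmod (of_real (poisson r (?z y) - ?S y) * u y) = cmod (u y) * \<bar>poisson r (?z y) - ?S y\<bar>"
      by (simp only: norm_mult norm_of_real mult.commute)
    also have "\<dots> \<le> C * (2 * r ^ Suc K / (1 - r))"
      using u(2)[of y] order_trans[OF norm_ge_zero u(2)] by (intro mult_mono poisson_remainder z r) auto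
    finally show "cmod (of_real (poisson r (?z y) - ?S y) * u y) \<le> C * (2 * r ^ Suc K / (1 - r))" .
  qed
  finally show ?thesis .
qed

text \<open>This evaluates the Poisson extensions of constants and of \<open>b\<close>, whose truncations do not depend on \<open>K \<ge> 1\<close>.\<close>

lemma ext_eqI:
  assumes u: "bounded_map u" and a: "cmod a = 1" and r: "0 \<le> r" "r < 1"
    and t: "\<And>K. K \<ge> 1 \<Longrightarrow> trunc u r K a = l"
  shows "poisson_ext u r a = l"
proof -
  obtain C where C: "C \<ge> 0" "\<And>x. cmod (u x) \<le> C" using u by (metis bounded_mapE)
  have "(\<lambda>K. C * (2 * r ^ Suc (Suc K) / (1 - r))) \<longlonglongrightarrow> C * (2 * 0 / (1 - r))"
  proof (intro tendsto_intros)
    show "(\<lambda>K. r ^ Suc (Suc K)) \<longlonglongrightarrow> 0"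
      using LIMSEQ_ignore_initial_segment[OF LIMSEQ_realpow_zero[OF r], of 2] by (simp add: numeral_2_eq_2)
  qed (use r in auto)
  moreover have "cmod (poisson_ext u r a - l) \<le> C * (2 * r ^ Suc (Suc K) / (1 - r))" for K
    using ext_trunc[OF u C(2) a r, of "Suc K"] t[of "Suc K"] by simp
  ultimately have "cmod (poisson_ext u r a - l) \<le> C * (2 * 0 / (1 - r))"
    using LIMSEQ_le_const by blast
  then show ?thesis by simp
qed

lemma ext_1:
  assumes "cmod a = 1" "0 \<le> r" "r < 1"
  shows "poisson_ext (\<lambda>x. 1) r a = 1"
proof (rule ext_eqI[OF bounded_map_const assms])
  have f: "fourier (\<lambda>x. 1) n = (if n = 0 then 1 else 0)" for n using fourier_b_power[of 0 n] by auto
  show "trunc (\<lambda>x. 1) r K a = 1" for K unfolding trunc_def by (simp add: f)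
qed

lemma ext_b:
  assumes "cmod a = 1" "0 \<le> r" "r < 1"
  shows "poisson_ext b r a = of_real r * a"
proof (rule ext_eqI[OF bounded_map_b assms])
  fix K :: nat assume K: "K \<ge> 1"
  have f: "fourier b n = (if n = 1 then 1 else 0)" "fourier (\<lambda>x. cnj (b x)) n = 0" for n
    using fourier_b_power[of 1 n] fourier_cnj_b_power[of 1 n] by auto
  have "(\<Sum>n = 1..K. of_real (r ^ n) * ((if n = 1 then 1 else 0) * a ^ n)) = (\<Sum>n\<in>{1}. of_real (r ^ n) * a ^ n)"
    using K by (intro sum.mono_neutral_cong_right) auto
  then show "trunc b r K a = of_real r * a" unfolding trunc_def by (simp add: f del: One_nat_def)
qed

lemma poisson_integral_1:
  assumes "cmod a = 1" "0 \<le> r" "r < 1"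
  shows "(\<integral>y. poisson r (a * cnj (b y)) \<partial>M) = 1"
proof -
  have "complex_of_real (\<integral>y. poisson r (a * cnj (b y)) \<partial>M) = 1"
    using ext_1[OF assms] unfolding poisson_ext_def by simp
  then show ?thesis by (simp only: of_real_eq_1_iff)
qed

text \<open>At a point \<open>a\<close> at positive distance from the range the Poisson kernel would tend to zero uniformly, although its integral is one.\<close>

lemma range_b_dense:
  assumes a: "cmod a = 1" and d: "\<delta> > 0" "\<And>x. \<delta> \<le> cmod (b x - a)"
  shows False
proof -
  have "1 \<le> (1 - (rad k)\<^sup>2) / (rad k * \<delta>\<^sup>2)" if k: "k > 0" for k
  proof -
    have r: "0 < rad k" "rad k < 1" using k by (simp_all add: rad_def)
    have le: "poisson (rad k) (a * cnj (b y)) \<le> (1 - (rad k)\<^sup>2) / (rad k * \<delta>\<^sup>2)" for y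
    proof -
      have "1 - a * cnj (b y) = (b y - a) * cnj (b y)" using b_cnj[of y] by (simp add: algebra_simps)
      then have n: "cmod (1 - a * cnj (b y)) = cmod (b y - a)" by (simp add: norm_mult)
      then have "a * cnj (b y) \<noteq> 1" using d(1) d(2)[of y] by auto
      then have "poisson (rad k) (a * cnj (b y)) \<le> (1 - (rad k)\<^sup>2) / (rad k * (cmod (b y - a))\<^sup>2)"
        using poisson_le[of "a * cnj (b y)" "rad k"] r a n by (simp add: norm_mult)
      also have "\<dots> \<le> (1 - (rad k)\<^sup>2) / (rad k * \<delta>\<^sup>2)"
        using r d(1) d(2)[of y]
        by (intro divide_left_mono mult_left_mono power_mono mult_pos_pos) (auto simp: power_le_one)
      finally show ?thesis .
    qed
    have "integrable M (\<lambda>y. poisson (rad k) (a * cnj (b y)))"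
      using integrable_Re[OF bounded_map_integrable[OF bounded_map_poisson[OF a rad(1,2)]]] by simp
    then have "(\<integral>y. poisson (rad k) (a * cnj (b y)) \<partial>M) \<le> (\<integral>y. (1 - (rad k)\<^sup>2) / (rad k * \<delta>\<^sup>2) \<partial>M)"
      by (intro integral_mono le) auto
    then show ?thesis using poisson_integral_1[OF a rad(1,2)] by (simp add: prob_space)
  qed
  moreover have "(\<lambda>k. (1 - (rad k)\<^sup>2) / (rad k * \<delta>\<^sup>2)) \<longlonglongrightarrow> (1 - 1\<^sup>2) / (1 * \<delta>\<^sup>2)"
    using d by (intro tendsto_intros rad) auto
  ultimately have "1 \<le> (1 - 1\<^sup>2) / (1 * \<delta>\<^sup>2)"
    by (intro LIMSEQ_le_const) (auto intro!: exI[of _ 1])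
  then show False by simp
qed


section \<open>Uniform approach to the circle\<close>

text \<open>The defect is the variance of \<open>u\<close> under the Poisson kernel, written as a double integral.\<close>

lemma norm_ext_sq:
  assumes u: "circle_map u" and a: "cmod a = 1" and r: "0 \<le> r" "r < 1"
  shows "(\<integral>p. poisson r (a * cnj (b (fst p))) * poisson r (a * cnj (b (snd p))) * (cmod (u (fst p) - u (snd p)))\<^sup>2 \<partial>N)
      = 2 - 2 * (cmod (poisson_ext u r a))\<^sup>2"
    and "integrable N (\<lambda>p. poisson r (a * cnj (b (fst p))) * poisson r (a * cnj (b (snd p))) * (cmod (u (fst p) - u (snd p)))\<^sup>2)"
proof -
  let ?P = "\<lambda>y. poisson r (a * cnj (b y))"
  let ?f = "\<lambda>y. of_real (?P y) * u y"
  have bP: "bounded_map (\<lambda>y. of_real (?P y))" by (rule bounded_map_poisson[OF a r])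
  have bf: "bounded_map ?f" by (intro bounded_map_mult bP circle_mapD(2)[OF u])
  note bf' = bounded_map_cnj[OF bf]
  have i1: "integrable N (\<lambda>p. ?f (fst p) * cnj (?f (snd p)))" by (rule pair_integral_mult(1)[OF bf bf'])
  have "(\<integral>p. ?f (fst p) * cnj (?f (snd p)) \<partial>N) = poisson_ext u r a * cnj (poisson_ext u r a)"
    unfolding pair_integral_mult(2)[OF bf bf'] poisson_ext_def Bochner_Integration.integral_cnj ..
  also have "\<dots> = of_real ((cmod (poisson_ext u r a))\<^sup>2)" by (rule complex_norm_square[symmetric])
  finally have e1: "(\<integral>p. Re (?f (fst p) * cnj (?f (snd p))) \<partial>N) = (cmod (poisson_ext u r a))\<^sup>2"
    using integral_Re[OF i1] by (simp only: Re_complex_of_real)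
  have "integrable N (\<lambda>p. complex_of_real (?P (fst p)) * of_real (?P (snd p)))"
    by (rule pair_integral_mult(1)[OF bP bP])
  then have i2: "integrable N (\<lambda>p. ?P (fst p) * ?P (snd p))"
    using integrable_Re by (fastforce simp flip: of_real_mult)
  have "(\<integral>y. complex_of_real (?P y) \<partial>M) = 1" using poisson_integral_1[OF a r] by simp
  then have "complex_of_real (\<integral>p. ?P (fst p) * ?P (snd p) \<partial>N) = 1"
    using pair_integral_mult(2)[OF bP bP]
    by (simp only: integral_complex_of_real[symmetric] of_real_mult) simp
  then have e2: "(\<integral>p. ?P (fst p) * ?P (snd p) \<partial>N) = 1" by (simp only: of_real_eq_1_iff)
  have eq: "?P (fst p) * ?P (snd p) * (cmod (u (fst p) - u (snd p)))\<^sup>2 =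
      2 * (?P (fst p) * ?P (snd p)) - 2 * Re (?f (fst p) * cnj (?f (snd p)))" for p
  proof -
    have "(cmod (u (fst p) - u (snd p)))\<^sup>2 = 2 - 2 * Re (u (fst p) * cnj (u (snd p)))"
      using unimodular_cross[of "u (fst p)" "u (snd p)"] u by (simp add: circle_mapD)
    moreover have "?f (fst p) * cnj (?f (snd p)) = of_real (?P (fst p) * ?P (snd p)) * (u (fst p) * cnj (u (snd p)))"
      by simp
    then have "Re (?f (fst p) * cnj (?f (snd p))) = (?P (fst p) * ?P (snd p)) * Re (u (fst p) * cnj (u (snd p)))"
      by (simp only: Re_complex_of_real times_complex.sel Im_complex_of_real)
    ultimately show ?thesis by (simp only: right_diff_distrib)
  qed
  show "integrable N (\<lambda>p. ?P (fst p) * ?P (snd p) * (cmod (u (fst p) - u (snd p)))\<^sup>2)"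
    unfolding eq using i2 integrable_Re[OF i1] by (intro Bochner_Integration.integrable_diff integrable_mult_right)
  show "(\<integral>p. ?P (fst p) * ?P (snd p) * (cmod (u (fst p) - u (snd p)))\<^sup>2 \<partial>N) = 2 - 2 * (cmod (poisson_ext u r a))\<^sup>2"
    unfolding eq using i2 integrable_Re[OF i1] e1 e2
    by (simp only: Bochner_Integration.integral_diff integrable_mult_right integral_mult_right_zero mult_1_right)
qed

lemma near_diagonal_energy:
  assumes u: "finite_dirichlet u"
  shows "(\<lambda>k. \<integral>p. quot u p * indicator {p. cmod (b (fst p) - b (snd p)) < 1 / real (Suc k)} p \<partial>N) \<longlonglongrightarrow> 0"
proof -
  have [measurable]: "u \<in> borel_measurable M" and iq: "integrable N (quot u)"
    using u by (auto simp: finite_dirichlet_def bounded_map_def)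
  have "(\<lambda>k. \<integral>p. quot u p * indicator {p. cmod (b (fst p) - b (snd p)) < 1 / real (Suc k)} p \<partial>N) \<longlonglongrightarrow> (\<integral>p. 0 \<partial>N)"
  proof (rule integral_dominated_convergence[where w = "quot u"])
    show "AE p in N. (\<lambda>k. quot u p * indicator {p. cmod (b (fst p) - b (snd p)) < 1 / real (Suc k)} p) \<longlonglongrightarrow> 0"
    proof (intro always_eventually allI)
      fix p
      show "(\<lambda>k. quot u p * indicator {p. cmod (b (fst p) - b (snd p)) < 1 / real (Suc k)} p) \<longlonglongrightarrow> 0"
      proof (cases "cmod (b (fst p) - b (snd p)) = 0")
        case True
        then show ?thesis by (simp add: quot_def)
      next
        case False
        then have pos: "cmod (b (fst p) - b (snd p)) > 0" by simp
        have "\<forall>\<^sub>F k in sequentially. 1 / real (Suc k) < cmod (b (fst p) - b (snd p))"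
          using order_tendstoD(2)[OF LIMSEQ_inverse_real_of_nat pos] by (simp add: inverse_eq_divide)
        then have "\<forall>\<^sub>F k in sequentially. quot u p * indicator {p. cmod (b (fst p) - b (snd p)) < 1 / real (Suc k)} p = 0"
          by eventually_elim (auto simp: indicator_def)
        then show ?thesis by (rule tendsto_eventually)
      qed
    qed
    have "{p \<in> space N. cmod (b (fst p) - b (snd p)) < 1 / real (Suc k)} \<in> sets N" for k by measurable
    then show "(\<lambda>p. quot u p * indicator {p. cmod (b (fst p) - b (snd p)) < 1 / real (Suc k)} p) \<in> borel_measurable N" for k
      by (intro borel_measurable_times quot_measurable borel_measurable_indicator') (auto simp: Int_def conj_commute)
    show "AE p in N. norm (quot u p * indicator {p. cmod (b (fst p) - b (snd p)) < 1 / real (Suc k)} p) \<le> quot u p" for k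
      by (intro always_eventually allI) (auto simp: indicator_def quot_nonneg)
  qed (use iq in auto)
  then show ?thesis by simp
qed

text \<open>Pairs that are close contribute to the variance at
  most a multiple of the energy near the diagonal, by \<open>poisson_mult_le\<close>; for distant pairs Chebyshev's inequality applies to the coordinate \<open>b\<close>, whose variance
  is \<open>1 - r\<^sup>2\<close>. Both bounds are uniform in the point.\<close>

lemma norm_ext_near_1:
  assumes u: "circle_map u" and \<eta>: "\<eta> > 0"
  obtains r\<^sub>0 where "r\<^sub>0 < 1" "\<And>r x. r\<^sub>0 \<le> r \<Longrightarrow> 0 \<le> r \<Longrightarrow> r < 1 \<Longrightarrow> 1 - (cmod (poisson_ext u r (b x)))\<^sup>2 \<le> \<eta>"
proof -
  let ?S = "\<lambda>k. \<integral>p. quot u p * indicator {p. cmod (b (fst p) - b (snd p)) < 1 / real (Suc k)} p \<partial>N"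
  have [measurable]: "u \<in> borel_measurable M" and iq: "integrable N (quot u)"
    using u by (simp_all add: circle_mapD)
  obtain k where k: "?S k < \<eta> / 64"
    using order_tendstoD(2)[OF near_diagonal_energy[OF circle_mapD(1)[OF u]], of "\<eta> / 64"] \<eta>
    by (auto simp: eventually_sequentially)
  define \<kappa> where "\<kappa> = 1 / real (Suc k)"
  have \<kappa>: "\<kappa> > 0" by (simp add: \<kappa>_def)
  let ?A = "{p. cmod (b (fst p) - b (snd p)) < \<kappa>}"
  \<comment> \<open>makes the contribution \<open>(4 / \<kappa>\<^sup>2) (2 - 2 r\<^sup>2)\<close> of the distant pairs at most \<open>\<eta>\<close>\<close>
  define r\<^sub>0 where "r\<^sub>0 = max (1/2) (1 - \<eta> * \<kappa>\<^sup>2 / 16)"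
  have "r\<^sub>0 < 1" using \<eta> \<kappa> by (simp add: r\<^sub>0_def)
  moreover have "1 - (cmod (poisson_ext u r (b x)))\<^sup>2 \<le> \<eta>" if r: "r\<^sub>0 \<le> r" "r < 1" for r x
  proof -
    have r2: "1/2 \<le> r" "1 - \<eta> * \<kappa>\<^sup>2 / 16 \<le> r" using r(1) by (auto simp: r\<^sub>0_def)
    then have r0: "0 \<le> r" "0 < r" by auto
    let ?P = "\<lambda>y. poisson r (b x * cnj (b y))"
    let ?PP = "\<lambda>p. ?P (fst p) * ?P (snd p)"
    have P0: "0 \<le> ?P y" for y using r0 r by (intro poisson_nonneg) auto
    have "?PP p * (cmod (u (fst p) - u (snd p)))\<^sup>2 \<le>
        64 * (quot u p * indicator ?A p) + (4 / \<kappa>\<^sup>2) * (?PP p * (cmod (b (fst p) - b (snd p)))\<^sup>2)" for p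
    proof (cases "p \<in> ?A")
      case True
      have "?PP p * (cmod (u (fst p) - u (snd p)))\<^sup>2 \<le> 64 * quot u p"
      proof (cases "b (fst p) = b (snd p)")
        case True
        then have "fst p = snd p" by (rule inj_b)
        then show ?thesis by (simp add: quot_def)
      next
        case False
        then have d: "0 < (cmod (b (fst p) - b (snd p)))\<^sup>2" by simp
        have "cmod (b x * cnj (b (fst p)) - b x * cnj (b (snd p))) = cmod (b (fst p) - b (snd p))"
          by (simp add: norm_mult flip: right_diff_distrib complex_cnj_diff)
        then have "?PP p * (r * cmod (b (fst p) - b (snd p)))\<^sup>2 \<le> 16"
          using poisson_mult_le[of "b x * cnj (b (fst p))" "b x * cnj (b (snd p))" r] r r0 by (simp add: norm_mult)
        moreover have "?PP p * ((1/2) * cmod (b (fst p) - b (snd p)))\<^sup>2 \<le> ?PP p * (r * cmod (b (fst p) - b (snd p)))\<^sup>2"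
          using P0 r2 by (intro mult_left_mono power_mono mult_right_mono mult_nonneg_nonneg) auto
        ultimately have "?PP p * (cmod (b (fst p) - b (snd p)))\<^sup>2 \<le> 64"
          by (simp add: power_mult_distrib power_divide)
        then have "?PP p \<le> 64 / (cmod (b (fst p) - b (snd p)))\<^sup>2" using d by (simp add: pos_le_divide_eq)
        then have "?PP p * (cmod (u (fst p) - u (snd p)))\<^sup>2 \<le> 64 / (cmod (b (fst p) - b (snd p)))\<^sup>2 * (cmod (u (fst p) - u (snd p)))\<^sup>2"
          by (rule mult_right_mono) simp
        then show ?thesis by (simp add: quot_def)
      qed
      moreover have "0 \<le> (4 / \<kappa>\<^sup>2) * (?PP p * (cmod (b (fst p) - b (snd p)))\<^sup>2)" using P0 by simp
      ultimately show ?thesis using True by simp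
    next
      case False
      have "cmod (u (fst p) - u (snd p)) \<le> 2"
        using norm_triangle_ineq4[of "u (fst p)" "u (snd p)"] u by (simp add: circle_mapD)
      then have "(cmod (u (fst p) - u (snd p)))\<^sup>2 \<le> 2\<^sup>2" by (intro power_mono) auto
      also have "2\<^sup>2 = (4 / \<kappa>\<^sup>2) * \<kappa>\<^sup>2" using \<kappa> by simp
      also have "\<dots> \<le> (4 / \<kappa>\<^sup>2) * (cmod (b (fst p) - b (snd p)))\<^sup>2"
        using False \<kappa> by (intro mult_left_mono power_mono) auto
      finally have "?PP p * (cmod (u (fst p) - u (snd p)))\<^sup>2 \<le> ?PP p * ((4 / \<kappa>\<^sup>2) * (cmod (b (fst p) - b (snd p)))\<^sup>2)"
        using P0 by (intro mult_left_mono) auto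
      then show ?thesis using False by (simp add: mult_ac)
    qed
    moreover have iA: "integrable N (\<lambda>p. quot u p * indicator ?A p)"
    proof (rule Bochner_Integration.integrable_bound[OF iq])
      have "{p \<in> space N. cmod (b (fst p) - b (snd p)) < \<kappa>} \<in> sets N" by measurable
      then show "(\<lambda>p. quot u p * indicator ?A p) \<in> borel_measurable N"
        by (intro borel_measurable_times quot_measurable borel_measurable_indicator') (auto simp: Int_def conj_commute)
    qed (auto simp: indicator_def)
    moreover note nb = norm_ext_sq[OF circle_map_b norm_b[of x] r0(1) r(2)]
    moreover note nu = norm_ext_sq[OF u norm_b[of x] r0(1) r(2)]
    ultimately have "(\<integral>p. ?PP p * (cmod (u (fst p) - u (snd p)))\<^sup>2 \<partial>N) \<le>
      (\<integral>p. 64 * (quot u p * indicator ?A p) + (4 / \<kappa>\<^sup>2) * (?PP p * (cmod (b (fst p) - b (snd p)))\<^sup>2) \<partial>N)"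
      by (intro integral_mono Bochner_Integration.integrable_add integrable_mult_right) auto
    also have "\<dots> = 64 * ?S k + (4 / \<kappa>\<^sup>2) * (2 - 2 * r\<^sup>2)"
      using iA nb ext_b[OF norm_b[of x] r0(1) r(2)]
      by (simp add: \<kappa>_def norm_mult mult.assoc)
    also have "\<dots> \<le> \<eta> + \<eta>"
    proof (intro add_mono)
      show "64 * ?S k \<le> \<eta>" using k by simp
      have "2 - 2 * r\<^sup>2 = 2 * ((1 - r) * (1 + r))" by (simp add: power2_eq_square algebra_simps)
      also have "\<dots> \<le> 2 * ((\<eta> * \<kappa>\<^sup>2 / 16) * 2)" using r r2 r0 \<eta> by (intro mult_left_mono mult_mono) auto
      finally have "(4 / \<kappa>\<^sup>2) * (2 - 2 * r\<^sup>2) \<le> (4 / \<kappa>\<^sup>2) * (2 * ((\<eta> * \<kappa>\<^sup>2 / 16) * 2))"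
        by (intro mult_left_mono) auto
      also have "\<dots> = \<eta>" using \<kappa> by simp
      finally show "(4 / \<kappa>\<^sup>2) * (2 - 2 * r\<^sup>2) \<le> \<eta>" .
    qed
    finally show ?thesis using nu(1) by simp
  qed
  ultimately show thesis using that by blast
qed

lemma norm_ext_le_1:
  assumes u: "circle_map u" and a: "cmod a = 1" and r: "0 \<le> r" "r < 1"
  shows "cmod (poisson_ext u r a) \<le> 1"
proof -
  have "0 \<le> (\<integral>p. poisson r (a * cnj (b (fst p))) * poisson r (a * cnj (b (snd p))) * (cmod (u (fst p) - u (snd p)))\<^sup>2 \<partial>N)"
    using r poisson_nonneg by (intro integral_nonneg_AE always_eventually allI mult_nonneg_nonneg) auto
  then have "(cmod (poisson_ext u r a))\<^sup>2 \<le> 1\<^sup>2" unfolding norm_ext_sq[OF u a r] by simp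
  then show ?thesis by (rule power2_le_imp_le) simp
qed

section \<open>The degree is an integer\<close>

lemma deg_b: "deg b = 1"
proof -
  have "fourier b n = (if n = 1 then 1 else 0)" "fourier (\<lambda>x. cnj (b x)) n = 0" for n
    using fourier_b_power[of 1 n] fourier_cnj_b_power[of 1 n] by auto
  moreover have "(\<lambda>n. real n * (cmod (if n = 1 then 1 else 0))\<^sup>2) sums 1"
  proof -
    have "(\<lambda>n. real n * (cmod (if n = 1 then 1 else 0))\<^sup>2) = (\<lambda>n. if n = 1 then real n else 0)" by auto
    then show ?thesis using sums_single[of 1 "\<lambda>n. real n"] by simp
  qed
  ultimately show ?thesis unfolding deg_def hardy_def using sums_unique by force
qed

lemma circle_map_sgn:
  assumes p: "finite_dirichlet p" and \<rho>: "\<rho> > 0" "\<And>x. \<rho> \<le> cmod (p x)"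
  shows "circle_map (\<lambda>x. sgn (p x))" "dirichlet (\<lambda>x. sgn (p x)) \<le> (1 / \<rho>)\<^sup>2 * dirichlet p"
proof -
  have n: "cmod (sgn (p x)) = 1" for x using \<rho>(1) \<rho>(2)[of x] by (auto simp: norm_sgn)
  have [measurable]: "p \<in> borel_measurable M" using p by (simp add: finite_dirichlet_def bounded_map_def)
  have "(\<lambda>x. sgn (p x)) \<in> borel_measurable M"
    unfolding sgn_eq by measurable
  then have bm: "bounded_map (\<lambda>x. sgn (p x))" using n by (intro bounded_mapI[of _ 1]) auto
  have l: "cmod (sgn (p x) - sgn (p y)) \<le> (1 / \<rho>) * cmod (p x - p y)" for x y
    by (rule sgn_lipschitz[OF \<rho>(1) \<rho>(2) \<rho>(2)])
  note f = finite_dirichlet_lipschitz[OF bm p l]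
  show "circle_map (\<lambda>x. sgn (p x))" using f(1) n unfolding circle_map_def by blast
  show "dirichlet (\<lambda>x. sgn (p x)) \<le> (1 / \<rho>)\<^sup>2 * dirichlet p" by (rule f(2))
qed

lemma deg_sgn_one_minus:
  assumes a: "cmod a < 1" and v: "circle_map v"
  shows "circle_map (\<lambda>x. sgn (1 - a * v x))" "deg (\<lambda>x. sgn (1 - a * v x)) = 0"
proof -
  have lo: "1 - cmod a \<le> cmod (1 - a * v x)" for x
    using norm_triangle_ineq2[of 1 "a * v x"] v by (simp add: norm_mult circle_mapD)
  have f: "finite_dirichlet (\<lambda>x. 1 + (- a) * v x)"
    by (intro finite_dirichlet_add finite_dirichlet_const finite_dirichlet_mult circle_mapD(1)[OF v])
  show c: "circle_map (\<lambda>x. sgn (1 - a * v x))"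
    by (rule circle_map_sgn(1)[of _ "1 - cmod a"]) (use f a lo in auto)
  show "deg (\<lambda>x. sgn (1 - a * v x)) = 0"
  proof (rule deg_half_plane[OF c, of "(1 - cmod a) / 2"])
    fix x
    have re: "1 - cmod a \<le> Re (1 - a * v x)"
      using complex_Re_le_cmod[of "a * v x"] v by (simp add: norm_mult circle_mapD del: times_complex.sel)
    have n2: "cmod (1 - a * v x) \<le> 2"
      using norm_triangle_ineq4[of 1 "a * v x"] a v by (simp add: norm_mult circle_mapD)
    have "(1 - cmod a) / 2 \<le> Re (1 - a * v x) / cmod (1 - a * v x)"
      using re n2 a lo[of x] by (intro frac_le) auto
    then show "(1 - cmod a) / 2 \<le> Re (sgn (1 - a * v x))"
      by (simp add: sgn_eq Re_divide_of_real del: times_complex.sel)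
  qed (use a in simp)
qed

text \<open>A root inside the disc gives \<open>b\<close> times a map into a half plane, hence degree one; a root outside gives
  a constant times such a map, hence degree zero; roots on the circle are excluded by \<open>range_b_dense\<close>.\<close>

lemma deg_sgn_linear:
  assumes d: "\<delta> > 0" "\<And>x. \<delta> \<le> cmod (b x - a)"
  shows "circle_map (\<lambda>x. sgn (b x - a))" "deg (\<lambda>x. sgn (b x - a)) \<in> \<int>"
proof -
  have "finite_dirichlet (\<lambda>x. b x + (- a))"
    by (intro finite_dirichlet_add finite_dirichlet_const finite_dirichlet_b)
  then show c: "circle_map (\<lambda>x. sgn (b x - a))"
    using d by (intro circle_map_sgn(1)[of _ \<delta>]) auto
  consider "cmod a < 1" | "cmod a > 1" | "cmod a = 1" by linarith
  then show "deg (\<lambda>x. sgn (b x - a)) \<in> \<int>"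
  proof cases
    case 1
    note w = deg_sgn_one_minus[OF 1 circle_map_cnj[OF circle_map_b]]
    have "sgn (b x - a) = b x * sgn (1 - a * cnj (b x))" for x
    proof -
      have "b x - a = b x * (1 - a * cnj (b x))" using b_cnj[of x] by (simp add: algebra_simps)
      moreover have "sgn (b x) = b x" by (simp add: sgn_eq)
      ultimately show ?thesis by (metis sgn_mult)
    qed
    then have "deg (\<lambda>x. sgn (b x - a)) = 1" using deg_mult[OF circle_map_b w(1)] w(2) deg_b by simp
    then show ?thesis by simp
  next
    case 2
    then have "cmod (1 / a) < 1" by (simp add: norm_divide divide_less_eq)
    note w = deg_sgn_one_minus[OF this circle_map_b]
    have "a \<noteq> 0" using 2 by auto
    have "sgn (b x - a) = sgn (- a) * sgn (1 - (1 / a) * b x)" for x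
      unfolding sgn_mult[symmetric] using \<open>a \<noteq> 0\<close> by (simp add: algebra_simps)
    moreover have "circle_map (\<lambda>x. sgn (- a))" using \<open>a \<noteq> 0\<close> by (intro circle_map_const) (simp add: norm_sgn)
    ultimately have "deg (\<lambda>x. sgn (b x - a)) = 0"
      using deg_mult[OF _ w(1), of "\<lambda>x. sgn (- a)"] w(2) deg_const by simp
    then show ?thesis by simp
  next
    case 3
    then show ?thesis using range_b_dense[OF 3 d] by simp
  qed
qed

lemma deg_sgn_poly:
  assumes d: "\<delta> > 0" "\<And>x. \<delta> \<le> cmod (poly p (b x))"
  shows "circle_map (\<lambda>x. sgn (poly p (b x))) \<and> deg (\<lambda>x. sgn (poly p (b x))) \<in> \<int>"
  using d
proof (induction "Polynomial.degree p" arbitrary: p \<delta>)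
  case 0
  then obtain c where c: "p = [:c:]" by (metis degree_eq_zeroE)
  then have "cmod (sgn c) = 1" using 0 by (auto simp: norm_sgn)
  then show ?case using c by (simp add: circle_map_const deg_const)
next
  case (Suc n)
  have "\<not> constant (poly p)" using Suc(2) by (simp add: constant_degree)
  then obtain a where "poly p a = 0" using fundamental_theorem_of_algebra by blast
  then obtain q where q: "p = [:-a, 1:] * q" by (metis poly_eq_0_iff_dvd dvdE)
  then have "q \<noteq> 0" using Suc(2) by auto
  then have dq: "n = Polynomial.degree q"
    using Suc(2) degree_mult_eq[of "[:-a, 1:]" q] by (simp add: q del: mult_pCons_left)
  have pb: "poly p (b x) = (b x - a) * poly q (b x)" for x by (simp add: q algebra_simps)
  have lo: "\<delta> \<le> cmod (b x - a) * cmod (poly q (b x))" for x using Suc(4)[of x] by (simp add: pb norm_mult)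
  have q1: "\<delta> / (1 + cmod a) \<le> cmod (poly q (b x))" for x
  proof -
    have "cmod (b x - a) \<le> 1 + cmod a" using norm_triangle_ineq4[of "b x" a] by simp
    then have "\<delta> \<le> (1 + cmod a) * cmod (poly q (b x))"
      using lo[of x] by (meson mult_right_mono norm_ge_zero order_trans)
    then show ?thesis by (simp add: divide_le_eq add_pos_nonneg mult.commute)
  qed
  have "compact (sphere (0::complex) 1)" by simp
  then have "compact (poly q ` sphere 0 1)" by (intro compact_continuous_image continuous_intros)
  then obtain C where C: "C > 0" "\<And>z. z \<in> sphere 0 1 \<Longrightarrow> cmod (poly q z) \<le> C"
    using compact_imp_bounded bounded_pos by (metis image_eqI)
  have l1: "\<delta> / C \<le> cmod (b x - a)" for x
  proof -
    have "cmod (b x - a) * cmod (poly q (b x)) \<le> cmod (b x - a) * C"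
      using C(2)[of "b x"] by (intro mult_left_mono) auto
    then show ?thesis using lo[of x] C(1) by (simp add: pos_divide_le_eq)
  qed
  have "\<delta> / (1 + cmod a) > 0" using Suc(3) by (simp add: add_pos_nonneg)
  note IH = Suc(1)[OF dq this q1]
  have "\<delta> / C > 0" using Suc(3) C by simp
  note lin = deg_sgn_linear[OF this l1]
  show ?case unfolding pb sgn_mult
    using IH lin circle_map_mult[OF lin(1)] deg_mult[OF lin(1)] by simp
qed


lemma hardy_lower_semicontinuous:
  assumes u: "finite_dirichlet u" and v: "\<And>k. finite_dirichlet (v k)"
    and conv: "\<And>n. (\<lambda>k. fourier (v k) n) \<longlonglongrightarrow> fourier u n" and e: "e > 0"
  shows "\<forall>\<^sub>F k in sequentially. hardy u - e < hardy (v k)"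
proof -
  let ?s = "\<lambda>u N. \<Sum>n<N. real n * (cmod (fourier u n))\<^sup>2"
  have "(\<lambda>N. ?s u N) \<longlonglongrightarrow> hardy u" unfolding hardy_def by (rule summable_LIMSEQ[OF hardy_sum(1)[OF u]])
  then have "\<forall>\<^sub>F N in sequentially. hardy u - e < ?s u N" using e by (intro order_tendstoD(1)) auto
  then obtain N where N: "hardy u - e < ?s u N" by (auto simp: eventually_sequentially)
  have "(\<lambda>k. ?s (v k) N) \<longlonglongrightarrow> ?s u N" by (intro tendsto_intros conv)
  then have "\<forall>\<^sub>F k in sequentially. hardy u - e < ?s (v k) N" using N by (intro order_tendstoD(1)) auto
  then show ?thesis
  proof eventually_elim
    case (elim k)
    have "?s (v k) N \<le> hardy (v k)" unfolding hardy_def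
      by (rule sum_le_suminf[OF hardy_sum(1)[OF v]]) auto
    then show ?case using elim by linarith
  qed
qed

text \<open>Neither of the two lower semicontinuous halves of the energy can jump when their sum does not drop.\<close>

lemma deg_tendsto:
  assumes u: "finite_dirichlet u" and v: "\<And>k. finite_dirichlet (v k)"
    and conv: "\<And>n. (\<lambda>k. fourier (v k) n) \<longlonglongrightarrow> fourier u n"
      "\<And>n. (\<lambda>k. fourier (\<lambda>x. cnj (v k x)) n) \<longlonglongrightarrow> fourier (\<lambda>x. cnj (u x)) n"
    and c: "\<And>k. dirichlet (v k) \<le> c k" "c \<longlonglongrightarrow> dirichlet u"
  shows "(\<lambda>k. deg (v k)) \<longlonglongrightarrow> deg u"
proof (rule tendstoI)
  fix e :: real assume e: "e > 0"
  then have e8: "e / 8 > 0" by simp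
  note l1 = hardy_lower_semicontinuous[OF u v conv(1) e8]
  note l2 = hardy_lower_semicontinuous[OF finite_dirichlet_cnj[OF u] finite_dirichlet_cnj[OF v] conv(2) e8]
  have l3: "\<forall>\<^sub>F k in sequentially. c k < dirichlet u + e / 8" using e by (intro order_tendstoD(2)[OF c(2)]) simp
  show "\<forall>\<^sub>F k in sequentially. dist (deg (v k)) (deg u) < e"
    using l1 l2 l3
  proof eventually_elim
    case (elim k)
    have "hardy (v k) + hardy (\<lambda>x. cnj (v k x)) \<le> c k" "hardy u + hardy (\<lambda>x. cnj (u x)) = dirichlet u"
      using hardy_sum(3)[OF v[of k]] hardy_sum(3)[OF u] c(1)[of k] by simp_all
    then show ?case using elim e unfolding deg_def dist_real_def by linarith
  qed
qed

lemma cnj_trunc: "cnj (trunc u r K a) = trunc (\<lambda>x. cnj (u x)) r K a"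
  unfolding trunc_def
  by (simp add: add.commute fourier_def flip: Bochner_Integration.integral_cnj)

lemma trunc_b:
  assumes u: "bounded_map u"
  shows "finite_dirichlet (\<lambda>x. trunc u r K (b x))"
    and "fourier (\<lambda>x. trunc u r K (b x)) n = (if n \<le> K then of_real (r ^ n) * fourier u n else 0)"
proof -
  let ?f = "\<lambda>j x. of_real (r ^ j) *
     (fourier u j * b x ^ j + cnj (fourier (\<lambda>x. cnj (u x)) j) * cnj (b x) ^ j)"
  have t: "finite_dirichlet (?f j)" for j
    by (intro finite_dirichlet_mult finite_dirichlet_add finite_dirichlet_const finite_dirichlet_power
        finite_dirichlet_cnj finite_dirichlet_b)
  then have tb: "bounded_map (?f j)" for j by (rule finite_dirichlet_bounded)
  show "finite_dirichlet (\<lambda>x. trunc u r K (b x))" unfolding trunc_def using t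
    by (intro finite_dirichlet_add finite_dirichlet_const finite_dirichlet_sum) auto
  have c: "fourier (\<lambda>x. a) n = (if n = 0 then a else 0)" for a
    using fourier_scale[of a "\<lambda>x. 1" n] fourier_b_power[of 0 n] by auto
  have bp: "bounded_map (\<lambda>x. a * b x ^ j)" "bounded_map (\<lambda>x. a * cnj (b x) ^ j)" for a j
    by (intro bounded_map_mult bounded_map_const bounded_map_power bounded_map_cnj bounded_map_b)+
  have f: "fourier (?f j) n = (if j = n then of_real (r ^ n) * fourier u n else 0)" if "j \<ge> 1" for j
    unfolding fourier_scale fourier_add[OF bp] fourier_b_power fourier_cnj_b_power using that by simp
  have "fourier (\<lambda>x. trunc u r K (b x)) n = (if n = 0 then fourier u 0 else 0) + (\<Sum>j=1..K. fourier (?f j) n)"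
    unfolding trunc_def
    by (simp only: fourier_add[OF bounded_map_const bounded_map_sum[OF finite_atLeastAtMost tb]]
        fourier_sum[OF finite_atLeastAtMost tb] c)
  also have "(\<Sum>j=1..K. fourier (?f j) n) = (\<Sum>j=1..K. if j = n then of_real (r ^ n) * fourier u n else 0)"
    by (intro sum.cong refl f) simp
  finally show "fourier (\<lambda>x. trunc u r K (b x)) n = (if n \<le> K then of_real (r ^ n) * fourier u n else 0)"
    by (cases "n = 0") auto
qed

lemma dirichlet_trunc_le:
  assumes u: "finite_dirichlet u" and r: "0 \<le> r" "r \<le> 1"
  shows "dirichlet (\<lambda>x. trunc u r K (b x)) \<le> dirichlet u"
proof -
  have h: "hardy (\<lambda>x. trunc v r K (b x)) \<le> hardy v" if v: "finite_dirichlet v" for v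
    unfolding hardy_def
  proof (rule suminf_le)
    show "summable (\<lambda>n. real n * (cmod (fourier (\<lambda>x. trunc v r K (b x)) n))\<^sup>2)"
      by (rule hardy_sum(1)[OF trunc_b(1)[OF finite_dirichlet_bounded[OF v]]])
    show "summable (\<lambda>n. real n * (cmod (fourier v n))\<^sup>2)" by (rule hardy_sum(1)[OF v])
    fix n
    have "cmod (of_real (r ^ n) * fourier v n) \<le> cmod (fourier v n)"
      using r by (simp add: norm_mult norm_power mult_left_le_one_le power_le_one)
    then show "real n * (cmod (fourier (\<lambda>x. trunc v r K (b x)) n))\<^sup>2 \<le> real n * (cmod (fourier v n))\<^sup>2"
      unfolding trunc_b(2)[OF finite_dirichlet_bounded[OF v]] by (auto intro!: mult_left_mono power_mono)
  qed
  show ?thesis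
    using hardy_sum(3)[OF trunc_b(1)[OF finite_dirichlet_bounded[OF u], of r K]] hardy_sum(3)[OF u]
      h[OF u] h[OF finite_dirichlet_cnj[OF u]] by (simp add: cnj_trunc)
qed

lemma trunc_poly:
  obtains p where "\<And>a. cmod a = 1 \<Longrightarrow> trunc u r K a = cnj a ^ K * poly p a"
proof
  let ?p = "monom (fourier u 0) K + (\<Sum>n=1..K. smult (of_real (r ^ n))
     (monom (fourier u n) (K + n) + monom (cnj (fourier (\<lambda>x. cnj (u x)) n)) (K - n)))"
  fix a :: complex assume a: "cmod a = 1"
  have aa: "cnj a * a = 1" using a by (metis complex_norm_square mult.commute of_real_1 power_one)
  have up: "cnj a ^ K * a ^ (K + n) = a ^ n" for n
    by (simp add: power_add mult.assoc[symmetric] flip: power_mult_distrib) (simp add: aa)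
  have down: "cnj a ^ K * a ^ (K - n) = cnj a ^ n" if "n \<le> K" for n
  proof -
    have "cnj a ^ K = cnj a ^ n * cnj a ^ (K - n)" using that by (simp flip: power_add)
    then show ?thesis by (simp add: mult.assoc flip: power_mult_distrib) (simp add: aa)
  qed
  have "cnj a ^ K * poly ?p a = fourier u 0 * (cnj a ^ K * a ^ (K + 0)) + (\<Sum>n=1..K. of_real (r ^ n) *
      (fourier u n * (cnj a ^ K * a ^ (K + n)) + cnj (fourier (\<lambda>x. cnj (u x)) n) * (cnj a ^ K * a ^ (K - n))))"
    by (simp add: poly_sum poly_monom algebra_simps sum_distrib_left)
  also have "\<dots> = trunc u r K a" unfolding trunc_def up by (simp add: down)
  finally show "trunc u r K a = cnj a ^ K * poly ?p a" ..
qed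

text \<open>The Poisson extension of radius close to one is nearly unimodular, uniformly; its truncation is a trigonometric
  polynomial with the same property and no more energy than \<open>u\<close>. Projection to the circle increases the energy only by a factor close to one.\<close>

lemma approximation:
  assumes u: "circle_map u" and \<eta>: "0 < \<eta>" "\<eta> \<le> 1 / 4"
  obtains v where "circle_map v" "deg v \<in> \<int>" "dirichlet v \<le> (1 / (1 - 2 * \<eta>))\<^sup>2 * dirichlet u"
    "\<And>n. real n \<le> 1 / \<eta> \<Longrightarrow> cmod (fourier v n - fourier u n) \<le> (real n + 2) * \<eta>"
    "\<And>n. real n \<le> 1 / \<eta> \<Longrightarrow> cmod (fourier (\<lambda>x. cnj (v x)) n - fourier (\<lambda>x. cnj (u x)) n) \<le> (real n + 2) * \<eta>"
proof -
  obtain r0 where r0: "r0 < 1"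
    "\<And>r x. r0 \<le> r \<Longrightarrow> 0 \<le> r \<Longrightarrow> r < 1 \<Longrightarrow> 1 - (cmod (poisson_ext u r (b x)))\<^sup>2 \<le> \<eta>"
    using norm_ext_near_1[OF u \<eta>(1)] by blast
  \<comment> \<open>\<open>1 - r \<le> \<eta>\<close> controls the Fourier coefficients, \<open>r0 \<le> r\<close> the modulus\<close>
  define r where "r = max r0 (1 - \<eta>)"
  have r: "r0 \<le> r" "1 - \<eta> \<le> r" "0 \<le> r" "r < 1" using r0 \<eta> by (auto simp: r_def)
  have ext: "1 - \<eta> \<le> cmod (poisson_ext u r (b x))" "cmod (poisson_ext u r (b x)) \<le> 1" for x
  proof -
    show le: "cmod (poisson_ext u r (b x)) \<le> 1" by (rule norm_ext_le_1[OF u norm_b r(3,4)])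
    have "(cmod (poisson_ext u r (b x)))\<^sup>2 \<le> cmod (poisson_ext u r (b x)) * 1"
      unfolding power2_eq_square using le by (intro mult_left_mono) auto
    then show "1 - \<eta> \<le> cmod (poisson_ext u r (b x))" using r0(2)[OF r(1,3,4), of x] by linarith
  qed
  have "(\<lambda>K. 1 * (2 * r ^ Suc K / (1 - r))) \<longlonglongrightarrow> 1 * (2 * 0 / (1 - r))"
    using r LIMSEQ_Suc[OF LIMSEQ_realpow_zero[OF r(3,4)]] by (intro tendsto_intros) auto
  then have "\<forall>\<^sub>F K in sequentially. 1 * (2 * r ^ Suc K / (1 - r)) < \<eta>"
    using \<eta> by (intro order_tendstoD(2)) auto
  then obtain K0 where K0: "\<And>K. K \<ge> K0 \<Longrightarrow> 1 * (2 * r ^ Suc K / (1 - r)) < \<eta>"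
    by (auto simp: eventually_sequentially)
  \<comment> \<open>large enough for a uniform error \<open>\<eta>\<close> and for keeping all frequencies up to \<open>1 / \<eta>\<close>\<close>
  define K where "K = max K0 (nat \<lceil>1 / \<eta>\<rceil>)"
  have K: "1 * (2 * r ^ Suc K / (1 - r)) < \<eta>" by (rule K0) (simp add: K_def)
  have Kn: "n \<le> K" if "real n \<le> 1 / \<eta>" for n using that unfolding K_def by linarith
  define p where "p x = trunc u r K (b x)" for x
  have near: "cmod (poisson_ext u r (b x) - p x) \<le> \<eta>" for x
    using ext_trunc[OF circle_mapD(2)[OF u], of 1 "b x" r K] K r u by (simp add: p_def circle_mapD)
  have p: "1 - 2 * \<eta> \<le> cmod (p x)" "\<bar>cmod (p x) - 1\<bar> \<le> 2 * \<eta>" for x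
    using near[of x] ext[of x] norm_triangle_ineq2[of "poisson_ext u r (b x)" "p x"]
      norm_triangle_ineq3[of "poisson_ext u r (b x)" "p x"] by linarith+
  have fp: "finite_dirichlet p" unfolding p_def by (rule trunc_b(1)[OF circle_mapD(2)[OF u]])
  define v where "v x = sgn (p x)" for x
  have pos: "1 - 2 * \<eta> > 0" using \<eta> by simp
  note cv = circle_map_sgn[OF fp pos p(1), folded v_def]
  have dv: "dirichlet v \<le> (1 / (1 - 2 * \<eta>))\<^sup>2 * dirichlet u"
  proof -
    have "dirichlet p \<le> dirichlet u"
      unfolding p_def by (rule dirichlet_trunc_le[OF circle_mapD(1)[OF u]]) (use r in auto)
    then have "(1 / (1 - 2 * \<eta>))\<^sup>2 * dirichlet p \<le> (1 / (1 - 2 * \<eta>))\<^sup>2 * dirichlet u"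
      by (intro mult_left_mono) auto
    then show ?thesis using cv(2) unfolding v_def by linarith
  qed
  have degv: "deg v \<in> \<int>"
  proof -
    obtain q where q: "\<And>a. cmod a = 1 \<Longrightarrow> trunc u r K a = cnj a ^ K * poly q a" using trunc_poly by blast
    have "cmod (p x) = cmod (poly q (b x))" for x by (simp add: p_def q norm_mult norm_power)
    then have "1 - 2 * \<eta> \<le> cmod (poly q (b x))" for x using p(1)[of x] by simp
    note Q = deg_sgn_poly[OF pos this]
    have bK: "circle_map (\<lambda>x. cnj (b x) ^ K)" "deg (\<lambda>x. cnj (b x) ^ K) = - real K"
      using deg_power[OF circle_map_cnj[OF circle_map_b], of K] by (simp_all add: deg_cnj deg_b)
    have "v x = cnj (b x) ^ K * sgn (poly q (b x))" for x
      by (simp add: v_def p_def q sgn_mult) (simp add: sgn_eq norm_power)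
    then have "v = (\<lambda>x. cnj (b x) ^ K * sgn (poly q (b x)))" by blast
    then have "deg v = - real K + deg (\<lambda>x. sgn (poly q (b x)))"
      using deg_mult[OF bK(1) conjunct1[OF Q]] bK(2) by simp
    then show ?thesis using Q by simp
  qed
  have close: "cmod (v x - p x) \<le> 2 * \<eta>" for x
  proof -
    have "p x \<noteq> 0" using p(1)[of x] pos by auto
    then have "v x - p x = sgn (p x) * of_real (1 - cmod (p x))"
      by (simp add: v_def sgn_eq field_simps)
    then have "cmod (v x - p x) = \<bar>1 - cmod (p x)\<bar>" using \<open>p x \<noteq> 0\<close> by (simp only: norm_mult norm_sgn norm_of_real) simp
    then show ?thesis using p(2)[of x] by linarith
  qed
  have est: "cmod (fourier v' n - fourier u' n) \<le> (real n + 2) * \<eta>"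
    if n: "real n \<le> 1 / \<eta>" and v': "circle_map v'" and u': "circle_map u'"
      and cl: "\<And>x. cmod (v' x - trunc u' r K (b x)) \<le> 2 * \<eta>" for n v' u'
  proof -
    let ?p = "\<lambda>x. trunc u' r K (b x)"
    have bp: "bounded_map ?p" by (rule finite_dirichlet_bounded[OF trunc_b(1)[OF circle_mapD(2)[OF u']]])
    have "cmod (fourier (\<lambda>x. v' x - ?p x) n) \<le> 2 * \<eta>"
      by (rule norm_fourier_le[OF bounded_map_diff[OF circle_mapD(2)[OF v'] bp] cl])
    then have 1: "cmod (fourier v' n - fourier ?p n) \<le> 2 * \<eta>"
      by (simp add: fourier_diff[OF circle_mapD(2)[OF v'] bp])
    have fp': "fourier ?p n = of_real (r ^ n) * fourier u' n"
      using trunc_b(2)[OF circle_mapD(2)[OF u'], of r K n] Kn[OF n] by simp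
    have "fourier ?p n - fourier u' n = of_real (r ^ n - 1) * fourier u' n"
      unfolding fp' by (simp add: left_diff_distrib)
    then have "cmod (fourier ?p n - fourier u' n) = \<bar>r ^ n - 1\<bar> * cmod (fourier u' n)"
      by (simp only: norm_mult norm_of_real)
    also have "\<dots> \<le> \<bar>r ^ n - 1\<bar> * 1"
      by (intro mult_left_mono norm_fourier_le circle_mapD(2)[OF u']) (simp_all add: circle_mapD(5)[OF u'])
    also have "\<dots> \<le> real n * \<eta>"
    proof -
      have "1 + real n * (r - 1) \<le> (1 + (r - 1)) ^ n" by (rule Bernoulli_inequality) (use r in simp)
      moreover have "r ^ n \<le> 1" using r by (simp add: power_le_one)
      moreover have "real n * (1 - r) \<le> real n * \<eta>" using r by (intro mult_left_mono) auto
      ultimately show ?thesis by (simp add: algebra_simps)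
    qed
    finally have 2: "cmod (fourier ?p n - fourier u' n) \<le> real n * \<eta>" .
    have "cmod (fourier v' n - fourier u' n) \<le> cmod (fourier v' n - fourier ?p n) + cmod (fourier ?p n - fourier u' n)"
      using norm_triangle_ineq[of "fourier v' n - fourier ?p n" "fourier ?p n - fourier u' n"] by simp
    then show ?thesis using 1 2 by (simp add: distrib_right)
  qed
  have cvv: "circle_map v" using cv(1) unfolding v_def .
  have e1: "cmod (fourier v n - fourier u n) \<le> (real n + 2) * \<eta>" if "real n \<le> 1 / \<eta>" for n
    by (rule est[OF that cvv u close[unfolded p_def]])
  have cl2: "cmod (cnj (v x) - trunc (\<lambda>x. cnj (u x)) r K (b x)) \<le> 2 * \<eta>" for x
    using close[of x] unfolding p_def cnj_trunc[symmetric] complex_cnj_diff[symmetric] complex_mod_cnj .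
  have e2: "cmod (fourier (\<lambda>x. cnj (v x)) n - fourier (\<lambda>x. cnj (u x)) n) \<le> (real n + 2) * \<eta>" if "real n \<le> 1 / \<eta>" for n
    by (rule est[OF that circle_map_cnj[OF cvv] circle_map_cnj[OF u] cl2])
  show thesis by (rule that[OF cvv degv dv e1 e2])
qed

theorem deg_Ints:
  assumes u: "circle_map u"
  shows "deg u \<in> \<int>"
proof -
  define \<eta> where "\<eta> k = 1 / real (k + 4)" for k :: nat
  have \<eta>: "0 < \<eta> k" "\<eta> k \<le> 1 / 4" for k by (simp_all add: \<eta>_def)
  have \<eta>0: "\<eta> \<longlonglongrightarrow> 0"
    unfolding \<eta>_def using LIMSEQ_ignore_initial_segment[OF lim_const_over_n[of "1::real"], of 4] by simp
  have "\<exists>v. circle_map v \<and> deg v \<in> \<int> \<and> dirichlet v \<le> (1 / (1 - 2 * \<eta> k))\<^sup>2 * dirichlet u \<and>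
    (\<forall>n. real n \<le> 1 / \<eta> k \<longrightarrow> cmod (fourier v n - fourier u n) \<le> (real n + 2) * \<eta> k) \<and>
    (\<forall>n. real n \<le> 1 / \<eta> k \<longrightarrow> cmod (fourier (\<lambda>x. cnj (v x)) n - fourier (\<lambda>x. cnj (u x)) n) \<le> (real n + 2) * \<eta> k)" for k
    by (rule approximation[OF u \<eta>(1)[of k] \<eta>(2)[of k]]) blast
  then have "\<exists>v. \<forall>k. circle_map (v k) \<and> deg (v k) \<in> \<int> \<and> dirichlet (v k) \<le> (1 / (1 - 2 * \<eta> k))\<^sup>2 * dirichlet u \<and>
    (\<forall>n. real n \<le> 1 / \<eta> k \<longrightarrow> cmod (fourier (v k) n - fourier u n) \<le> (real n + 2) * \<eta> k) \<and>
    (\<forall>n. real n \<le> 1 / \<eta> k \<longrightarrow> cmod (fourier (\<lambda>x. cnj (v k x)) n - fourier (\<lambda>x. cnj (u x)) n) \<le> (real n + 2) * \<eta> k)"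
    by (intro choice allI)
  then obtain v where v: "\<And>k. circle_map (v k)" "\<And>k. deg (v k) \<in> \<int>"
    "\<And>k. dirichlet (v k) \<le> (1 / (1 - 2 * \<eta> k))\<^sup>2 * dirichlet u"
    "\<And>k n. real n \<le> 1 / \<eta> k \<Longrightarrow> cmod (fourier (v k) n - fourier u n) \<le> (real n + 2) * \<eta> k"
    "\<And>k n. real n \<le> 1 / \<eta> k \<Longrightarrow> cmod (fourier (\<lambda>x. cnj (v k x)) n - fourier (\<lambda>x. cnj (u x)) n) \<le> (real n + 2) * \<eta> k"
    by blast
  have lim: "f \<longlonglongrightarrow> l" if "\<And>k. real n \<le> 1 / \<eta> k \<Longrightarrow> cmod (f k - l) \<le> (real n + 2) * \<eta> k" for f l and n :: nat
  proof (rule Lim_null[THEN iffD2], rule Lim_null_comparison)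
    show "\<forall>\<^sub>F k in sequentially. cmod (f k - l) \<le> (real n + 2) * \<eta> k"
      using eventually_ge_at_top[of n] by eventually_elim (rule that, simp add: \<eta>_def)
    show "(\<lambda>k. (real n + 2) * \<eta> k) \<longlonglongrightarrow> 0" using tendsto_mult_left[OF \<eta>0, of "real n + 2"] by simp
  qed
  have "(\<lambda>k. deg (v k)) \<longlonglongrightarrow> deg u"
  proof (rule deg_tendsto)
    show "(\<lambda>k. (1 / (1 - 2 * \<eta> k))\<^sup>2 * dirichlet u) \<longlonglongrightarrow> dirichlet u"
    proof -
      have "(\<lambda>k. (1 / (1 - 2 * \<eta> k))\<^sup>2 * dirichlet u) \<longlonglongrightarrow> (1 / (1 - 2 * 0))\<^sup>2 * dirichlet u"
        by (intro tendsto_intros \<eta>0) auto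
      then show ?thesis by simp
    qed
    show "(\<lambda>k. fourier (v k) n) \<longlonglongrightarrow> fourier u n" for n by (rule lim) (rule v(4))
    show "(\<lambda>k. fourier (\<lambda>x. cnj (v k x)) n) \<longlonglongrightarrow> fourier (\<lambda>x. cnj (u x)) n" for n by (rule lim) (rule v(5))
    show "finite_dirichlet u" by (rule circle_mapD(1)[OF u])
    show "finite_dirichlet (v k)" for k by (rule circle_mapD(1)[OF v(1)])
    show "dirichlet (v k) \<le> (1 / (1 - 2 * \<eta> k))\<^sup>2 * dirichlet u" for k by (rule v(3))
  qed
  then show ?thesis using closed_sequentially[OF closed_Ints, of "\<lambda>k. deg (v k)" "deg u"] v(2) by blast
qed

end

text \<open>A countable product of discs is compact and first countable.\<close>

lemma bounded_family_convergent_subsequence: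
  fixes f :: "nat \<Rightarrow> nat \<Rightarrow> complex"
  assumes "\<And>k n. cmod (f k n) \<le> C"
  obtains s where "strict_mono s" "\<And>n. convergent (\<lambda>k. f (s k) n)"
proof -
  have "compactin (product_topology (\<lambda>_. euclidean) UNIV) (\<Pi>\<^sub>E n\<in>(UNIV::nat set). cball (0::complex) C)"
    by (subst compactin_PiE) auto
  then have "compact (\<Pi>\<^sub>E n\<in>(UNIV::nat set). cball (0::complex) C)"
    by (simp add: euclidean_product_topology)
  then have "seq_compact (\<Pi>\<^sub>E n\<in>(UNIV::nat set). cball (0::complex) C)"
    by (rule compact_imp_seq_compact)
  moreover have "\<And>k. f k \<in> (\<Pi>\<^sub>E n\<in>UNIV. cball 0 C)" using assms by auto
  ultimately obtain l s where s: "strict_mono s" "(f \<circ> s) \<longlonglongrightarrow> l"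
    unfolding seq_compact_def by blast
  have "(\<lambda>k. f (s k) n) \<longlonglongrightarrow> l n" for n
  proof -
    have "continuous_on UNIV (\<lambda>g::nat \<Rightarrow> complex. g n)" by (rule continuous_on_product_coordinates)
    then have "isCont (\<lambda>g::nat \<Rightarrow> complex. g n) l" by (rule continuous_on_interior) simp
    from isCont_tendsto_compose[OF this s(2)] show ?thesis by simp
  qed
  then show thesis using that[OF s(1)] by (auto simp: convergent_def)
qed

context circle_space
begin

section \<open>Compactness\<close>

lemma poisson_omega_measurable [measurable]: "(\<lambda>p. poisson r (omega p)) \<in> borel_measurable N"
  unfolding poisson_def by measurable

lemma poisson_omega_integral:
  assumes r: "0 \<le> r" "r < 1"
  shows "integrable N (\<lambda>p. poisson r (omega p))" "(\<integral>p. poisson r (omega p) \<partial>N) = 1"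
proof -
  show i: "integrable N (\<lambda>p. poisson r (omega p))"
  proof (rule integrable_pairI[of _ "2 / (1 - r)"])
    show "norm (poisson r (omega p)) \<le> 2 / (1 - r)" for p
      using poisson_bound[OF norm_omega r, of p] poisson_nonneg[of r "omega p"] r by simp
  qed measurable
  show "(\<integral>p. poisson r (omega p) \<partial>N) = 1"
    using P.integral_fst'[OF i] poisson_integral_1[OF norm_b r] by (simp add: omega_def prob_space)
qed

text \<open>The mean of \<open>\<bar>f x - f y\<bar>\<close> under the Poisson kernel is split by \<open>d \<le> s/2 + d\<^sup>2/(2 s)\<close>; the kernel has mass one
  and is at most \<open>(1 - r\<^sup>2) / r\<close> times \<open>1 / \<bar>b x - b y\<bar>\<^sup>2\<close>.\<close>

lemma L1_diff_ext_le:
  assumes f: "finite_dirichlet f" and r: "0 < r" "r < 1" and s: "s > 0"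
  shows "(\<integral>x. cmod (f x - poisson_ext f r (b x)) \<partial>M) \<le> s / 2 + (1 - r\<^sup>2) / (2 * r * s) * dirichlet f"
    and "integrable M (\<lambda>x. cmod (f x - poisson_ext f r (b x)))"
proof -
  have bf: "bounded_map f" using f by (rule finite_dirichlet_bounded)
  then have [measurable]: "f \<in> borel_measurable M" by (rule bounded_map_measurable)
  have r': "0 \<le> r" using r by simp
  obtain C where C: "C \<ge> 0" "\<And>x. cmod (f x) \<le> C" using bf by (metis bounded_mapE)
  let ?h = "\<lambda>p. poisson r (omega p) * cmod (f (fst p) - f (snd p))"
  let ?w = "\<lambda>p. s / 2 * poisson r (omega p) + (1 - r\<^sup>2) / (2 * r * s) * quot f p"
  have iw: "integrable N ?w"
    using poisson_omega_integral(1)[OF r' r(2)] f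
    by (intro Bochner_Integration.integrable_add integrable_mult_right) (auto simp: finite_dirichlet_def)
  have h0: "0 \<le> ?h p" for p using poisson_nonneg[of r "omega p"] r by simp
  have hw: "?h p \<le> ?w p" for p
  proof (cases "omega p = 1")
    case True
    then have "fst p = snd p" by (simp add: omega_eq_1_iff)
    then show ?thesis using poisson_nonneg[of r "omega p"] r s by (simp add: quot_def)
  next
    case False
    let ?P = "poisson r (omega p)" and ?d = "cmod (f (fst p) - f (snd p))"
    have P0: "0 \<le> ?P" using r by (intro poisson_nonneg) auto
    have d0: "(cmod (b (fst p) - b (snd p)))\<^sup>2 > 0" using False by (simp flip: norm_one_minus_omega)
    have "?P * ?d\<^sup>2 \<le> (1 - r\<^sup>2) / (r * (cmod (b (fst p) - b (snd p)))\<^sup>2) * ?d\<^sup>2"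
      using poisson_le[OF norm_omega r False] by (intro mult_right_mono) (simp_all add: norm_one_minus_omega)
    also have "\<dots> = (1 - r\<^sup>2) / r * quot f p" by (simp add: quot_def)
    finally have 1: "?P * ?d\<^sup>2 \<le> (1 - r\<^sup>2) / r * quot f p" .
    have "?d \<le> s / 2 + ?d\<^sup>2 / (2 * s)"
    proof -
      have "0 \<le> (s - ?d)\<^sup>2 / (2 * s)" using s by simp
      also have "\<dots> = s / 2 + ?d\<^sup>2 / (2 * s) - ?d" using s by (simp add: power2_eq_square field_simps)
      finally show ?thesis by simp
    qed
    then have "?h p \<le> ?P * (s / 2 + ?d\<^sup>2 / (2 * s))" using P0 by (rule mult_left_mono)
    also have "\<dots> = s / 2 * ?P + (?P * ?d\<^sup>2) / (2 * s)" by (simp add: algebra_simps)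
    also have "\<dots> \<le> s / 2 * ?P + ((1 - r\<^sup>2) / r * quot f p) / (2 * s)"
      using 1 s by (intro add_left_mono divide_right_mono) auto
    finally show ?thesis by (simp add: mult_ac)
  qed
  have ih: "integrable N ?h"
  proof (rule Bochner_Integration.integrable_bound[OF iw])
    show "AE p in N. norm (?h p) \<le> norm (?w p)"
    proof (intro always_eventually allI)
      show "norm (?h p) \<le> norm (?w p)" for p
        using h0[of p] hw[of p] unfolding real_norm_def by linarith
    qed
  qed measurable
  have pt: "cmod (f x - poisson_ext f r (b x)) \<le> (\<integral>y. ?h (x, y) \<partial>M)" for x
  proof -
    note bP = bounded_map_poisson[OF norm_b r' r(2), of x]
    have i1: "integrable M (\<lambda>y. of_real (poisson r (b x * cnj (b y))) * f x)"
      by (intro bounded_map_integrable bounded_map_mult bP bounded_map_const)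
    have i2: "integrable M (\<lambda>y. of_real (poisson r (b x * cnj (b y))) * f y)"
      by (intro bounded_map_integrable bounded_map_mult bP bf)
    have "(\<integral>y. of_real (poisson r (b x * cnj (b y))) * f x \<partial>M) = f x"
      using poisson_integral_1[OF norm_b r' r(2), of x] by simp
    then have "f x - poisson_ext f r (b x) = (\<integral>y. of_real (poisson r (b x * cnj (b y))) * f x - of_real (poisson r (b x * cnj (b y))) * f y \<partial>M)"
      unfolding poisson_ext_def Bochner_Integration.integral_diff[OF i1 i2] by simp
    also have "cmod \<dots> \<le> (\<integral>y. cmod (of_real (poisson r (b x * cnj (b y))) * f x - of_real (poisson r (b x * cnj (b y))) * f y) \<partial>M)"
      by (rule integral_norm_bound)
    also have "\<dots> = (\<integral>y. ?h (x, y) \<partial>M)"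
    proof (rule Bochner_Integration.integral_cong[OF refl])
      fix y
      have "0 \<le> poisson r (b x * cnj (b y))" using r by (intro poisson_nonneg) auto
      then show "cmod (of_real (poisson r (b x * cnj (b y))) * f x - of_real (poisson r (b x * cnj (b y))) * f y) = ?h (x, y)"
        by (simp add: omega_def norm_mult flip: right_diff_distrib)
    qed
    finally show ?thesis .
  qed
  have "(\<lambda>x. poisson_ext f r (b x)) \<in> borel_measurable M"
    unfolding poisson_ext_def poisson_def by measurable
  then have m: "(\<lambda>x. cmod (f x - poisson_ext f r (b x))) \<in> borel_measurable M" by measurable
  have ih1: "integrable M (\<lambda>x. \<integral>y. ?h (x, y) \<partial>M)" by (rule P.integrable_fst'[OF ih])
  show i: "integrable M (\<lambda>x. cmod (f x - poisson_ext f r (b x)))"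
  proof (rule Bochner_Integration.integrable_bound[OF ih1 m], intro always_eventually allI)
    show "norm (cmod (f x - poisson_ext f r (b x))) \<le> norm (\<integral>y. ?h (x, y) \<partial>M)" for x
      using order_trans[OF pt abs_ge_self, of x] by (simp only: real_norm_def abs_norm_cancel)
  qed
  have "(\<integral>x. cmod (f x - poisson_ext f r (b x)) \<partial>M) \<le> (\<integral>x. (\<integral>y. ?h (x, y) \<partial>M) \<partial>M)"
    by (intro integral_mono i ih1 pt)
  also have "\<dots> = (\<integral>p. ?h p \<partial>N)" by (rule P.integral_fst'[OF ih])
  also have "\<dots> \<le> (\<integral>p. ?w p \<partial>N)" by (intro integral_mono ih iw hw)
  also have "\<dots> = s / 2 + (1 - r\<^sup>2) / (2 * r * s) * dirichlet f"
    using poisson_omega_integral[OF r' r(2)] f by (simp add: finite_dirichlet_def dirichlet_def)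
  finally show "(\<integral>x. cmod (f x - poisson_ext f r (b x)) \<partial>M) \<le> s / 2 + (1 - r\<^sup>2) / (2 * r * s) * dirichlet f" .
qed

lemma L1_norm_le:
  assumes f: "finite_dirichlet f" "\<And>x. cmod (f x) \<le> C" and r: "0 < r" "r < 1" and s: "s > 0"
  shows "(\<integral>x. cmod (f x) \<partial>M) \<le> s / 2 + (1 - r\<^sup>2) / (2 * r * s) * dirichlet f +
     (cmod (fourier f 0) + (\<Sum>n=1..K. cmod (fourier f n) + cmod (fourier (\<lambda>x. cnj (f x)) n)))
     + C * (2 * r ^ Suc K / (1 - r))"
proof -
  have bf: "bounded_map f" using f(1) by (rule finite_dirichlet_bounded)
  let ?T = "cmod (fourier f 0) + (\<Sum>n=1..K. cmod (fourier f n) + cmod (fourier (\<lambda>x. cnj (f x)) n))"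
  let ?E = "C * (2 * r ^ Suc K / (1 - r))"
  have "cmod (f x) \<le> cmod (f x - poisson_ext f r (b x)) + (?T + ?E)" for x
  proof -
    have "cmod (trunc f r K (b x)) \<le> ?T" unfolding trunc_def
    proof (intro order_trans[OF norm_triangle_ineq] add_mono order_refl order_trans[OF norm_sum] sum_mono)
      fix n
      have "cmod (fourier f n * b x ^ n + cnj (fourier (\<lambda>x. cnj (f x)) n) * cnj (b x) ^ n)
          \<le> cmod (fourier f n) + cmod (fourier (\<lambda>x. cnj (f x)) n)"
        using norm_triangle_ineq[of "fourier f n * b x ^ n" "cnj (fourier (\<lambda>x. cnj (f x)) n) * cnj (b x) ^ n"]
        by (simp add: norm_mult norm_power)
      moreover have "r ^ n * cmod (fourier f n * b x ^ n + cnj (fourier (\<lambda>x. cnj (f x)) n) * cnj (b x) ^ n)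
          \<le> 1 * cmod (fourier f n * b x ^ n + cnj (fourier (\<lambda>x. cnj (f x)) n) * cnj (b x) ^ n)"
        using r by (intro mult_right_mono) (auto simp: power_le_one)
      ultimately show "cmod (of_real (r ^ n) * (fourier f n * b x ^ n + cnj (fourier (\<lambda>x. cnj (f x)) n) * cnj (b x) ^ n))
          \<le> cmod (fourier f n) + cmod (fourier (\<lambda>x. cnj (f x)) n)"
        using r by (simp add: norm_mult norm_power)
    qed
    moreover have "cmod (poisson_ext f r (b x) - trunc f r K (b x)) \<le> ?E"
      using r by (intro ext_trunc bf f) auto
    moreover have "cmod (f x) \<le> cmod (f x - poisson_ext f r (b x)) + cmod (poisson_ext f r (b x) - trunc f r K (b x)) + cmod (trunc f r K (b x))"
      using norm_triangle_ineq[of "f x - poisson_ext f r (b x)" "poisson_ext f r (b x)"]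
        norm_triangle_ineq[of "poisson_ext f r (b x) - trunc f r K (b x)" "trunc f r K (b x)"] by simp
    ultimately show ?thesis by linarith
  qed
  then have "(\<integral>x. cmod (f x) \<partial>M) \<le> (\<integral>x. cmod (f x - poisson_ext f r (b x)) + (?T + ?E) \<partial>M)"
    using L1_diff_ext_le(2)[OF f(1) r s] bounded_map_integrable[OF bf] by (intro integral_mono) auto
  also have "\<dots> = (\<integral>x. cmod (f x - poisson_ext f r (b x)) \<partial>M) + (?T + ?E)"
    using L1_diff_ext_le(2)[OF f(1) r s] by (simp add: prob_space)
  also have "\<dots> \<le> s / 2 + (1 - r\<^sup>2) / (2 * r * s) * dirichlet f + (?T + ?E)"
    using L1_diff_ext_le(1)[OF f(1) r s] by simp
  finally show ?thesis by simp
qed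

text \<open>By \<open>L1_norm_le\<close>, bounded energy makes the \<open>L\<^sup>1\<close> distance depend on finitely many Fourier coefficients up to a small error.\<close>

lemma circle_maps_L1_Cauchy:
  assumes u: "\<And>k. circle_map (u k)" and E: "\<And>k. dirichlet (u k) \<le> E"
    and conv: "\<And>n. convergent (\<lambda>k. fourier (u k) n)" "\<And>n. convergent (\<lambda>k. fourier (\<lambda>x. cnj (u k x)) n)"
    and e: "e > 0"
  shows "\<exists>K. \<forall>i\<ge>K. \<forall>j\<ge>K. (\<integral>x. cmod (u i x - u j x) \<partial>M) < e"
proof -
  have E0: "0 \<le> E" using order_trans[OF dirichlet_nonneg E] .
  define s where "s = e / 2"
  have s: "s > 0" using e by (simp add: s_def)
  have "(\<lambda>k. (1 - (rad k)\<^sup>2) / (2 * rad k * s) * (4 * E)) \<longlonglongrightarrow> (1 - 1\<^sup>2) / (2 * 1 * s) * (4 * E)"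
    using s by (intro tendsto_intros rad) auto
  then have "\<forall>\<^sub>F k in sequentially. (1 - (rad k)\<^sup>2) / (2 * rad k * s) * (4 * E) < e / 4"
    using e by (intro order_tendstoD(2)) auto
  then have "\<forall>\<^sub>F k in sequentially. (1 - (rad k)\<^sup>2) / (2 * rad k * s) * (4 * E) < e / 4 \<and> 0 < k"
    using eventually_gt_at_top[of 0] by eventually_elim auto
  then obtain k where k: "(1 - (rad k)\<^sup>2) / (2 * rad k * s) * (4 * E) < e / 4" "0 < k"
    by (auto simp: eventually_sequentially)
  define r where "r = rad k"
  have r: "0 < r" "r < 1" using k(2) by (simp_all add: r_def rad_def)
  have "(\<lambda>K. 2 * (2 * r ^ Suc K / (1 - r))) \<longlonglongrightarrow> 2 * (2 * 0 / (1 - r))"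
    using r LIMSEQ_Suc[OF LIMSEQ_realpow_zero[of r]] by (intro tendsto_intros) auto
  then have "\<forall>\<^sub>F K in sequentially. 2 * (2 * r ^ Suc K / (1 - r)) < e / 8"
    using e by (intro order_tendstoD(2)) auto
  then obtain L where L: "2 * (2 * r ^ Suc L / (1 - r)) < e / 8"
    by (auto simp: eventually_sequentially)
  \<comment> \<open>at most \<open>2 (L + 1)\<close> coefficients enter, and together they may contribute \<open>e / 8\<close>\<close>
  define d where "d = e / (16 * (real L + 1))"
  have d: "d > 0" using e by (simp add: d_def)
  have cau: "\<exists>K. \<forall>i\<ge>K. \<forall>j\<ge>K. \<forall>n\<le>L. cmod (fourier (v i) n - fourier (v j) n) < d"
    if c: "\<And>n. convergent (\<lambda>k. fourier (v k) n)" for v :: "nat \<Rightarrow> 'a \<Rightarrow> complex"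
  proof -
    have "\<exists>K. \<forall>i\<ge>K. \<forall>j\<ge>K. cmod (fourier (v i) n - fourier (v j) n) < d" for n
      using convergent_Cauchy[OF c[of n]] d unfolding Cauchy_def dist_norm by blast
    then obtain K where K: "\<And>n i j. i \<ge> K n \<Longrightarrow> j \<ge> K n \<Longrightarrow> cmod (fourier (v i) n - fourier (v j) n) < d"
      by metis
    show ?thesis
    proof (intro exI allI impI)
      fix i j n assume ij: "Max (K ` {..L}) \<le> i" "Max (K ` {..L}) \<le> j" and "n \<le> L"
      then have "K n \<le> Max (K ` {..L})" by (intro Max_ge) auto
      then show "cmod (fourier (v i) n - fourier (v j) n) < d" using ij by (intro K) linarith+
    qed
  qed
  obtain K1 where K1: "\<And>i j n. i \<ge> K1 \<Longrightarrow> j \<ge> K1 \<Longrightarrow> n \<le> L \<Longrightarrow> cmod (fourier (u i) n - fourier (u j) n) < d"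
    using cau[of u, OF conv(1)] by blast
  obtain K2 where K2: "\<And>i j n. i \<ge> K2 \<Longrightarrow> j \<ge> K2 \<Longrightarrow> n \<le> L \<Longrightarrow>
      cmod (fourier (\<lambda>x. cnj (u i x)) n - fourier (\<lambda>x. cnj (u j x)) n) < d"
    using cau[of "\<lambda>k x. cnj (u k x)", OF conv(2)] by blast
  show ?thesis
  proof (intro exI allI impI)
    fix i j assume ij: "max K1 K2 \<le> i" "max K1 K2 \<le> j"
    let ?f = "\<lambda>x. u i x - u j x"
    have f: "finite_dirichlet ?f" "dirichlet ?f \<le> 4 * E"
      using finite_dirichlet_diff[OF circle_mapD(1)[OF u] circle_mapD(1)[OF u], of i j] E[of i] E[of j] by auto
    have f2: "cmod (?f x) \<le> 2" for x
      using norm_triangle_ineq4[of "u i x" "u j x"] circle_mapD(5)[OF u] by simp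
    have ff: "cmod (fourier ?f n) < d" "cmod (fourier (\<lambda>x. cnj (?f x)) n) < d" if "n \<le> L" for n
    proof -
      show "cmod (fourier ?f n) < d"
        using K1[of i j n] ij that by (simp add: fourier_diff circle_mapD(2)[OF u])
      show "cmod (fourier (\<lambda>x. cnj (?f x)) n) < d"
        using K2[of i j n] ij that by (simp add: fourier_diff bounded_map_cnj circle_mapD(2)[OF u])
    qed
    have "(\<Sum>n=1..L. cmod (fourier ?f n) + cmod (fourier (\<lambda>x. cnj (?f x)) n)) \<le> (\<Sum>n=1..L. d + d)"
      by (intro sum_mono add_mono less_imp_le[OF ff(1)] less_imp_le[OF ff(2)]) auto
    then have T: "cmod (fourier ?f 0) + (\<Sum>n=1..L. cmod (fourier ?f n) + cmod (fourier (\<lambda>x. cnj (?f x)) n))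
       \<le> 2 * (real L + 1) * d"
      using ff(1)[of 0] d by (simp add: algebra_simps)
    also have "\<dots> = e / 8" by (simp add: d_def field_simps)
    finally have T: "cmod (fourier ?f 0) + (\<Sum>n=1..L. cmod (fourier ?f n) + cmod (fourier (\<lambda>x. cnj (?f x)) n)) \<le> e / 8" .
    have "(1 - r\<^sup>2) / (2 * r * s) * dirichlet ?f \<le> (1 - r\<^sup>2) / (2 * r * s) * (4 * E)"
      using r s by (intro mult_left_mono f(2) divide_nonneg_nonneg) (auto simp: power_le_one)
    then have 2: "(1 - r\<^sup>2) / (2 * r * s) * dirichlet ?f < e / 4"
      using k(1) unfolding r_def by (rule le_less_trans)
    show "(\<integral>x. cmod (u i x - u j x) \<partial>M) < e"
      using L1_norm_le[OF f(1) f2 r s, of L] T 2 L e unfolding s_def by linarith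
  qed
qed

lemma AE_pair_fst_snd:
  assumes "AE x in M. Q x"
  shows "AE p in N. Q (fst p) \<and> Q (snd p)"
proof -
  obtain Z where Z: "{x \<in> space M. \<not> Q x} \<subseteq> Z" "emeasure M Z = 0" "Z \<in> sets M"
    using AE_E[OF assms] by blast
  have ae: "AE x in M. x \<notin> Z" using Z by (intro AE_not_in) (auto simp: null_sets_def)
  have [measurable]: "Z \<in> sets M" by (rule Z(3))
  have "AE p in N. fst p \<notin> Z \<and> snd p \<notin> Z"
  proof (rule P.AE_pair_measure)
    show "{p \<in> space N. fst p \<notin> Z \<and> snd p \<notin> Z} \<in> sets N" by measurable
    show "AE x in M. AE y in M. fst (x, y) \<notin> Z \<and> snd (x, y) \<notin> Z"
      using ae by eventually_elim (use ae in simp)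
  qed
  then show ?thesis
    using AE_space by eventually_elim (use Z(1) in \<open>auto simp: space_pair_measure\<close>)
qed

lemma fourier_tendsto:
  assumes u: "\<And>k. circle_map (u k)" and v: "circle_map v" and lim: "AE x in M. (\<lambda>k. u k x) \<longlonglongrightarrow> v x"
  shows "(\<lambda>k. fourier (u k) n) \<longlonglongrightarrow> fourier v n"
  unfolding fourier_def
proof (rule integral_dominated_convergence[where w = "\<lambda>_. 1"])
  note [measurable] = circle_mapD(3)[OF u] circle_mapD(3)[OF v]
  show "(\<lambda>x. v x * cnj (b x) ^ n) \<in> borel_measurable M" "(\<lambda>x. u k x * cnj (b x) ^ n) \<in> borel_measurable M" for k
    by measurable
  show "AE x in M. (\<lambda>k. u k x * cnj (b x) ^ n) \<longlonglongrightarrow> v x * cnj (b x) ^ n"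
    using lim by eventually_elim (intro tendsto_intros)
  show "AE x in M. norm (u k x * cnj (b x) ^ n) \<le> 1" for k
    by (intro always_eventually allI) (simp add: norm_mult norm_power circle_mapD(5)[OF u])
qed simp

text \<open>Rellich's theorem, with almost everywhere convergence of a further subsequence. The limit has finite energy by Fatou's lemma.\<close>

lemma circle_maps_compact:
  fixes u :: "nat \<Rightarrow> 'a \<Rightarrow> complex"
  assumes u: "\<And>k. circle_map (u k)" and E: "\<And>k. dirichlet (u k) \<le> E"
  obtains s v where "strict_mono s" "circle_map v" "AE x in M. (\<lambda>k. u (s k) x) \<longlonglongrightarrow> v x"
proof -
  have b1: "cmod (fourier (u k) n) \<le> 1" "cmod (fourier (\<lambda>x. cnj (u k x)) n) \<le> 1" for k n
    by (intro norm_fourier_le bounded_map_cnj circle_mapD(2)[OF u]; simp add: circle_mapD(5)[OF u])+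
  obtain s1 where s1: "strict_mono s1" "\<And>n. convergent (\<lambda>k. fourier (u (s1 k)) n)"
    using bounded_family_convergent_subsequence[of "\<lambda>k. fourier (u k)" 1] b1(1) by auto
  obtain s2 where s2: "strict_mono s2" "\<And>n. convergent (\<lambda>k. fourier (\<lambda>x. cnj (u (s1 (s2 k)) x)) n)"
    using bounded_family_convergent_subsequence[of "\<lambda>k. fourier (\<lambda>x. cnj (u (s1 k) x))" 1] b1(2) by auto
  define w where "w k = u (s1 (s2 k))" for k
  have w: "circle_map (w k)" "dirichlet (w k) \<le> E" for k using u E by (simp_all add: w_def)
  have c1: "convergent (\<lambda>k. fourier (w k) n)" for n
    using convergent_subseq_convergent[OF s1(2)[of n] s2(1)] by (simp add: w_def o_def)
  have c2: "convergent (\<lambda>k. fourier (\<lambda>x. cnj (w k x)) n)" for n using s2(2)[of n] by (simp add: w_def)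
  obtain s3 where s3: "strict_mono s3" "AE x in M. Cauchy (\<lambda>i. w (s3 i) x)"
    using cauchy_L1_AE_cauchy_subseq[of M w, OF bounded_map_integrable[OF circle_mapD(2)[OF w(1)]]]
      circle_maps_L1_Cauchy[OF w c1 c2] by blast
  note [measurable] = circle_mapD(3)[OF w(1)]
  define l where "l x = lim (\<lambda>i. w (s3 i) x)" for x
  have [measurable]: "l \<in> borel_measurable M" unfolding l_def[abs_def] by measurable
  \<comment> \<open>a representative that is unimodular at every point\<close>
  define v where "v x = (if cmod (l x) = 1 then l x else 1)" for x
  have [measurable]: "v \<in> borel_measurable M" unfolding v_def[abs_def] by measurable
  have v1: "cmod (v x) = 1" for x by (simp add: v_def)
  have conv: "AE x in M. (\<lambda>i. w (s3 i) x) \<longlonglongrightarrow> v x"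
    using s3(2)
  proof eventually_elim
    case (elim x)
    then have l: "(\<lambda>i. w (s3 i) x) \<longlonglongrightarrow> l x"
      unfolding l_def using Cauchy_convergent convergent_LIMSEQ_iff by blast
    then have "(\<lambda>i. cmod (w (s3 i) x)) \<longlonglongrightarrow> cmod (l x)" by (rule tendsto_norm)
    then have "(\<lambda>i. 1::real) \<longlonglongrightarrow> cmod (l x)" by (simp add: circle_mapD(5)[OF w(1)])
    then have "cmod (l x) = 1" by (simp add: LIMSEQ_const_iff)
    then show ?case using l by (simp add: v_def)
  qed
  have "(\<integral>\<^sup>+p. ennreal (quot v p) \<partial>N) \<le> (\<integral>\<^sup>+p. liminf (\<lambda>k. ennreal (quot (w (s3 k)) p)) \<partial>N)"
  proof (rule nn_integral_mono_AE)
    show "AE p in N. ennreal (quot v p) \<le> liminf (\<lambda>k. ennreal (quot (w (s3 k)) p))"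
      using AE_pair_fst_snd[OF conv]
    proof eventually_elim
      case (elim p)
      show ?case
      proof (cases "fst p = snd p")
        case True then show ?thesis by (simp add: quot_def)
      next
        case False
        then have "b (fst p) \<noteq> b (snd p)" using inj_b by blast
        then have "(\<lambda>k. quot (w (s3 k)) p) \<longlonglongrightarrow> quot v p"
          unfolding quot_def using elim by (intro tendsto_intros) auto
        then have "(\<lambda>k. ennreal (quot (w (s3 k)) p)) \<longlonglongrightarrow> ennreal (quot v p)" by (rule tendsto_ennrealI)
        then show ?thesis by (simp add: lim_imp_Liminf)
      qed
    qed
  qed
  also have "\<dots> \<le> liminf (\<lambda>k. \<integral>\<^sup>+p. ennreal (quot (w (s3 k)) p) \<partial>N)"
    by (rule nn_integral_liminf) measurable
  also have "\<dots> \<le> liminf (\<lambda>k. ennreal E)"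
  proof (intro Liminf_mono always_eventually allI)
    fix k
    have "(\<integral>\<^sup>+p. ennreal (quot (w (s3 k)) p) \<partial>N) = ennreal (dirichlet (w (s3 k)))"
      unfolding dirichlet_def by (rule nn_integral_eq_integral) (auto simp: circle_mapD(4)[OF w(1)] quot_nonneg)
    then show "(\<integral>\<^sup>+p. ennreal (quot (w (s3 k)) p) \<partial>N) \<le> ennreal E" using w(2)[of "s3 k"] by (simp add: ennreal_leI)
  qed
  also have "\<dots> < \<infinity>" by (simp add: Liminf_const)
  finally have "integrable N (quot v)"
    by (intro integrableI_nonneg) (auto simp: quot_nonneg)
  then have "circle_map v" using v1 bounded_mapI[of v 1] by (simp add: circle_map_def finite_dirichlet_def)
  moreover have "strict_mono (\<lambda>k. s1 (s2 (s3 k)))"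
    using s1(1) s2(1) s3(1) by (auto simp: strict_mono_def)
  moreover have "AE x in M. (\<lambda>k. u (s1 (s2 (s3 k))) x) \<longlonglongrightarrow> v x" using conv by (simp add: w_def)
  ultimately show thesis using that by blast
qed

section \<open>Minimizing in a degree class\<close>

text \<open>Along a minimizing sequence of degree \<open>d\<close> both \<open>hardy\<close> energies, which are \<open>(dirichlet \<plusminus> deg)/2\<close>, pass
  to the limit lower semicontinuously, so the limit satisfies \<open>dirichlet u + \<bar>deg u - d\<bar> \<le> inf\<close>. A jump of the
  degree costs at least one unit of energy by integrality, more than the competitor allows.\<close>

lemma minimizer_in_degree_class:
  assumes u0: "\<And>w. circle_map w \<Longrightarrow> (AE x in M. x \<in> A \<longrightarrow> w x = g x) \<Longrightarrow> m0 \<le> dirichlet w"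
    and v: "circle_map v" "AE x in M. x \<in> A \<longrightarrow> v x = g x" "dirichlet v < m0 + 1"
  obtains u where "circle_map u" "AE x in M. x \<in> A \<longrightarrow> u x = g x" "deg u = deg v"
    "\<And>w. circle_map w \<Longrightarrow> (AE x in M. x \<in> A \<longrightarrow> w x = g x) \<Longrightarrow> deg w = deg v \<Longrightarrow> dirichlet u \<le> dirichlet w"
proof -
  define S where "S = {w. circle_map w \<and> (AE x in M. x \<in> A \<longrightarrow> w x = g x) \<and> deg w = deg v}"
  define m where "m = Inf (dirichlet ` S)"
  have vS: "v \<in> S" using v by (simp add: S_def)
  have bdd: "bdd_below (dirichlet ` S)" using dirichlet_nonneg by (intro bdd_belowI[of _ 0]) auto
  have mS: "m \<le> dirichlet w" if "w \<in> S" for w unfolding m_def using that bdd by (intro cInf_lower) auto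
  have "\<exists>w\<in>S. dirichlet w < m + 1 / real (Suc k)" for k
    using cInf_lessD[of "dirichlet ` S" "m + 1 / real (Suc k)"] vS by (auto simp: m_def)
  then obtain w where w: "\<And>k. w k \<in> S" "\<And>k. dirichlet (w k) < m + 1 / real (Suc k)" by metis
  have wc: "circle_map (w k)" "AE x in M. x \<in> A \<longrightarrow> w k x = g x" "deg (w k) = deg v" for k
    using w(1)[of k] by (auto simp: S_def)
  have "dirichlet (w k) \<le> m + 1" for k
    using w(2)[of k] by (rule order_trans[OF less_imp_le]) simp
  then obtain s u where s: "strict_mono s" and u: "circle_map u" and lim: "AE x in M. (\<lambda>k. w (s k) x) \<longlonglongrightarrow> u x"
    using circle_maps_compact[of w "m + 1"] wc(1) by blast
  have "AE x in M. \<forall>k. x \<in> A \<longrightarrow> w (s k) x = g x" unfolding AE_all_countable using wc(2) by blast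
  then have ug: "AE x in M. x \<in> A \<longrightarrow> u x = g x"
    using lim
  proof eventually_elim
    case (elim x)
    show ?case
    proof
      assume "x \<in> A"
      then have "(\<lambda>k. g x) \<longlonglongrightarrow> u x" using elim by simp
      then show "u x = g x" by (simp add: LIMSEQ_const_iff)
    qed
  qed
  have lim': "AE x in M. (\<lambda>k. cnj (w (s k) x)) \<longlonglongrightarrow> cnj (u x)"
    using lim by eventually_elim (intro tendsto_intros)
  have semi: "hardy u + hardy u \<le> m + deg v" "hardy (\<lambda>x. cnj (u x)) + hardy (\<lambda>x. cnj (u x)) \<le> m - deg v"
  proof -
    have d: "hardy (w k) + hardy (w k) \<le> m + deg v + 1 / real (Suc k)"
      "hardy (\<lambda>x. cnj (w k x)) + hardy (\<lambda>x. cnj (w k x)) \<le> m - deg v + 1 / real (Suc k)" for k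
      using hardy_sum(3)[OF circle_mapD(1)[OF wc(1)], of k] wc(3)[of k] w(2)[of k] unfolding deg_def by linarith+
    have le: "hardy f + hardy f \<le> c" if f: "circle_map f" and h: "\<And>k. circle_map (h k)"
      "AE x in M. (\<lambda>k. h k x) \<longlonglongrightarrow> f x" "\<And>k. hardy (h k) + hardy (h k) \<le> c + 1 / real (Suc k)" for f h c
    proof (rule field_le_epsilon)
      fix e :: real assume e: "e > 0"
      have "\<forall>\<^sub>F k in sequentially. hardy f - e / 4 < hardy (h k)"
        by (rule hardy_lower_semicontinuous[OF circle_mapD(1)[OF f] circle_mapD(1)[OF h(1)] fourier_tendsto[OF h(1) f h(2)]])
           (use e in simp)
      moreover have "\<forall>\<^sub>F k in sequentially. 1 / real (Suc k) < e / 2"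
        using order_tendstoD(2)[OF LIMSEQ_inverse_real_of_nat, of "e / 2"] e by (simp add: inverse_eq_divide)
      ultimately have "\<forall>\<^sub>F k in sequentially. hardy f + hardy f \<le> c + e"
      proof eventually_elim
        case (elim k) then show ?case using h(3)[of k] by linarith
      qed
      then show "hardy f + hardy f \<le> c + e" by simp
    qed
    have sk: "1 / real (Suc (s k)) \<le> 1 / real (Suc k)" for k
      using seq_suble[OF s, of k] by (intro divide_left_mono) auto
    show "hardy u + hardy u \<le> m + deg v"
      by (rule le[OF u wc(1) lim]) (rule order_trans[OF d(1)], use sk in simp)
    show "hardy (\<lambda>x. cnj (u x)) + hardy (\<lambda>x. cnj (u x)) \<le> m - deg v"
      by (rule le[OF circle_map_cnj[OF u] circle_map_cnj[OF wc(1)] lim']) (rule order_trans[OF d(2)], use sk in simp)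
  qed
  have sum: "dirichlet u + deg u \<le> m + deg v" "dirichlet u - deg u \<le> m - deg v"
    using semi hardy_sum(3)[OF circle_mapD(1)[OF u]] by (simp_all add: deg_def)
  have "deg u = deg v"
  proof (rule ccontr)
    assume ne: "deg u \<noteq> deg v"
    obtain i j where ij: "deg u = of_int i" "deg v = of_int j"
      using deg_Ints[OF u] deg_Ints[OF v(1)] by (auto elim!: Ints_cases)
    then have "\<bar>i - j\<bar> \<ge> 1" using ne by auto
    then have "\<bar>deg u - deg v\<bar> \<ge> 1" unfolding ij by linarith
    then have "dirichlet u + 1 \<le> m" using sum by linarith
    then show False using mS[OF vS] v(3) u0[OF u ug] by linarith
  qed
  moreover have "dirichlet u \<le> dirichlet w" if "circle_map w" "AE x in M. x \<in> A \<longrightarrow> w x = g x" "deg w = deg v" for w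
    using mS[of w] that sum calculation by (simp add: S_def)
  ultimately show thesis using that u ug by blast
qed

end

text \<open>At a minimum the increment is nonnegative for both signs of \<open>t\<close>, so the bound \<open>t L + K t\<^sup>2\<close> forces \<open>L = 0\<close>, and the
  difference quotient is \<open>O(t)\<close>.\<close>

lemma derivative_zero_at_minimum:
  fixes f :: "real \<Rightarrow> real"
  assumes d: "\<delta> > 0" and lo: "\<And>t. \<bar>t\<bar> \<le> \<delta> \<Longrightarrow> f 0 \<le> f t"
    and up: "\<And>t. \<bar>t\<bar> \<le> \<delta> \<Longrightarrow> f t \<le> f 0 + t * L + K * t\<^sup>2"
  shows "(f has_real_derivative 0) (at 0)"
proof -
  have nn: "0 \<le> t * (L + K * t)" if "\<bar>t\<bar> \<le> \<delta>" for t
    using lo[OF that] up[OF that] by (simp add: power2_eq_square algebra_simps)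
  have lim: "((\<lambda>t. L + K * t) \<longlongrightarrow> L + K * 0) (at 0 within S)" for S by (intro tendsto_intros)
  have "\<forall>\<^sub>F t in at_right 0. 0 \<le> L + K * t"
  proof -
    have "\<forall>\<^sub>F t in at_right (0::real). t \<in> {0<..<\<delta>}" using d by (rule eventually_at_right_real)
    then show ?thesis
    proof eventually_elim
      case (elim t) then show ?case using nn[of t] by (simp add: zero_le_mult_iff)
    qed
  qed
  then have "0 \<le> L + K * 0" by (rule tendsto_lowerbound[OF lim]) simp
  moreover have "\<forall>\<^sub>F t in at_left 0. L + K * t \<le> 0"
  proof -
    have "\<forall>\<^sub>F t in at_left (0::real). t \<in> {- \<delta><..<0}" using d by (intro eventually_at_left_real) simp
    then show ?thesis
    proof eventually_elim
      case (elim t) then show ?case using nn[of t] by (simp add: zero_le_mult_iff)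
    qed
  qed
  then have "L + K * 0 \<le> 0" by (rule tendsto_upperbound[OF lim]) simp
  ultimately have L: "L = 0" by simp
  have "((\<lambda>h. (f (0 + h) - f 0) / h) \<longlongrightarrow> 0) (at 0)"
  proof (rule Lim_null_comparison)
    show "\<forall>\<^sub>F h in at 0. norm ((f (0 + h) - f 0) / h) \<le> \<bar>K\<bar> * \<bar>h\<bar>"
    proof -
      have "\<forall>\<^sub>F h in at 0. h \<noteq> 0 \<and> \<bar>h\<bar> < \<delta>"
        unfolding eventually_at using d by (intro exI[of _ \<delta>]) (auto simp: dist_real_def)
      then show ?thesis
      proof eventually_elim
        case (elim h)
        have "\<bar>f h - f 0\<bar> \<le> \<bar>K\<bar> * h\<^sup>2"
        proof -
          have "\<bar>h\<bar> \<le> \<delta>" using elim by simp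
          then have "f 0 \<le> f h" "f h \<le> f 0 + K * h\<^sup>2" using lo[of h] up[of h] L by simp_all
          moreover have "K * h\<^sup>2 \<le> \<bar>K\<bar> * h\<^sup>2" by (intro mult_right_mono) auto
          ultimately show ?thesis by linarith
        qed
        then have "\<bar>f h - f 0\<bar> / \<bar>h\<bar> \<le> \<bar>K\<bar> * h\<^sup>2 / \<bar>h\<bar>" by (rule divide_right_mono) simp
        also have "\<dots> = \<bar>K\<bar> * \<bar>h\<bar>" proof -
          have "h\<^sup>2 = \<bar>h\<bar> * \<bar>h\<bar>" by (simp add: power2_eq_square)
          then show ?thesis unfolding mult.assoc[symmetric]
            by (simp only: mult.assoc[symmetric]) (rule nonzero_mult_div_cancel_right, use elim in simp)
        qed
        finally show ?case by simp
      qed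
    qed
    have "((\<lambda>h::real. \<bar>K\<bar> * \<bar>h\<bar>) \<longlongrightarrow> \<bar>K\<bar> * \<bar>0\<bar>) (at 0)" by (intro tendsto_intros)
    then show "((\<lambda>h::real. \<bar>K\<bar> * \<bar>h\<bar>) \<longlongrightarrow> 0) (at 0)" by simp
  qed
  then show ?thesis unfolding DERIV_def .
qed

text \<open>The expansion of \<open>1 / \<bar>u + t f\<bar>\<close> uses \<open>\<bar>u + t f\<bar> \<ge> 1 + t Re (f cnj u)\<close>, which is affine in \<open>t\<close>.\<close>

lemma projected_variation_le:
  fixes u v f g :: complex and t C :: real
  assumes u: "cmod u = 1" "cmod v = 1" and f: "cmod f \<le> C" "cmod g \<le> C" and t: "\<bar>t\<bar> * C \<le> 1 / 2"
  shows "(cmod (sgn (u + t * f) - sgn (v + t * g)))\<^sup>2 \<le> (cmod (u - v))\<^sup>2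
    + t * (2 * Re ((u - v) * cnj (f - g)) - (Re (f * cnj u) + Re (g * cnj v)) * (cmod (u - v))\<^sup>2)
    + t\<^sup>2 * ((16 * C\<^sup>2 + 2 * C) * (cmod (u - v))\<^sup>2 + (6 + 2 * C) * (cmod (f - g))\<^sup>2)"
proof -
  have C0: "0 \<le> C" using f(1) norm_ge_zero order_trans by blast
  define s where "s = \<bar>t\<bar>"
  have s0: "0 \<le> s" and ts: "t\<^sup>2 = s\<^sup>2" and sC: "s * C \<le> 1 / 2" using t by (simp_all add: s_def)
  have one: "1 / 2 \<le> cmod (u + t * f)"
    "1 / cmod (u + t * f) \<le> 1 - t * Re (f * cnj u) + 2 * C\<^sup>2 * t\<^sup>2"
    "\<bar>Re (f * cnj u)\<bar> \<le> C"
    if u: "cmod u = 1" and f: "cmod f \<le> C" for u f :: complex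
  proof -
    define \<psi> where "\<psi> = Re (f * cnj u)"
    have p: "\<bar>\<psi>\<bar> \<le> C" using abs_Re_le_cmod[of "f * cnj u"] u f by (simp add: \<psi>_def norm_mult del: times_complex.sel)
    then show "\<bar>Re (f * cnj u)\<bar> \<le> C" by (simp add: \<psi>_def)
    have "\<bar>t * \<psi>\<bar> \<le> \<bar>t\<bar> * C" unfolding abs_mult by (intro mult_left_mono p) simp
    then have tp: "\<bar>t * \<psi>\<bar> \<le> 1 / 2" using t by linarith
    have "u * cnj u = 1" using u by (metis complex_norm_square of_real_1 power_one)
    then have "(u + t * f) * cnj u = 1 + t * (f * cnj u)" by (simp add: algebra_simps)
    then have "1 + t * \<psi> = Re ((u + t * f) * cnj u)" by (simp add: \<psi>_def)
    also have "\<dots> \<le> cmod (u + t * f)" using complex_Re_le_cmod[of "(u + t * f) * cnj u"] u by (simp add: norm_mult del: times_complex.sel)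
    finally have lo: "1 + t * \<psi> \<le> cmod (u + t * f)" .
    then show "1 / 2 \<le> cmod (u + t * f)" using tp by linarith
    have pos: "1 / 2 \<le> 1 + t * \<psi>" using tp by linarith
    have "1 / cmod (u + t * f) \<le> 1 / (1 + t * \<psi>)"
      using lo pos by (intro divide_left_mono mult_pos_pos) auto
    also have "\<dots> = 1 - t * \<psi> + (t * \<psi>)\<^sup>2 / (1 + t * \<psi>)" using pos by (simp add: power2_eq_square field_simps)
    also have "(t * \<psi>)\<^sup>2 / (1 + t * \<psi>) \<le> (t * \<psi>)\<^sup>2 / (1 / 2)"
      using pos by (intro divide_left_mono mult_pos_pos) auto
    also have "\<dots> = 2 * (\<psi>\<^sup>2 * t\<^sup>2)" by (simp add: power_mult_distrib mult.commute)
    also have "\<dots> \<le> 2 * (C\<^sup>2 * t\<^sup>2)"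
      using power_mono[OF p, of 2] by (intro mult_left_mono mult_right_mono) auto
    finally show "1 / cmod (u + t * f) \<le> 1 - t * Re (f * cnj u) + 2 * C\<^sup>2 * t\<^sup>2" by (simp add: \<psi>_def)
  qed
  define a where "a = Re (f * cnj u)"
  define c where "c = Re (g * cnj v)"
  define U where "U = (cmod (u - v))\<^sup>2"
  define V where "V = (cmod (f - g))\<^sup>2"
  define X where "X = Re ((u - v) * cnj (f - g))"
  define W where "W = (cmod ((u + t * f) - (v + t * g)))\<^sup>2"
  have ac: "\<bar>a\<bar> \<le> C" "\<bar>c\<bar> \<le> C" using one(3)[OF u(1) f(1)] one(3)[OF u(2) f(2)] by (simp_all add: a_def c_def)
  have UV: "0 \<le> U" "0 \<le> V" "0 \<le> W" by (simp_all add: U_def V_def W_def)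
  have W: "W = U + 2 * t * X + t\<^sup>2 * V"
    unfolding W_def U_def V_def X_def cmod_power2 by (simp add: power2_eq_square algebra_simps)
  have X: "2 * \<bar>X\<bar> \<le> U + V"
  proof -
    have "\<bar>X\<bar> \<le> cmod (u - v) * cmod (f - g)"
      unfolding X_def by (metis abs_Re_le_cmod complex_mod_cnj norm_mult)
    then show ?thesis using zero_le_power2[of "cmod (u - v) - cmod (f - g)"]
      unfolding U_def V_def by (simp add: power2_diff)
  qed
  have "(cmod (sgn (u + t * f) - sgn (v + t * g)))\<^sup>2 \<le> W / (cmod (u + t * f) * cmod (v + t * g))"
    unfolding W_def using one(1)[OF u(1) f(1)] one(1)[OF u(2) f(2)] by (intro sgn_diff_sq_le) auto
  also have "\<dots> = W * ((1 / cmod (u + t * f)) * (1 / cmod (v + t * g)))" by simp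
  also have "\<dots> \<le> W * ((1 - t * a + 2 * C\<^sup>2 * t\<^sup>2) * (1 - t * c + 2 * C\<^sup>2 * t\<^sup>2))"
  proof (intro mult_left_mono mult_mono)
    show "1 / cmod (u + t * f) \<le> 1 - t * a + 2 * C\<^sup>2 * t\<^sup>2" unfolding a_def by (rule one(2)[OF u(1) f(1)])
    then show "0 \<le> 1 - t * a + 2 * C\<^sup>2 * t\<^sup>2" by (rule order_trans[rotated]) simp
    show "1 / cmod (v + t * g) \<le> 1 - t * c + 2 * C\<^sup>2 * t\<^sup>2" unfolding c_def by (rule one(2)[OF u(2) f(2)])
  qed (use UV in auto)
  also have "\<dots> \<le> W * (1 - t * (a + c) + 8 * (C\<^sup>2 * t\<^sup>2))"
  proof (intro mult_left_mono UV)
    \<comment> \<open>bounds \<open>t a\<close> and \<open>t c\<close>; as \<open>q \<le> 1 / 2\<close>, the cubic and quartic terms are absorbed by \<open>q\<^sup>2\<close>\<close>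
    define q where "q = s * C"
    have q: "0 \<le> q" "q \<le> 1 / 2" using s0 C0 sC by (simp_all add: q_def)
    have qq: "C\<^sup>2 * t\<^sup>2 = q\<^sup>2" by (simp add: q_def ts power_mult_distrib mult.commute)
    have ta: "\<bar>t * a\<bar> \<le> q" "\<bar>t * c\<bar> \<le> q" unfolding abs_mult q_def s_def using ac by (auto intro: mult_left_mono)
    have 1: "(t * a) * (t * c) \<le> q\<^sup>2"
    proof -
      have "\<bar>(t * a) * (t * c)\<bar> \<le> q * q" unfolding abs_mult[of "t * a"] using ta by (intro mult_mono) auto
      then show ?thesis by (simp add: power2_eq_square)
    qed
    have 2: "- (2 * q\<^sup>2 * (t * a + t * c)) \<le> 2 * q\<^sup>2"
    proof -
      have "2 * q\<^sup>2 * (- (t * a + t * c)) \<le> 2 * q\<^sup>2 * 1" using ta q by (intro mult_left_mono) auto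
      then show ?thesis by (simp only: mult_minus_right mult_1_right)
    qed
    have 3: "4 * (q\<^sup>2 * q\<^sup>2) \<le> q\<^sup>2"
    proof -
      have "q\<^sup>2 \<le> (1/2)\<^sup>2" using q by (intro power_mono) auto
      then have "q\<^sup>2 * q\<^sup>2 \<le> q\<^sup>2 * (1/2)\<^sup>2" by (intro mult_left_mono) auto
      then show ?thesis by (simp add: power2_eq_square)
    qed
    have "(1 - t * a + 2 * C\<^sup>2 * t\<^sup>2) * (1 - t * c + 2 * C\<^sup>2 * t\<^sup>2) =
       (1 - t * a + 2 * q\<^sup>2) * (1 - t * c + 2 * q\<^sup>2)" by (simp add: qq[symmetric] mult.assoc)
    also have "\<dots> = 1 - t * (a + c) + 4 * q\<^sup>2 + (t * a) * (t * c) - 2 * q\<^sup>2 * (t * a + t * c) + 4 * (q\<^sup>2 * q\<^sup>2)"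
      by (simp add: algebra_simps)
    also have "\<dots> \<le> 1 - t * (a + c) + 8 * q\<^sup>2" using 1 2 3 by linarith
    finally show "(1 - t * a + 2 * C\<^sup>2 * t\<^sup>2) * (1 - t * c + 2 * C\<^sup>2 * t\<^sup>2) \<le> 1 - t * (a + c) + 8 * (C\<^sup>2 * t\<^sup>2)"
      unfolding qq .
  qed
  also have "\<dots> = U + t * (2 * X - (a + c) * U) + (t\<^sup>2 * V - 2 * t\<^sup>2 * (X * (a + c)) + t\<^sup>2 * (V * (- (t * (a + c))))) + 8 * C\<^sup>2 * t\<^sup>2 * W"
    unfolding W by (simp add: power2_eq_square algebra_simps)
  also have "\<dots> \<le> U + t * (2 * X - (a + c) * U) + (t\<^sup>2 * V + t\<^sup>2 * (2 * C * (U + V)) + t\<^sup>2 * V) + t\<^sup>2 * (16 * C\<^sup>2 * U + 4 * V)"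
  proof -
    have "- (2 * (X * (a + c))) \<le> 2 * C * (U + V)"
    proof -
      have "\<bar>a + c\<bar> \<le> 2 * C" using ac by linarith
      then have "2 * \<bar>X\<bar> * \<bar>a + c\<bar> \<le> (U + V) * (2 * C)" using X UV by (intro mult_mono) auto
      moreover have "- (2 * (X * (a + c))) \<le> 2 * \<bar>X\<bar> * \<bar>a + c\<bar>" by (simp add: abs_mult[symmetric] mult.assoc)
      ultimately show ?thesis by (simp add: mult.commute)
    qed
    then have 1: "t\<^sup>2 * - (2 * (X * (a + c))) \<le> t\<^sup>2 * (2 * C * (U + V))" by (rule mult_left_mono) simp
    have "- (t * (a + c)) \<le> 1"
    proof -
      have "\<bar>t * (a + c)\<bar> \<le> \<bar>t\<bar> * (2 * C)" unfolding abs_mult using ac by (intro mult_left_mono) auto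
      then show ?thesis using t by linarith
    qed
    then have "V * (- (t * (a + c))) \<le> V * 1" using UV by (intro mult_left_mono) auto
    then have 2: "t\<^sup>2 * (V * (- (t * (a + c)))) \<le> t\<^sup>2 * V" by (intro mult_left_mono) auto
    have "\<bar>2 * t * X\<bar> \<le> U + t\<^sup>2 * V"
    proof -
      have "\<bar>X\<bar> \<le> cmod (u - v) * cmod (f - g)"
        unfolding X_def by (metis abs_Re_le_cmod complex_mod_cnj norm_mult)
      then have "\<bar>t\<bar> * \<bar>X\<bar> \<le> \<bar>t\<bar> * (cmod (u - v) * cmod (f - g))" by (intro mult_left_mono) auto
      moreover have "2 * (\<bar>t\<bar> * (cmod (u - v) * cmod (f - g))) \<le> U + t\<^sup>2 * V"
        using zero_le_power2[of "cmod (u - v) - \<bar>t\<bar> * cmod (f - g)"]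
        unfolding U_def V_def by (simp add: power2_diff power_mult_distrib mult_ac)
      ultimately show ?thesis by (simp add: abs_mult)
    qed
    then have "W \<le> 2 * U + 2 * (t\<^sup>2 * V)" unfolding W by linarith
    then have "8 * C\<^sup>2 * t\<^sup>2 * W \<le> 8 * C\<^sup>2 * t\<^sup>2 * (2 * U + 2 * (t\<^sup>2 * V))" by (intro mult_left_mono) auto
    also have "\<dots> = t\<^sup>2 * (16 * C\<^sup>2 * U + 16 * ((C * s)\<^sup>2 * V))" by (simp add: ts power_mult_distrib algebra_simps)
    also have "\<dots> \<le> t\<^sup>2 * (16 * C\<^sup>2 * U + 16 * ((1/2)\<^sup>2 * V))"
      using sC s0 C0 UV by (intro mult_left_mono add_left_mono mult_right_mono power_mono) (auto simp: mult.commute)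
    also have "\<dots> = t\<^sup>2 * (16 * C\<^sup>2 * U + 4 * V)" by (simp add: power2_eq_square)
    finally have 3: "8 * C\<^sup>2 * t\<^sup>2 * W \<le> t\<^sup>2 * (16 * C\<^sup>2 * U + 4 * V)" .
    have e: "- 2 * t\<^sup>2 * (X * (a + c)) = t\<^sup>2 * - (2 * (X * (a + c)))" by simp
    show ?thesis using 1 2 3 e by linarith
  qed
  also have "\<dots> = U + t * (2 * X - (a + c) * U) + t\<^sup>2 * ((16 * C\<^sup>2 + 2 * C) * U + (6 + 2 * C) * V)"
    by (simp add: algebra_simps)
  finally show ?thesis unfolding U_def V_def X_def a_def c_def .
qed

context circle_space
begin

section \<open>Stationarity\<close>

text \<open>The quotient of the perturbed and the original map stays in a half plane, so the degree does not change.\<close>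

lemma projected_variation:
  fixes t :: real and u f :: "'a \<Rightarrow> complex"
  assumes u: "circle_map u" and f: "finite_dirichlet f" "\<And>x. cmod (f x) \<le> C" and t: "\<bar>t\<bar> * C \<le> 1 / 2"
  shows "circle_map (\<lambda>x. sgn (u x + t * f x))" "deg (\<lambda>x. sgn (u x + t * f x)) = deg u"
proof -
  have tf: "cmod (of_real t * f x) \<le> 1 / 2" for x
  proof -
    have "cmod (of_real t * f x) \<le> \<bar>t\<bar> * C" unfolding norm_mult norm_of_real by (intro mult_left_mono f) simp
    then show ?thesis using t by linarith
  qed
  have lo: "1 / 2 \<le> cmod (u x + t * f x)" for x
    using norm_diff_ineq[of "u x" "t * f x"] circle_mapD(5)[OF u, of x] tf[of x] by linarith
  have fd: "finite_dirichlet (\<lambda>x. u x + t * f x)"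
    by (intro finite_dirichlet_add finite_dirichlet_mult finite_dirichlet_const circle_mapD(1)[OF u] f(1))
  show c: "circle_map (\<lambda>x. sgn (u x + t * f x))"
    by (rule circle_map_sgn(1)[OF fd _ lo]) simp
  let ?w = "\<lambda>x. sgn (u x + t * f x) * cnj (u x)"
  have cw: "circle_map ?w" by (rule circle_map_mult[OF c circle_map_cnj[OF u]])
  have uu: "u x * cnj (u x) = 1" for x
    using circle_mapD(5)[OF u, of x] by (metis complex_norm_square of_real_1 power_one)
  have w0: "deg ?w = 0"
  proof (rule deg_half_plane[OF cw, of "1 / 3"])
    fix x
    let ?z = "1 + t * f x * cnj (u x)"
    have "(u x + t * f x) * cnj (u x) = ?z" using uu[of x] by (simp add: algebra_simps)
    moreover have "sgn (cnj (u x)) = cnj (u x)" using circle_mapD(5)[OF u, of x] by (simp add: sgn_eq)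
    ultimately have w: "?w x = sgn ?z" by (metis sgn_mult)
    have n: "cmod (t * f x * cnj (u x)) \<le> 1 / 2" using tf[of x] circle_mapD(5)[OF u, of x] by (simp add: norm_mult)
    have "- (1 / 2) \<le> Re (t * f x * cnj (u x))"
      using abs_Re_le_cmod[of "t * f x * cnj (u x)"] n by linarith
    then have re: "1 / 2 \<le> Re ?z" by simp
    have up: "cmod ?z \<le> 3 / 2" using norm_triangle_ineq[of 1 "t * f x * cnj (u x)"] n by simp
    have "0 < cmod ?z" using re by (metis complex_Re_le_cmod half_gt_zero_iff less_le_trans order.strict_trans1 zero_less_one)
    then have "(1 / 2) / (3 / 2) \<le> Re ?z / cmod ?z" using re up by (intro frac_le) auto
    then show "1 / 3 \<le> Re (?w x)" unfolding w by (simp add: sgn_eq Re_divide_of_real del: times_complex.sel)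
  qed simp
  have "(\<lambda>x. ?w x * u x) = (\<lambda>x. sgn (u x + t * f x))"
    using uu by (auto simp: mult.assoc mult.commute[of "cnj _"])
  then show "deg (\<lambda>x. sgn (u x + t * f x)) = deg u"
    using deg_mult[OF cw u] w0 by simp
qed

lemma dirichlet_projected_variation_le:
  fixes u f :: "'a \<Rightarrow> complex"
  assumes u: "circle_map u" and f: "finite_dirichlet f" "\<And>x. cmod (f x) \<le> C"
  obtains L K where "\<And>t::real. \<bar>t\<bar> * C \<le> 1 / 2 \<Longrightarrow>
    dirichlet (\<lambda>x. sgn (u x + t * f x)) \<le> dirichlet u + t * L + K * t\<^sup>2"
proof -
  note [measurable] = circle_mapD(3)[OF u] bounded_map_measurable[OF finite_dirichlet_bounded[OF f(1)]]
  have iu: "integrable N (quot u)" and if': "integrable N (quot f)"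
    using u f(1) by (auto simp: finite_dirichlet_def circle_mapD)
  have C0: "0 \<le> C" using order_trans[OF norm_ge_zero f(2)] .
  let ?\<Delta> = "\<lambda>u p. u (fst p) - u (snd p)"
  let ?B = "\<lambda>p. (cmod (b (fst p) - b (snd p)))\<^sup>2"
  let ?\<psi> = "\<lambda>x. Re (f x * cnj (u x))"
  define \<Lambda> where "\<Lambda> p = (2 * Re (?\<Delta> u p * cnj (?\<Delta> f p)) - (?\<psi> (fst p) + ?\<psi> (snd p)) * (cmod (?\<Delta> u p))\<^sup>2) / ?B p" for p
  have \<psi>: "\<bar>?\<psi> x\<bar> \<le> C" for x
    using abs_Re_le_cmod[of "f x * cnj (u x)"] f(2)[of x] circle_mapD(5)[OF u, of x] by (simp add: norm_mult del: times_complex.sel)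
  have \<Lambda>_le: "\<bar>\<Lambda> p\<bar> \<le> (1 + 2 * C) * quot u p + quot f p" for p
  proof -
    have "\<bar>Re (?\<Delta> u p * cnj (?\<Delta> f p))\<bar> \<le> cmod (?\<Delta> u p) * cmod (?\<Delta> f p)"
      by (metis abs_Re_le_cmod complex_mod_cnj norm_mult)
    then have 1: "2 * \<bar>Re (?\<Delta> u p * cnj (?\<Delta> f p))\<bar> \<le> (cmod (?\<Delta> u p))\<^sup>2 + (cmod (?\<Delta> f p))\<^sup>2"
      using zero_le_power2[of "cmod (?\<Delta> u p) - cmod (?\<Delta> f p)"] by (simp add: power2_diff del: times_complex.sel)
    have "\<bar>?\<psi> (fst p) + ?\<psi> (snd p)\<bar> \<le> 2 * C" using \<psi>[of "fst p"] \<psi>[of "snd p"] by linarith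
    then have 2: "\<bar>(?\<psi> (fst p) + ?\<psi> (snd p)) * (cmod (?\<Delta> u p))\<^sup>2\<bar> \<le> 2 * C * (cmod (?\<Delta> u p))\<^sup>2"
      unfolding abs_mult abs_power2 by (intro mult_right_mono) auto
    have "\<bar>2 * Re (?\<Delta> u p * cnj (?\<Delta> f p)) - (?\<psi> (fst p) + ?\<psi> (snd p)) * (cmod (?\<Delta> u p))\<^sup>2\<bar>
      \<le> (1 + 2 * C) * (cmod (?\<Delta> u p))\<^sup>2 + (cmod (?\<Delta> f p))\<^sup>2"
      using 1 2 by (simp only: distrib_right mult_1)
    then have "\<bar>\<Lambda> p\<bar> \<le> ((1 + 2 * C) * (cmod (?\<Delta> u p))\<^sup>2 + (cmod (?\<Delta> f p))\<^sup>2) / ?B p"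
      unfolding \<Lambda>_def abs_divide abs_power2 by (rule divide_right_mono) simp
    then show ?thesis by (simp add: quot_def add_divide_distrib)
  qed
  have i\<Lambda>: "integrable N \<Lambda>"
  proof (rule Bochner_Integration.integrable_bound)
    show "integrable N (\<lambda>p. (1 + 2 * C) * quot u p + quot f p)" using iu if' by simp
    show "\<Lambda> \<in> borel_measurable N" unfolding \<Lambda>_def[abs_def] by measurable
    show "AE p in N. norm (\<Lambda> p) \<le> norm ((1 + 2 * C) * quot u p + quot f p)"
      using order_trans[OF \<Lambda>_le abs_ge_self] by (intro always_eventually allI) simp
  qed
  have "dirichlet (\<lambda>x. sgn (u x + t * f x)) \<le> dirichlet u + t * (\<integral>p. \<Lambda> p \<partial>N)
      + ((16 * C\<^sup>2 + 2 * C) * dirichlet u + (6 + 2 * C) * dirichlet f) * t\<^sup>2"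
    if t: "\<bar>t\<bar> * C \<le> 1 / 2" for t :: real
  proof -
    let ?w = "\<lambda>p. quot u p + t * \<Lambda> p + t\<^sup>2 * ((16 * C\<^sup>2 + 2 * C) * quot u p + (6 + 2 * C) * quot f p)"
    have iw: "integrable N ?w"
      using iu if' i\<Lambda> by (intro Bochner_Integration.integrable_add integrable_mult_right)
    have "quot (\<lambda>x. sgn (u x + t * f x)) p \<le> ?w p" for p
    proof -
      have "quot (\<lambda>x. sgn (u x + t * f x)) p \<le> ((cmod (?\<Delta> u p))\<^sup>2
        + t * (2 * Re (?\<Delta> u p * cnj (?\<Delta> f p)) - (?\<psi> (fst p) + ?\<psi> (snd p)) * (cmod (?\<Delta> u p))\<^sup>2)
        + t\<^sup>2 * ((16 * C\<^sup>2 + 2 * C) * (cmod (?\<Delta> u p))\<^sup>2 + (6 + 2 * C) * (cmod (?\<Delta> f p))\<^sup>2)) / ?B p"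
        unfolding quot_def
        by (intro divide_right_mono projected_variation_le circle_mapD(5)[OF u] f(2) t) simp
      also have "\<dots> = ?w p" unfolding \<Lambda>_def quot_def by (simp only: times_divide_eq_right add_divide_distrib[symmetric])
      finally show ?thesis .
    qed
    then have "dirichlet (\<lambda>x. sgn (u x + t * f x)) \<le> (\<integral>p. ?w p \<partial>N)"
      by (rule finite_dirichletI(2)[OF circle_mapD(2)[OF projected_variation(1)[OF u f t]] iw])
    also have "\<dots> = dirichlet u + t * (\<integral>p. \<Lambda> p \<partial>N) + t\<^sup>2 * ((16 * C\<^sup>2 + 2 * C) * dirichlet u + (6 + 2 * C) * dirichlet f)"
      using iu if' i\<Lambda> by (simp add: dirichlet_def)
    finally show ?thesis by (simp add: mult.commute)
  qed
  then show thesis by (rule that)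
qed

lemma class_minimizer_stationary:
  fixes u f :: "'a \<Rightarrow> complex"
  assumes u: "circle_map u" "AE x in M. x \<in> A \<longrightarrow> u x = g x"
    and min: "\<And>w. circle_map w \<Longrightarrow> (AE x in M. x \<in> A \<longrightarrow> w x = g x) \<Longrightarrow> deg w = deg u \<Longrightarrow> dirichlet u \<le> dirichlet w"
    and f: "finite_dirichlet f" "\<And>x. x \<in> A \<Longrightarrow> f x = 0"
  shows "((\<lambda>t::real. dirichlet (\<lambda>x. sgn (u x + t * f x))) has_real_derivative 0) (at 0)"
proof -
  obtain C0 where C0: "\<And>x. cmod (f x) \<le> C0" using finite_dirichlet_bounded[OF f(1)] by (metis bounded_mapE)
  define C where "C = max C0 1"
  have C: "cmod (f x) \<le> C" for x using C0[of x] by (simp add: C_def)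
  have C1: "C \<ge> 1" by (simp add: C_def)
  obtain L K where LK: "\<And>t::real. \<bar>t\<bar> * C \<le> 1 / 2 \<Longrightarrow>
    dirichlet (\<lambda>x. sgn (u x + t * f x)) \<le> dirichlet u + t * L + K * t\<^sup>2"
    using dirichlet_projected_variation_le[OF u(1) f(1) C] by blast
  have su: "sgn (u x) = u x" for x using circle_mapD(5)[OF u(1), of x] by (simp add: sgn_eq)
  have t: "\<bar>t\<bar> * C \<le> 1 / 2" if "\<bar>t\<bar> \<le> 1 / (2 * C)" for t
    using that C1 by (simp add: pos_le_divide_eq mult_ac)
  show ?thesis
  proof (rule derivative_zero_at_minimum[of "1 / (2 * C)" _ L K])
    show "1 / (2 * C) > 0" using C1 by simp
    fix t :: real assume tt: "\<bar>t\<bar> \<le> 1 / (2 * C)"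
    note pv = projected_variation[OF u(1) f(1) C t[OF tt]]
    have "AE x in M. x \<in> A \<longrightarrow> sgn (u x + t * f x) = g x"
      using u(2)
    proof eventually_elim
      case (elim x)
      then show ?case using su[of x] f(2)[of x] by auto
    qed
    then show "dirichlet (\<lambda>x. sgn (u x + complex_of_real 0 * f x)) \<le> dirichlet (\<lambda>x. sgn (u x + t * f x))"
      using min[OF pv(1) _ pv(2)] by (simp add: su)
    show "dirichlet (\<lambda>x. sgn (u x + t * f x)) \<le> dirichlet (\<lambda>x. sgn (u x + complex_of_real 0 * f x)) + t * L + K * t\<^sup>2"
      using LK[OF t[OF tt]] by (simp add: su)
  qed
qed

section \<open>Gluing a bubble\<close>

text \<open>With \<open>z = \<beta> x cnj (\<beta> y)\<close> and \<open>w = u x cnj (u y)\<close> the two squared differences are \<open>2 - 2 Re (z w)\<close> and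
  \<open>2 - 2 Re (cnj z w)\<close>, and \<open>Re (z w) + Re (cnj z w) = 2 Re z Re w\<close>.\<close>

lemma dirichlet_mult_add_mult_cnj:
  assumes u: "circle_map u" and \<beta>: "circle_map \<beta>"
  shows "dirichlet (\<lambda>x. \<beta> x * u x) + dirichlet (\<lambda>x. cnj (\<beta> x) * u x) =
    2 * dirichlet u + 2 * dirichlet \<beta> - (\<integral>p. (cmod (\<beta> (fst p) - \<beta> (snd p)))\<^sup>2 * quot u p \<partial>N)"
    and "integrable N (\<lambda>p. (cmod (\<beta> (fst p) - \<beta> (snd p)))\<^sup>2 * quot u p)"
proof -
  note [measurable] = circle_mapD(3)[OF u] circle_mapD(3)[OF \<beta>]
  have b2: "cmod (\<beta> (fst p) - \<beta> (snd p)) \<le> 2" for p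
    using norm_triangle_ineq4[of "\<beta> (fst p)" "\<beta> (snd p)"] by (simp add: circle_mapD(5)[OF \<beta>])
  show i: "integrable N (\<lambda>p. (cmod (\<beta> (fst p) - \<beta> (snd p)))\<^sup>2 * quot u p)"
  proof (rule Bochner_Integration.integrable_bound)
    show "integrable N (\<lambda>p. 2\<^sup>2 * quot u p)" using circle_mapD(4)[OF u] by simp
    show "AE p in N. norm ((cmod (\<beta> (fst p) - \<beta> (snd p)))\<^sup>2 * quot u p) \<le> norm (2\<^sup>2 * quot u p)"
      unfolding real_norm_def abs_mult abs_power2 using b2
      by (intro always_eventually allI mult_right_mono power_mono) auto
  qed measurable
  have c: "circle_map (\<lambda>x. \<beta> x * u x)" "circle_map (\<lambda>x. cnj (\<beta> x) * u x)"
    by (intro circle_map_mult circle_map_cnj u \<beta>)+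
  have "quot (\<lambda>x. \<beta> x * u x) p + quot (\<lambda>x. cnj (\<beta> x) * u x) p =
     2 * quot u p + 2 * quot \<beta> p - (cmod (\<beta> (fst p) - \<beta> (snd p)))\<^sup>2 * quot u p" for p
  proof -
    obtain x y where p: "p = (x, y)" by (cases p)
    define z where "z = \<beta> x * cnj (\<beta> y)"
    define w where "w = u x * cnj (u y)"
    note n = circle_mapD(5)[OF u] circle_mapD(5)[OF \<beta>] circle_mapD(5)[OF c(1)] circle_mapD(5)[OF c(2)]
    have z: "(cmod (\<beta> x - \<beta> y))\<^sup>2 = 2 - 2 * Re z" unfolding z_def using unimodular_cross[of "\<beta> x" "\<beta> y"] n by simp
    have w: "(cmod (u x - u y))\<^sup>2 = 2 - 2 * Re w" unfolding w_def using unimodular_cross[of "u x" "u y"] n by simp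
    have "(\<beta> x * u x) * cnj (\<beta> y * u y) = z * w" "(cnj (\<beta> x) * u x) * cnj (cnj (\<beta> y) * u y) = cnj z * w"
      by (simp_all add: z_def w_def)
    then have "(cmod (\<beta> x * u x - \<beta> y * u y))\<^sup>2 + (cmod (cnj (\<beta> x) * u x - cnj (\<beta> y) * u y))\<^sup>2
        = (2 - 2 * Re (z * w)) + (2 - 2 * Re (cnj z * w))"
      using unimodular_cross[of "\<beta> x * u x" "\<beta> y * u y"] unimodular_cross[of "cnj (\<beta> x) * u x" "cnj (\<beta> y) * u y"] n
      by (simp del: times_complex.sel)
    also have "\<dots> = 4 - 4 * (Re z * Re w)" by simp
    also have "\<dots> = 2 * (cmod (u x - u y))\<^sup>2 + 2 * (cmod (\<beta> x - \<beta> y))\<^sup>2 - (cmod (\<beta> x - \<beta> y))\<^sup>2 * (cmod (u x - u y))\<^sup>2"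
      unfolding z w by (simp add: algebra_simps)
    finally show ?thesis unfolding quot_def p by (simp add: add_divide_distrib diff_divide_distrib flip: add_divide_distrib)
  qed
  then have "(\<integral>p. quot (\<lambda>x. \<beta> x * u x) p + quot (\<lambda>x. cnj (\<beta> x) * u x) p \<partial>N) =
    (\<integral>p. 2 * quot u p + 2 * quot \<beta> p - (cmod (\<beta> (fst p) - \<beta> (snd p)))\<^sup>2 * quot u p \<partial>N)" by simp
  then show "dirichlet (\<lambda>x. \<beta> x * u x) + dirichlet (\<lambda>x. cnj (\<beta> x) * u x) =
    2 * dirichlet u + 2 * dirichlet \<beta> - (\<integral>p. (cmod (\<beta> (fst p) - \<beta> (snd p)))\<^sup>2 * quot u p \<partial>N)"
    unfolding dirichlet_def using i circle_mapD(4)[OF u] circle_mapD(4)[OF \<beta>] circle_mapD(4)[OF c(1)] circle_mapD(4)[OF c(2)]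
    by simp
qed

text \<open>A degree-one map that is \<open>1\<close> on \<open>A\<close> produces a second critical map as soon as its energy exceeds the
  minimal energy \<open>1\<close> of its class by less than half of its interaction with \<open>u0\<close>: then \<open>\<beta> u0\<close> or \<open>cnj \<beta> u0\<close>
  is a competitor that rules out a loss of degree.\<close>

theorem second_critical_map:
  fixes u0 \<beta> :: "'a \<Rightarrow> complex"
  assumes u0: "circle_map u0"
    and min: "\<And>w. circle_map w \<Longrightarrow> (AE x in M. x \<in> A \<longrightarrow> w x = u0 x) \<Longrightarrow> dirichlet u0 \<le> dirichlet w"
    and \<beta>: "circle_map \<beta>" "deg \<beta> = 1" "\<And>x. x \<in> A \<Longrightarrow> \<beta> x = 1"
    and gain: "2 * dirichlet \<beta> < 2 + (\<integral>p. (cmod (\<beta> (fst p) - \<beta> (snd p)))\<^sup>2 * quot u0 p \<partial>N)"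
  obtains u :: "'a \<Rightarrow> complex" where "circle_map u" "AE x in M. x \<in> A \<longrightarrow> u x = u0 x" "deg u \<noteq> deg u0"
    "\<And>f. finite_dirichlet f \<Longrightarrow> (\<And>x. x \<in> A \<Longrightarrow> f x = 0) \<Longrightarrow>
      ((\<lambda>t::real. dirichlet (\<lambda>x. sgn (u x + t * f x))) has_real_derivative 0) (at 0)"
proof -
  have "dirichlet (\<lambda>x. \<beta> x * u0 x) + dirichlet (\<lambda>x. cnj (\<beta> x) * u0 x) < 2 * dirichlet u0 + 2"
    using dirichlet_mult_add_mult_cnj(1)[OF u0 \<beta>(1)] gain by linarith
  then have "dirichlet (\<lambda>x. \<beta> x * u0 x) < dirichlet u0 + 1 \<or> dirichlet (\<lambda>x. cnj (\<beta> x) * u0 x) < dirichlet u0 + 1"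
    by linarith
  then obtain v where v: "circle_map v" "deg v \<noteq> deg u0" "\<And>x. x \<in> A \<Longrightarrow> v x = u0 x" "dirichlet v < dirichlet u0 + 1"
  proof
    assume "dirichlet (\<lambda>x. \<beta> x * u0 x) < dirichlet u0 + 1"
    then show thesis using that[of "\<lambda>x. \<beta> x * u0 x"] circle_map_mult[OF \<beta>(1) u0] deg_mult[OF \<beta>(1) u0] \<beta> by simp
  next
    assume "dirichlet (\<lambda>x. cnj (\<beta> x) * u0 x) < dirichlet u0 + 1"
    then show thesis using that[of "\<lambda>x. cnj (\<beta> x) * u0 x"] circle_map_mult[OF circle_map_cnj[OF \<beta>(1)] u0]
        deg_mult[OF circle_map_cnj[OF \<beta>(1)] u0] deg_cnj[of \<beta>] \<beta> by simp
  qed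
  have "AE x in M. x \<in> A \<longrightarrow> v x = u0 x" using v(3) by simp
  then obtain u where u: "circle_map u" "AE x in M. x \<in> A \<longrightarrow> u x = u0 x" "deg u = deg v"
    "\<And>w. circle_map w \<Longrightarrow> (AE x in M. x \<in> A \<longrightarrow> w x = u0 x) \<Longrightarrow> deg w = deg v \<Longrightarrow> dirichlet u \<le> dirichlet w"
    using minimizer_in_degree_class[OF min v(1) _ v(4)] by blast
  show thesis
  proof (rule that[OF u(1,2)])
    show "deg u \<noteq> deg u0" using u(3) v(2) by simp
    show "((\<lambda>t::real. dirichlet (\<lambda>x. sgn (u x + t * f x))) has_real_derivative 0) (at 0)"
      if "finite_dirichlet f" "\<And>x. x \<in> A \<Longrightarrow> f x = 0" for f
      using class_minimizer_stationary[OF u(1,2) _ that] u(3,4) by simp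
  qed
qed

lemma deg_cong_AE:
  assumes "AE x in M. u x = v x" "u \<in> borel_measurable M" "v \<in> borel_measurable M"
  shows "deg u = deg v"
proof -
  note [measurable] = assms(2,3)
  have "(\<integral>x. u x * cnj (b x) ^ n \<partial>M) = (\<integral>x. v x * cnj (b x) ^ n \<partial>M)" for n
  proof (rule integral_cong_AE)
    show "AE x in M. u x * cnj (b x) ^ n = v x * cnj (b x) ^ n"
      using assms(1) by eventually_elim simp
  qed measurable
  moreover have "(\<integral>x. cnj (u x) * cnj (b x) ^ n \<partial>M) = (\<integral>x. cnj (v x) * cnj (b x) ^ n \<partial>M)" for n
  proof (rule integral_cong_AE)
    show "AE x in M. cnj (u x) * cnj (b x) ^ n = cnj (v x) * cnj (b x) ^ n"
      using assms(1) by eventually_elim simp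
  qed measurable
  ultimately have "fourier u n = fourier v n" "fourier (\<lambda>x. cnj (u x)) n = fourier (\<lambda>x. cnj (v x)) n" for n
    unfolding fourier_def by simp_all
  then show ?thesis unfolding deg_def hardy_def by presburger
qed

end

section \<open>The real line as a circle\<close>

definition cayley :: "real \<Rightarrow> complex" where
  "cayley x = (of_real x - \<i>) / (of_real x + \<i>)"

definition cauchy_measure :: "real measure" where
  "cauchy_measure = density lebesgue (\<lambda>x. ennreal (1 / (pi * (1 + x\<^sup>2))))"

lemma real_plus_i_nonzero: "complex_of_real x + \<i> \<noteq> 0" "complex_of_real x - \<i> \<noteq> 0"
  by (auto simp: complex_eq_iff)

lemma norm_real_plus_i: "(cmod (of_real x + \<i>))\<^sup>2 = 1 + x\<^sup>2" "(cmod (of_real x - \<i>))\<^sup>2 = 1 + x\<^sup>2"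
  unfolding cmod_power2 by simp_all

lemma one_plus_sq_pos: "0 < 1 + (x::real)\<^sup>2"
  by (simp add: add_pos_nonneg)

lemma norm_cayley: "cmod (cayley x) = 1"
proof -
  have "(cmod (cayley x))\<^sup>2 = 1"
    unfolding cayley_def norm_divide power_divide norm_real_plus_i using one_plus_sq_pos[of x] by simp
  then show ?thesis by (simp add: power2_eq_1_iff) (metis norm_ge_zero not_one_le_zero le_minus_one_simps(3))
qed

lemma cayley_diff_sq: "(cmod (cayley x - cayley y))\<^sup>2 = 4 * (x - y)\<^sup>2 / ((1 + x\<^sup>2) * (1 + y\<^sup>2))"
proof -
  have "cayley x - cayley y = 2 * \<i> * of_real (x - y) / ((of_real x + \<i>) * (of_real y + \<i>))"
    unfolding cayley_def using real_plus_i_nonzero[of x] real_plus_i_nonzero[of y]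
    by (simp add: diff_frac_eq) (simp add: algebra_simps)
  then have "(cmod (cayley x - cayley y))\<^sup>2 = (2 * \<bar>x - y\<bar>)\<^sup>2 / ((cmod (of_real x + \<i>))\<^sup>2 * (cmod (of_real y + \<i>))\<^sup>2)"
    by (simp add: norm_divide norm_mult power_divide power_mult_distrib del: of_real_diff)
  then show ?thesis unfolding norm_real_plus_i by (simp add: power_mult_distrib)
qed

lemma cayley_measurable: "cayley \<in> borel_measurable borel"
  unfolding cayley_def[abs_def] by measurable

lemma cauchy_density_FTC:
  "set_integrable lborel UNIV (\<lambda>x. 1 / (pi * (1 + x\<^sup>2)))"
  "(\<integral>x. 1 / (pi * (1 + x\<^sup>2)) \<partial>lborel) = 1"
proof -
  have D: "DERIV (\<lambda>x. arctan x / pi) x :> 1 / (pi * (1 + x\<^sup>2))" for x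
    by (auto intro!: derivative_eq_intros simp: divide_simps)
  have c: "isCont (\<lambda>x. 1 / (pi * (1 + x\<^sup>2))) x" for x :: real
    using one_plus_sq_pos[of x] by (intro continuous_intros) auto
  have l: "((\<lambda>x. arctan x / pi) \<longlongrightarrow> - (1/2)) at_bot" "((\<lambda>x. arctan x / pi) \<longlongrightarrow> 1/2) at_top"
    using tendsto_divide[OF tendsto_arctan_at_bot tendsto_const[of pi]]
      tendsto_divide[OF tendsto_arctan_at_top tendsto_const[of pi]] by simp_all
  have nn: "AE x in lborel. - \<infinity> < ereal x \<longrightarrow> ereal x < \<infinity> \<longrightarrow> 0 \<le> 1 / (pi * (1 + x\<^sup>2))"
    using one_plus_sq_pos by (intro always_eventually) (auto intro!: divide_nonneg_nonneg mult_nonneg_nonneg)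
  note F = interval_integral_FTC_nonneg[where a = "-\<infinity>" and b = "\<infinity>" and F = "\<lambda>x. arctan x / pi" and
     f = "\<lambda>x. 1 / (pi * (1 + x\<^sup>2))" and A = "- (1/2)" and B = "1/2", OF _ D c nn]
  show "set_integrable lborel UNIV (\<lambda>x. 1 / (pi * (1 + x\<^sup>2)))"
    using F(1) l by (simp add: ereal_tendsto_simps)
  have "(LBINT x=-\<infinity>..\<infinity>. 1 / (pi * (1 + x\<^sup>2))) = 1"
    using F(2) l by (simp add: ereal_tendsto_simps)
  then show "(\<integral>x. 1 / (pi * (1 + x\<^sup>2)) \<partial>lborel) = 1"
    by (simp add: interval_lebesgue_integral_def set_lebesgue_integral_def)
qed

lemma cauchy_density_measurable [measurable]: "(\<lambda>x::real. 1 / (pi * (1 + x\<^sup>2))) \<in> borel_measurable borel"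
  by measurable

lemma cauchy_density_lebesgue [measurable]: "(\<lambda>x::real. 1 / (pi * (1 + x\<^sup>2))) \<in> borel_measurable lebesgue"
  by (rule measurable_completion) simp

lemma cauchy_integral:
  fixes f :: "real \<Rightarrow> complex"
  assumes "f \<in> borel_measurable borel"
  shows "(\<integral>x. f x \<partial>cauchy_measure) = (\<integral>x. (1 / (pi * (1 + x\<^sup>2))) *\<^sub>R f x \<partial>lborel)"
proof -
  have m: "f \<in> borel_measurable lebesgue" using assms by (simp add: measurable_completion)
  have "(\<integral>x. f x \<partial>cauchy_measure) = (\<integral>x. (1 / (pi * (1 + x\<^sup>2))) *\<^sub>R f x \<partial>lebesgue)"
    unfolding cauchy_measure_def using one_plus_sq_pos
    by (intro integral_density m cauchy_density_lebesgue always_eventually allI divide_nonneg_nonneg mult_nonneg_nonneg)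
       (auto intro: less_imp_le)
  also have "\<dots> = (\<integral>x. (1 / (pi * (1 + x\<^sup>2))) *\<^sub>R f x \<partial>lborel)"
    using assms by (intro integral_completion) measurable
  finally show ?thesis .
qed

text \<open>The integrand has the primitive \<open>cayley x ^ n / (2 \<i> n \<pi>)\<close>, which has the same limit at both ends of the line.\<close>

lemma cayley_moment:
  assumes n: "n \<ge> 1"
  shows "(\<integral>x. cayley x ^ n \<partial>cauchy_measure) = 0"
proof -
  let ?c = "1 / (2 * \<i> * of_nat n * of_real pi)"
  let ?F = "\<lambda>x::real. ?c * cayley x ^ n"
  let ?f = "\<lambda>x::real. (1 / (pi * (1 + x\<^sup>2))) *\<^sub>R cayley x ^ n"
  have Db: "(cayley has_vector_derivative (2 * \<i> / (of_real x + \<i>)\<^sup>2)) (at x)" for x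
  proof -
    have "((\<lambda>z. (z - \<i>) / (z + \<i>)) has_field_derivative (2 * \<i> / (of_real x + \<i>)\<^sup>2)) (at (of_real x))"
      using real_plus_i_nonzero[of x] by (auto intro!: derivative_eq_intros simp: power2_eq_square divide_simps)
    then have "((\<lambda>x. (of_real x - \<i>) / (of_real x + \<i>)) has_vector_derivative (2 * \<i> / (of_real x + \<i>)\<^sup>2)) (at x)"
      by (rule has_vector_derivative_real_field)
    then show ?thesis by (simp add: cayley_def[abs_def])
  qed
  have DF: "(?F has_vector_derivative ?f x) (at x)" for x
  proof -
    have "((\<lambda>z. ?c * z ^ n) has_field_derivative ?c * (of_nat n * cayley x ^ (n - 1))) (at (cayley x))"
      by (auto intro!: derivative_eq_intros)
    from field_vector_diff_chain_at[OF Db this]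
    have "(?F has_vector_derivative (2 * \<i> / (of_real x + \<i>)\<^sup>2) * (?c * (of_nat n * cayley x ^ (n - 1)))) (at x)"
      by (simp add: o_def)
    moreover have "(2 * \<i> / (of_real x + \<i>)\<^sup>2) * (?c * (of_nat n * cayley x ^ (n - 1))) = ?f x"
    proof -
      have "cayley x ^ n = cayley x * cayley x ^ (n - 1)" using n by (simp flip: power_Suc)
      moreover have "complex_of_real (1 + x\<^sup>2) = (of_real x + \<i>) * (of_real x - \<i>)"
        by (simp add: power2_eq_square algebra_simps)
      moreover have "complex_of_nat n \<noteq> 0" using n by simp
      ultimately show ?thesis using real_plus_i_nonzero[of x]
        by (simp only: scaleR_conv_of_real of_real_divide of_real_mult of_real_1)
           (simp add: cayley_def power2_eq_square divide_simps)
    qed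
    ultimately show ?thesis by simp
  qed
  have cb: "isCont cayley x" for x using Db[of x] has_vector_derivative_continuous by blast
  have cf: "isCont ?f x" for x
    using one_plus_sq_pos[of x] by (intro continuous_intros cb) auto
  have i: "set_integrable lborel UNIV ?f"
    unfolding set_integrable_def
  proof (rule Bochner_Integration.integrable_bound)
    show "integrable lborel (\<lambda>x::real. 1 / (pi * (1 + x\<^sup>2)))"
      using cauchy_density_FTC(1) by (simp add: set_integrable_def)
    show "(\<lambda>x. indicat_real UNIV x *\<^sub>R ?f x) \<in> borel_measurable lborel"
      using cayley_measurable by measurable
  qed (simp add: norm_power norm_cayley)
  have lim: "(cayley \<longlongrightarrow> 1) at_bot" "(cayley \<longlongrightarrow> 1) at_top"
  proof -
    have e: "cayley x = 1 - 2 * \<i> / (of_real x + \<i>)" for x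
      using real_plus_i_nonzero[of x] by (simp add: cayley_def diff_frac_eq divide_simps)
    have a: "filterlim (\<lambda>x::real. of_real x + \<i>) at_infinity F" if "filterlim (\<lambda>x::real. x) at_infinity F" for F
      by (rule tendsto_add_filterlim_at_infinity') (use filterlim_at_infinity_imp_norm_at_top[OF that] in
          \<open>auto intro!: filterlim_norm_at_top_imp_at_infinity\<close>)
    have "((\<lambda>x. 1 - 2 * \<i> / (of_real x + \<i>)) \<longlongrightarrow> 1 - 0) F" if "filterlim (\<lambda>x::real. x) at_infinity F" for F
      by (intro tendsto_diff tendsto_const tendsto_divide_0[OF tendsto_const] a that)
    then show "(cayley \<longlongrightarrow> 1) at_bot" "(cayley \<longlongrightarrow> 1) at_top"
      unfolding e[abs_def] by (simp_all add: filterlim_at_infinity_imp_filterlim_at_top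
        filterlim_mono[OF filterlim_ident at_bot_le_at_infinity order_refl] filterlim_mono[OF filterlim_ident at_top_le_at_infinity order_refl])
  qed
  have "(LBINT x=-\<infinity>..\<infinity>. ?f x) = ?c * 1 ^ n - ?c * 1 ^ n"
  proof (rule interval_integral_FTC_integrable[where F = ?F])
    show "((?F \<circ> real_of_ereal) \<longlongrightarrow> ?c * 1 ^ n) (at_right (- \<infinity>))"
      unfolding ereal_tendsto_simps by (intro tendsto_intros lim)
    show "((?F \<circ> real_of_ereal) \<longlongrightarrow> ?c * 1 ^ n) (at_left \<infinity>)"
      unfolding ereal_tendsto_simps by (intro tendsto_intros lim)
    show "set_integrable lborel (einterval (- \<infinity>) \<infinity>) ?f" using i by simp
  qed (use DF cf in auto)
  then have "(\<integral>x. ?f x \<partial>lborel) = 0"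
    by (simp add: interval_lebesgue_integral_def set_lebesgue_integral_def)
  then show ?thesis using cauchy_integral[of "\<lambda>x. cayley x ^ n"] cayley_measurable by simp
qed

lemma space_cauchy [simp]: "space cauchy_measure = UNIV"
  by (simp add: cauchy_measure_def)

lemma sets_cauchy [measurable_cong]: "sets cauchy_measure = sets lebesgue"
  by (simp add: cauchy_measure_def)

lemma borel_measurable_cauchy: "borel_measurable cauchy_measure = borel_measurable lebesgue"
  by (rule measurable_cong_sets) (simp_all add: sets_cauchy)

lemma AE_cauchy: "(AE x in cauchy_measure. P x) \<longleftrightarrow> (AE x in lebesgue. P x)"
proof -
  have "(\<lambda>x::real. ennreal (1 / (pi * (1 + x\<^sup>2)))) \<in> borel_measurable lebesgue" by measurable
  then show ?thesis unfolding cauchy_measure_def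
    using one_plus_sq_pos by (subst AE_density) (auto simp: ennreal_less_zero_iff)
qed

lemma prob_space_cauchy: "prob_space cauchy_measure"
proof (rule prob_spaceI)
  have "emeasure cauchy_measure (space cauchy_measure) = (\<integral>\<^sup>+x. ennreal (1 / (pi * (1 + x\<^sup>2))) \<partial>lebesgue)"
    unfolding cauchy_measure_def by (simp add: emeasure_density)
  also have "\<dots> = (\<integral>\<^sup>+x. ennreal (1 / (pi * (1 + x\<^sup>2))) \<partial>lborel)" by (rule nn_integral_completion)
  also have "\<dots> = ennreal (\<integral>x. 1 / (pi * (1 + x\<^sup>2)) \<partial>lborel)"
    using cauchy_density_FTC(1) one_plus_sq_pos
    by (intro nn_integral_eq_integral) (auto simp: set_integrable_def intro!: divide_nonneg_nonneg mult_nonneg_nonneg less_imp_le)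
  finally show "emeasure cauchy_measure (space cauchy_measure) = 1" by (simp only: cauchy_density_FTC(2) ennreal_1)
qed

interpretation line: circle_space cauchy_measure cayley
proof (rule circle_space.intro[OF prob_space_cauchy], unfold_locales)
  show "cayley \<in> borel_measurable cauchy_measure"
    using cayley_measurable by (simp add: borel_measurable_cauchy measurable_completion)
  show "cmod (cayley x) = 1" for x by (rule norm_cayley)
  show "x = y" if "cayley x = cayley y" for x y
  proof -
    have "4 * (x - y)\<^sup>2 / ((1 + x\<^sup>2) * (1 + y\<^sup>2)) = 0" using cayley_diff_sq[of x y] that by simp
    then show ?thesis using one_plus_sq_pos[of x] one_plus_sq_pos[of y] by simp
  qed
  show "(\<integral>x. cayley x ^ n \<partial>cauchy_measure) = 0" if "n \<ge> 1" for n by (rule cayley_moment[OF that])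
qed

text \<open>By \<open>cayley_diff_sq\<close> the factors \<open>1 + x\<^sup>2\<close> of the chord length cancel against the densities.\<close>

lemma gagliardo_eq:
  assumes u: "u \<in> borel_measurable lebesgue"
  shows "gagliardo_sq u = ennreal (4 * pi\<^sup>2) * (\<integral>\<^sup>+p. ennreal (line.quot u p) \<partial>line.N)"
proof -
  have um [measurable]: "u \<in> borel_measurable cauchy_measure" using u by (simp add: borel_measurable_cauchy)
  let ?w = "\<lambda>x::real. 1 / (pi * (1 + x\<^sup>2))"
  have w0: "0 \<le> ?w x" for x using one_plus_sq_pos[of x] by simp
  have wm: "(\<lambda>x. ennreal (?w x)) \<in> borel_measurable lebesgue"
    by (rule measurable_compose[OF cauchy_density_lebesgue measurable_ennreal])
  define J where "J x = (\<integral>\<^sup>+\<xi>. ennreal (line.quot u (x, \<xi>)) \<partial>cauchy_measure)" for x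
  have Jm: "J \<in> borel_measurable lebesgue"
    unfolding J_def[abs_def] borel_measurable_cauchy[symmetric]
    by (rule line.borel_measurable_nn_integral_fst) measurable
  have q: "(cmod (u x - u \<xi>))\<^sup>2 / (x - \<xi>)\<^sup>2 = (4 * pi\<^sup>2) * (?w x * (?w \<xi> * line.quot u (x, \<xi>)))" for x \<xi>
  proof (cases "x = \<xi>")
    case False
    then show ?thesis
      using one_plus_sq_pos[of x] one_plus_sq_pos[of \<xi>]
      unfolding line.quot_def fst_conv snd_conv cayley_diff_sq by (simp add: power2_eq_square divide_simps)
  qed (simp add: line.quot_def)
  have inner: "(\<integral>\<^sup>+\<xi>. ennreal ((cmod (u x - u \<xi>))\<^sup>2 / (x - \<xi>)\<^sup>2) \<partial>lebesgue) = ennreal (4 * pi\<^sup>2) * (ennreal (?w x) * J x)" for x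
  proof -
    have qm: "(\<lambda>\<xi>. ennreal (line.quot u (x, \<xi>))) \<in> borel_measurable lebesgue"
    proof -
      have "(\<lambda>p. ennreal (line.quot u p)) \<in> borel_measurable line.N" by measurable
      from measurable_Pair2[OF this, of x] show ?thesis unfolding borel_measurable_cauchy[symmetric] by simp
    qed
    have "(\<integral>\<^sup>+\<xi>. ennreal ((cmod (u x - u \<xi>))\<^sup>2 / (x - \<xi>)\<^sup>2) \<partial>lebesgue) =
      (\<integral>\<^sup>+\<xi>. (ennreal (4 * pi\<^sup>2) * ennreal (?w x)) * (ennreal (?w \<xi>) * ennreal (line.quot u (x, \<xi>))) \<partial>lebesgue)"
    proof -
      have split: "ennreal (a * (c * (d * e))) = (ennreal a * ennreal c) * (ennreal d * ennreal e)"
        if "0 \<le> a" "0 \<le> c" "0 \<le> d" for a c d e :: real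
        using that by (simp add: ennreal_mult' mult.assoc)
      show ?thesis unfolding q by (intro nn_integral_cong split w0) simp
    qed
    also have "\<dots> = (ennreal (4 * pi\<^sup>2) * ennreal (?w x)) * (\<integral>\<^sup>+\<xi>. ennreal (?w \<xi>) * ennreal (line.quot u (x, \<xi>)) \<partial>lebesgue)"
      by (intro nn_integral_cmult borel_measurable_times_ennreal wm qm)
    also have "(\<integral>\<^sup>+\<xi>. ennreal (?w \<xi>) * ennreal (line.quot u (x, \<xi>)) \<partial>lebesgue) = J x"
      unfolding J_def cauchy_measure_def by (intro nn_integral_density[symmetric] wm qm)
    finally show ?thesis by (simp add: mult.assoc)
  qed
  have "gagliardo_sq u = (\<integral>\<^sup>+x. ennreal (4 * pi\<^sup>2) * (ennreal (?w x) * J x) \<partial>lebesgue)"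
    unfolding gagliardo_sq_def inner ..
  also have "\<dots> = ennreal (4 * pi\<^sup>2) * (\<integral>\<^sup>+x. ennreal (?w x) * J x \<partial>lebesgue)"
    by (intro nn_integral_cmult borel_measurable_times_ennreal wm Jm)
  also have "(\<integral>\<^sup>+x. ennreal (?w x) * J x \<partial>lebesgue) = (\<integral>\<^sup>+x. J x \<partial>cauchy_measure)"
    unfolding cauchy_measure_def by (intro nn_integral_density[symmetric] wm Jm)
  also have "\<dots> = (\<integral>\<^sup>+p. ennreal (line.quot u p) \<partial>line.N)"
    unfolding J_def by (rule line.nn_integral_fst) measurable
  finally show ?thesis .
qed

lemma energy_eq_dirichlet:
  assumes "u \<in> borel_measurable lebesgue"
  shows "energy u = 2 * pi * line.dirichlet u"
proof -
  have [measurable]: "u \<in> borel_measurable cauchy_measure" using assms by (simp add: borel_measurable_cauchy)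
  have "line.dirichlet u = enn2real (\<integral>\<^sup>+p. ennreal (line.quot u p) \<partial>line.N)"
    unfolding line.dirichlet_def by (rule integral_eq_nn_integral) (auto simp: line.quot_nonneg)
  then show ?thesis unfolding energy_def gagliardo_eq[OF assms] enn2real_mult
    by (simp add: power2_eq_square)
qed

lemma finite_dirichlet_iff:
  assumes "u \<in> borel_measurable lebesgue" "\<And>x. cmod (u x) \<le> C"
  shows "line.finite_dirichlet u \<longleftrightarrow> gagliardo_sq u < \<infinity>"
proof -
  have [measurable]: "u \<in> borel_measurable cauchy_measure" using assms by (simp add: borel_measurable_cauchy)
  have "line.bounded_map u" by (rule line.bounded_mapI[OF _ assms(2)]) measurable
  moreover have "integrable line.N (line.quot u) \<longleftrightarrow> (\<integral>\<^sup>+p. ennreal (line.quot u p) \<partial>line.N) < \<infinity>"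
    unfolding integrable_iff_bounded by (simp add: line.quot_nonneg)
  moreover have "ennreal (4 * pi\<^sup>2) * X < \<infinity> \<longleftrightarrow> X < \<infinity>" for X
    by (auto simp: ennreal_mult_less_top top_unique less_top)
  ultimately show ?thesis unfolding line.finite_dirichlet_def gagliardo_eq[OF assms(1)] by blast
qed

lemma gagliardo_cong_AE:
  assumes "AE x in lebesgue. u x = v x"
  shows "gagliardo_sq u = gagliardo_sq v"
  unfolding gagliardo_sq_def
proof (rule nn_integral_cong_AE)
  show "AE x in lebesgue. (\<integral>\<^sup>+\<xi>. ennreal ((cmod (u x - u \<xi>))\<^sup>2 / (x - \<xi>)\<^sup>2) \<partial>lebesgue) =
     (\<integral>\<^sup>+\<xi>. ennreal ((cmod (v x - v \<xi>))\<^sup>2 / (x - \<xi>)\<^sup>2) \<partial>lebesgue)"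
    using assms
  proof eventually_elim
    case (elim x)
    show ?case by (rule nn_integral_cong_AE) (use assms in \<open>eventually_elim, simp add: elim\<close>)
  qed
qed

section \<open>The bubble\<close>

definition hat :: "real \<Rightarrow> real" where "hat x = max 0 (1 - x\<^sup>2)"

definition bubble_denom :: "real \<Rightarrow> real \<Rightarrow> complex" where
  "bubble_denom e x = of_real x + \<i> * of_real (e * hat x)"

text \<open>With \<open>h = x / (1 - x\<^sup>2)\<close>, which maps the interval onto the line, this is the Blaschke factor
  \<open>(h - \<i> e) / (h + \<i> e)\<close>; as \<open>h\<close> is infinite at the end points, it continues by the constant \<open>1\<close>.\<close>

definition bubble :: "real \<Rightarrow> real \<Rightarrow> complex" where
  "bubble e x = cnj (bubble_denom e x) / bubble_denom e x"

lemma hat_nonneg: "0 \<le> hat x" and hat_le_1: "hat x \<le> 1"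
  by (simp_all add: hat_def)

lemma hat_inside: "\<bar>x\<bar> \<le> 1 \<Longrightarrow> hat x = 1 - x\<^sup>2"
  by (simp add: hat_def abs_square_le_1)

lemma hat_outside: "1 \<le> \<bar>x\<bar> \<Longrightarrow> hat x = 0"
  using power_mono[of 1 "\<bar>x\<bar>" 2] by (simp add: hat_def)

lemma hat_measurable [measurable]: "hat \<in> borel_measurable borel"
  unfolding hat_def[abs_def] by measurable

lemma norm_bubble_denom: "(cmod (bubble_denom e x))\<^sup>2 = x\<^sup>2 + e\<^sup>2 * (hat x)\<^sup>2"
  unfolding cmod_power2 bubble_denom_def by (simp add: power_mult_distrib)

lemma bubble_denom_nonzero:
  assumes "e > 0"
  shows "bubble_denom e x \<noteq> 0"
proof
  assume *: "bubble_denom e x = 0"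
  then have "x = 0" by (simp add: bubble_denom_def complex_eq_iff)
  with * assms show False by (simp add: bubble_denom_def hat_def)
qed

lemma bubble_outside: "1 \<le> \<bar>x\<bar> \<Longrightarrow> bubble e x = 1"
  by (auto simp: bubble_def bubble_denom_def hat_outside)

lemma Re_cayley: "Re (cayley x) = (x\<^sup>2 - 1) / (1 + x\<^sup>2)"
  unfolding cayley_def Re_divide by (simp add: power2_eq_square add.commute)

text \<open>This makes \<open>hat\<close> a Lipschitz function of the Cayley transform, also at infinity.\<close>

lemma hat_cayley: "hat x = 2 * max 0 (- Re (cayley x)) / (1 + max 0 (- Re (cayley x)))"
proof (cases "\<bar>x\<bar> \<le> 1")
  case True
  then have x: "x\<^sup>2 \<le> 1" by (simp add: abs_square_le_1)
  have m: "max 0 (- Re (cayley x)) = (1 - x\<^sup>2) / (1 + x\<^sup>2)"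
    unfolding Re_cayley using x one_plus_sq_pos[of x] by (simp add: max_def divide_simps)
  have "1 + (1 - x\<^sup>2) / (1 + x\<^sup>2) = 2 / (1 + x\<^sup>2)" using one_plus_sq_pos[of x] by (simp add: divide_simps)
  then show ?thesis unfolding m hat_inside[OF True] using one_plus_sq_pos[of x] by simp
next
  case False
  then have "1 \<le> x\<^sup>2" using power_mono[of 1 "\<bar>x\<bar>" 2] by simp
  then have "max 0 (- Re (cayley x)) = 0"
    unfolding Re_cayley using one_plus_sq_pos[of x] by (simp add: max_def divide_simps)
  then show ?thesis using False by (simp add: hat_outside)
qed

lemma hat_lipschitz: "\<bar>hat x - hat y\<bar> \<le> 2 * cmod (cayley x - cayley y)"
proof -
  define m where "m x = max 0 (- Re (cayley x))" for x
  have m0: "0 \<le> m x" for x by (simp add: m_def)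
  have h: "hat x = 2 * m x / (1 + m x)" for x unfolding m_def by (rule hat_cayley)
  have p: "0 < (1 + m x) * (1 + m y)" using m0[of x] m0[of y] by (intro mult_pos_pos) auto
  have "hat x - hat y = 2 * (m x - m y) / ((1 + m x) * (1 + m y))"
    unfolding h using m0[of x] m0[of y] by (simp add: diff_frac_eq) (simp add: algebra_simps)
  then have "\<bar>hat x - hat y\<bar> = 2 * \<bar>m x - m y\<bar> / ((1 + m x) * (1 + m y))"
    by (simp only: abs_divide abs_mult[of 2] abs_of_pos[OF p] abs_numeral)
  also have "\<dots> \<le> 2 * \<bar>m x - m y\<bar> / 1"
  proof (rule divide_left_mono)
    have "1 * 1 \<le> (1 + m x) * (1 + m y)" using m0[of x] m0[of y] by (intro mult_mono) auto
    then show "1 \<le> (1 + m x) * (1 + m y)" by simp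
  qed (use p in auto)
  also have "\<bar>m x - m y\<bar> \<le> \<bar>Re (cayley x) - Re (cayley y)\<bar>" unfolding m_def by linarith
  also have "\<dots> \<le> cmod (cayley x - cayley y)" using abs_Re_le_cmod[of "cayley x - cayley y"] by simp
  finally show ?thesis by simp
qed

lemma borel_imp_cauchy: "f \<in> borel_measurable borel \<Longrightarrow> f \<in> borel_measurable cauchy_measure"
  by (simp add: borel_measurable_cauchy measurable_completion)

lemma finite_dirichlet_hat: "line.finite_dirichlet (\<lambda>x. of_real (hat x))"
proof (rule line.finite_dirichlet_chord_lipschitz[where C = 2])
  show "line.bounded_map (\<lambda>x. complex_of_real (hat x))"
  proof (rule line.bounded_mapI)
    show "(\<lambda>x. complex_of_real (hat x)) \<in> borel_measurable cauchy_measure"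
      by (rule borel_imp_cauchy) measurable
    show "cmod (complex_of_real (hat x)) \<le> 1" for x using hat_nonneg[of x] hat_le_1[of x] by simp
  qed
  show "cmod (complex_of_real (hat x) - complex_of_real (hat y)) \<le> 2 * cmod (cayley x - cayley y)" for x y
    using hat_lipschitz[of x y] by (simp flip: of_real_diff)
qed

text \<open>The quotient of \<open>x + \<i> e hat x\<close> by \<open>x + \<i>\<close> stays in a half plane, so \<open>bubble e\<close> is the Cayley map times a
  square of degree zero.\<close>

lemma bubble_circle_map:
  assumes e: "0 < e" "e \<le> 1"
  shows "line.circle_map (bubble e)" "line.deg (bubble e) = 1"
proof -
  define v where "v x = bubble_denom e x / (of_real x + \<i>)" for x
  have v_eq: "v x = (1 / 2) * (1 + cayley x) + of_real (e / 2) * (of_real (hat x) * (1 + (- 1) * cayley x))" for x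
  proof -
    have "1 + cayley x = 2 * of_real x / (of_real x + \<i>)" "1 + (- 1) * cayley x = 2 * \<i> / (of_real x + \<i>)"
      using real_plus_i_nonzero[of x] by (simp_all add: cayley_def divide_simps)
    then show ?thesis by (simp add: v_def bubble_denom_def add_divide_distrib)
  qed
  have fv: "line.finite_dirichlet v"
    unfolding v_eq[abs_def]
    by (intro line.finite_dirichlet_add line.finite_dirichlet_mult line.finite_dirichlet_const
        line.finite_dirichlet_b finite_dirichlet_hat)
  have re: "e / 2 \<le> Re (v x)" for x
  proof -
    have "v x = bubble_denom e x * cnj (of_real x + \<i>) / of_real ((cmod (of_real x + \<i>))\<^sup>2)"
      using real_plus_i_nonzero[of x] by (simp add: v_def complex_norm_square divide_simps del: of_real_power)
    then have r: "Re (v x) = (x\<^sup>2 + e * hat x) / (1 + x\<^sup>2)"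
      unfolding norm_real_plus_i by (simp add: bubble_denom_def power2_eq_square Re_divide_of_real del: of_real_add)
    show ?thesis
    proof (cases "\<bar>x\<bar> \<le> 1")
      case True
      then have x: "x\<^sup>2 \<le> 1" by (simp add: abs_square_le_1)
      have "0 \<le> x\<^sup>2 * (1 - e)" using e by simp
      then have "e \<le> x\<^sup>2 + e * hat x" unfolding hat_inside[OF True] by (simp add: algebra_simps)
      then show ?thesis unfolding r using e x one_plus_sq_pos[of x] by (intro frac_le) auto
    next
      case False
      then have "1 \<le> x\<^sup>2" using power_mono[of 1 "\<bar>x\<bar>" 2] by simp
      then have "1 / 2 \<le> Re (v x)" unfolding r using False by (simp add: hat_outside divide_simps)
      then show ?thesis using e by linarith
    qed
  qed
  have up: "cmod (v x) \<le> 1" for x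
  proof -
    have "(cmod (bubble_denom e x))\<^sup>2 \<le> (cmod (of_real x + \<i>))\<^sup>2"
      unfolding norm_bubble_denom norm_real_plus_i
      using e hat_nonneg[of x] hat_le_1[of x] by (simp add: mult_le_one power_le_one)
    then have "cmod (bubble_denom e x) \<le> cmod (of_real x + \<i>)" by (rule power2_le_imp_le) simp
    then show ?thesis using real_plus_i_nonzero[of x] by (simp add: v_def norm_divide divide_le_eq_1)
  qed
  have lo: "e / 2 \<le> cmod (v x)" for x using re[of x] complex_Re_le_cmod[of "v x"] by linarith
  have v0: "v x \<noteq> 0" for x using lo[of x] e by auto
  have w: "line.circle_map (\<lambda>x. sgn (v x))" by (rule line.circle_map_sgn(1)[OF fv _ lo]) (use e in simp)
  have dw: "line.deg (\<lambda>x. sgn (v x)) = 0"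
  proof (rule line.deg_half_plane[OF w, of "e / 2"])
    fix x
    have "e / 2 / 1 \<le> Re (v x) / cmod (v x)" using re[of x] up[of x] v0[of x] e by (intro frac_le) auto
    then show "e / 2 \<le> Re (sgn (v x))" by (simp add: sgn_eq Re_divide_of_real)
  qed (use e in simp)
  have b_eq: "bubble e = (\<lambda>x. cayley x * (cnj (sgn (v x)) * cnj (sgn (v x))))"
  proof
    fix x
    have "cnj (sgn (v x)) * cnj (sgn (v x)) = cnj (v x) * cnj (v x) / of_real ((cmod (v x))\<^sup>2)"
      by (simp add: sgn_eq power2_eq_square)
    also have "\<dots> = cnj (v x) / v x" unfolding complex_norm_square using v0[of x] by simp
    also have "\<dots> = (cnj (bubble_denom e x) / (of_real x - \<i>)) * ((of_real x + \<i>) / bubble_denom e x)"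
      by (simp add: v_def)
    finally show "bubble e x = cayley x * (cnj (sgn (v x)) * cnj (sgn (v x)))"
      unfolding bubble_def cayley_def using real_plus_i_nonzero[of x] bubble_denom_nonzero[OF e(1), of x] by simp
  qed
  note cw = line.circle_map_cnj[OF w]
  note cw2 = line.circle_map_mult[OF cw cw]
  show "line.circle_map (bubble e)"
    unfolding b_eq by (rule line.circle_map_mult[OF line.circle_map_b cw2])
  show "line.deg (bubble e) = 1"
    unfolding b_eq line.deg_mult[OF line.circle_map_b cw2] line.deg_mult[OF cw cw] line.deg_cnj dw line.deg_b by simp
qed

lemma bubble_diff_sq:
  assumes "e > 0"
  shows "(cmod (bubble e x - bubble e y))\<^sup>2 =
    4 * e\<^sup>2 * (x * hat y - y * hat x)\<^sup>2 / ((x\<^sup>2 + e\<^sup>2 * (hat x)\<^sup>2) * (y\<^sup>2 + e\<^sup>2 * (hat y)\<^sup>2))"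
proof -
  let ?N = "bubble_denom e"
  have "bubble e x - bubble e y = (cnj (?N x) * ?N y - cnj (?N y) * ?N x) / (?N x * ?N y)"
    unfolding bubble_def using bubble_denom_nonzero[OF assms] by (simp add: diff_frac_eq)
  also have "cnj (?N x) * ?N y - cnj (?N y) * ?N x = of_real (2 * (e * (x * hat y - y * hat x))) * \<i>"
    by (simp add: bubble_denom_def algebra_simps)
  finally have "(cmod (bubble e x - bubble e y))\<^sup>2 = (2 * (e * (x * hat y - y * hat x)))\<^sup>2 / ((cmod (?N x))\<^sup>2 * (cmod (?N y))\<^sup>2)"
    by (simp only: norm_divide norm_mult norm_of_real norm_ii power_divide power_mult_distrib power2_abs mult_1_right power_one)
  then show ?thesis unfolding norm_bubble_denom by (simp add: power_mult_distrib mult.assoc)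
qed

context
  fixes e :: real
  assumes e: "0 < e" "e \<le> 1"
begin

text \<open>The squared modulus of \<open>bubble_denom\<close> inside the interval, continued by the same polynomial.\<close>

definition rho :: "real \<Rightarrow> real" where "rho x = x\<^sup>2 + e\<^sup>2 * (1 - x\<^sup>2)\<^sup>2"

definition bubble_moment :: "nat \<Rightarrow> real" where "bubble_moment k = (\<integral>x. indicator {-1..1} x * (e * x ^ k / rho x) \<partial>lborel)"

lemma rho_pos: "0 < rho x"
proof (cases "x = 0")
  case False then show ?thesis by (simp add: rho_def add_pos_nonneg)
qed (use e in \<open>simp add: rho_def\<close>)

lemma rho_continuous: "continuous_on S rho" "isCont rho x"
  unfolding rho_def[abs_def] by (intro continuous_intros)+

lemma rho_measurable [measurable]: "rho \<in> borel_measurable borel"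
  unfolding rho_def[abs_def] by measurable

lemma bubble_moment_integrable:
  assumes "continuous_on {-1..1} f"
  shows "integrable lborel (\<lambda>x::real. indicator {-1..1} x * (f x :: real))"
  using borel_integrable_atLeastAtMost'[OF assms] by (simp add: set_integrable_def)

lemma bubble_moment_continuous: "continuous_on {-1..1} (\<lambda>x. e * x ^ k / rho x)"
  using rho_pos by (intro continuous_intros rho_continuous) (metis less_irrefl)

lemma bubble_moment_1: "bubble_moment 1 = 0"
proof -
  have "bubble_moment 1 = \<bar>-1\<bar> *\<^sub>R (\<integral>x. indicator {-1..1} (0 + (-1) * x) * (e * (0 + (-1) * x) ^ 1 / rho (0 + (-1) * x)) \<partial>lborel)"
    unfolding bubble_moment_def by (rule lborel_integral_real_affine) simp
  also have "\<dots> = (\<integral>x. - (indicator {-1..1} x * (e * x ^ 1 / rho x)) \<partial>lborel)"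
    by (simp, intro Bochner_Integration.integral_cong) (auto simp: rho_def indicator_def)
  also have "\<dots> = - bubble_moment 1" unfolding bubble_moment_def by simp
  finally show ?thesis by simp
qed

text \<open>The sum of the two integrands is the derivative of \<open>arctan (x / (e (1 - x\<^sup>2)))\<close>.\<close>

lemma bubble_moment_0_2: "bubble_moment 0 + bubble_moment 2 = pi"
proof -
  let ?f = "\<lambda>x. e * (1 + x\<^sup>2) / rho x"
  let ?F = "\<lambda>x. arctan (x / (e * (1 - x\<^sup>2)))"
  have D: "DERIV ?F x :> ?f x" if "ereal (-1) < ereal x" "ereal x < ereal 1" for x
  proof -
    have "\<bar>x\<bar> < 1" using that by auto
    then have x: "0 < 1 - x\<^sup>2" by (simp add: abs_square_less_1)
    have ne: "e * (1 - x\<^sup>2) \<noteq> 0" using x e by simp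
    have "DERIV (\<lambda>x. x / (e * (1 - x\<^sup>2))) x :> (1 + x\<^sup>2) / (e * (1 - x\<^sup>2)\<^sup>2)"
      using ne e x by (auto intro!: derivative_eq_intros simp: power2_eq_square divide_simps) (simp add: algebra_simps)
    from DERIV_chain2[OF DERIV_arctan this]
    have "DERIV ?F x :> inverse (1 + (x / (e * (1 - x\<^sup>2)))\<^sup>2) * ((1 + x\<^sup>2) / (e * (1 - x\<^sup>2)\<^sup>2))" .
    moreover have "inverse (1 + (x / (e * (1 - x\<^sup>2)))\<^sup>2) * ((1 + x\<^sup>2) / (e * (1 - x\<^sup>2)\<^sup>2)) = ?f x"
    proof -
      define h where "h = 1 - x\<^sup>2"
      have h: "h > 0" "e * h \<noteq> 0" using x e by (simp_all add: h_def)
      have "1 + (x / (e * h))\<^sup>2 = (x\<^sup>2 + e\<^sup>2 * h\<^sup>2) / (e * h)\<^sup>2"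
        using h by (simp add: power_divide power_mult_distrib add_divide_distrib)
      moreover have "inverse (D / (e * h)\<^sup>2) * ((1 + x\<^sup>2) / (e * h\<^sup>2)) = e * (1 + x\<^sup>2) / D" for D
        using h e by (simp add: power2_eq_square divide_simps)
      ultimately have "inverse (1 + (x / (e * h))\<^sup>2) * ((1 + x\<^sup>2) / (e * h\<^sup>2)) = e * (1 + x\<^sup>2) / (x\<^sup>2 + e\<^sup>2 * h\<^sup>2)"
        by simp
      then show ?thesis by (simp add: rho_def h_def)
    qed
    ultimately show ?thesis by simp
  qed
  have c: "isCont ?f x" for x
    using rho_pos[of x] by (intro continuous_intros rho_continuous) auto
  have l: "(?F \<longlongrightarrow> pi / 2) (at_left 1)" "(?F \<longlongrightarrow> - (pi / 2)) (at_right (-1))"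
    using e by real_asymp+
  have f0: "AE x in lborel. ereal (-1) < ereal x \<longrightarrow> ereal x < ereal 1 \<longrightarrow> 0 \<le> ?f x"
    using rho_pos e one_plus_sq_pos by (intro always_eventually) (auto intro!: divide_nonneg_nonneg mult_nonneg_nonneg less_imp_le)
  have "(LBINT x=ereal (-1)..ereal 1. ?f x) = pi / 2 - - (pi / 2)"
    by (rule interval_integral_FTC_nonneg(2)[OF _ D c f0]) (use l in \<open>simp_all only: ereal_tendsto_simps, simp_all\<close>)
  then have "(LBINT x:{-1..1}. ?f x) = pi" by (subst (asm) interval_integral_Icc) auto
  moreover have "(LBINT x:{-1..1}. ?f x) = bubble_moment 0 + bubble_moment 2"
  proof -
    have "indicator {-1..1} x *\<^sub>R ?f x = indicator {-1..1} x * (e * x ^ 0 / rho x) + indicator {-1..1} x * (e * x ^ 2 / rho x)" for x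
      by (simp add: algebra_simps add_divide_distrib)
    then show ?thesis unfolding bubble_moment_def set_lebesgue_integral_def
      by (simp only: Bochner_Integration.integral_add[OF bubble_moment_integrable[OF bubble_moment_continuous] bubble_moment_integrable[OF bubble_moment_continuous]])
  qed
  ultimately show ?thesis by simp
qed

lemma bubble_moment_nonneg: "0 \<le> bubble_moment 0" "0 \<le> bubble_moment 2"
proof -
  have "0 \<le> indicator {-1..1} x * (e * x ^ 0 / rho x)" "0 \<le> indicator {-1..1} x * (e * x\<^sup>2 / rho x)" for x
    using e less_imp_le[OF rho_pos[of x]] by (auto intro!: mult_nonneg_nonneg divide_nonneg_nonneg)
  then show "0 \<le> bubble_moment 0" "0 \<le> bubble_moment 2"
    unfolding bubble_moment_def by (auto intro!: integral_nonneg_AE always_eventually)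
qed

lemma bubble_moment_2_bounds: "bubble_moment 2 \<le> 2 * e" "2 * e - pi * e\<^sup>2 \<le> bubble_moment 2"
proof -
  have i1: "integrable lborel (\<lambda>x::real. indicator {-1..1} x * e)" by (rule bubble_moment_integrable) simp
  have v1: "(\<integral>x. indicator {-1..1::real} x * e \<partial>lborel) = 2 * e" by simp
  have i2: "integrable lborel (\<lambda>x. indicator {-1..1} x * (e * x ^ 2 / rho x))" by (rule bubble_moment_integrable[OF bubble_moment_continuous])
  have i0: "integrable lborel (\<lambda>x. indicator {-1..1} x * (e * x ^ 0 / rho x))" by (rule bubble_moment_integrable[OF bubble_moment_continuous])
  have "bubble_moment 2 \<le> (\<integral>x. indicator {-1..1::real} x * e \<partial>lborel)" unfolding bubble_moment_def
  proof (intro integral_mono i1 i2 mult_left_mono)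
    fix x
    have "e * x\<^sup>2 \<le> e * rho x" using e by (intro mult_left_mono) (auto simp: rho_def)
    then show "e * x\<^sup>2 / rho x \<le> e" using rho_pos[of x] by (simp add: pos_divide_le_eq)
  qed simp
  then show "bubble_moment 2 \<le> 2 * e" unfolding v1 .
  have "(\<integral>x. indicator {-1..1} x * e - e\<^sup>2 * (indicator {-1..1} x * (e * x ^ 0 / rho x)) \<partial>lborel) \<le> bubble_moment 2"
    unfolding bubble_moment_def
  proof (intro integral_mono Bochner_Integration.integrable_diff integrable_mult_right i0 i1 i2)
    fix x :: real
    show "indicator {-1..1} x * e - e\<^sup>2 * (indicator {-1..1} x * (e * x ^ 0 / rho x)) \<le> indicator {-1..1} x * (e * x\<^sup>2 / rho x)"
    proof (cases "x \<in> {-1..1}")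
      case True
      then have "\<bar>x\<bar> \<le> 1" by (simp add: abs_le_iff)
      then have x: "x\<^sup>2 \<le> 1" by (simp add: abs_square_le_1)
      have "(1 - x\<^sup>2)\<^sup>2 \<le> 1" using x by (intro power_le_one) auto
      then have "e\<^sup>2 * (1 - x\<^sup>2)\<^sup>2 \<le> e\<^sup>2 * 1" by (intro mult_left_mono) auto
      then have "rho x \<le> x\<^sup>2 + e\<^sup>2" by (simp add: rho_def)
      then have "e * rho x \<le> e * (x\<^sup>2 + e\<^sup>2)" using e by (intro mult_left_mono) auto
      then have "e \<le> (e * (x\<^sup>2 + e\<^sup>2)) / rho x" using rho_pos[of x] by (simp add: pos_le_divide_eq)
      also have "\<dots> = e * x\<^sup>2 / rho x + e\<^sup>2 * (e / rho x)" by (simp add: add_divide_distrib distrib_left mult.commute)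
      finally show ?thesis using True by simp
    qed simp
  qed
  also have "(\<integral>x. indicator {-1..1} x * e - e\<^sup>2 * (indicator {-1..1} x * (e * x ^ 0 / rho x)) \<partial>lborel) = 2 * e - e\<^sup>2 * bubble_moment 0"
    unfolding bubble_moment_def using i0 i1 v1 by (simp only: Bochner_Integration.integral_diff integrable_mult_right integral_mult_right_zero)
  finally have "2 * e - e\<^sup>2 * bubble_moment 0 \<le> bubble_moment 2" .
  moreover have "e\<^sup>2 * bubble_moment 0 \<le> e\<^sup>2 * pi" using bubble_moment_0_2 bubble_moment_nonneg by (intro mult_left_mono) auto
  ultimately show "2 * e - pi * e\<^sup>2 \<le> bubble_moment 2" by (simp add: mult.commute)
qed

lemma exterior_kernel_integral:
  assumes x: "\<bar>x\<bar> < 1"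
  shows "(\<integral>\<^sup>+y. ennreal (1 / (x - y)\<^sup>2) * indicator {y. 1 \<le> \<bar>y\<bar>} y \<partial>lborel) = ennreal (2 / (1 - x\<^sup>2))"
proof -
  have right: "(\<integral>\<^sup>+y. ennreal (1 / (y - x)\<^sup>2) * indicator {1..} y \<partial>lborel) = ennreal (1 / (1 - x))" if x: "\<bar>x\<bar> < 1" for x :: real
  proof -
    have "(\<integral>\<^sup>+y. ennreal (1 / (y - x)\<^sup>2) * indicator {1..} y \<partial>lborel) = 0 - (- 1 / (1 - x))"
    proof (rule nn_integral_FTC_atLeast[where F = "\<lambda>y. - 1 / (y - x)" and T = 0])
      show "DERIV (\<lambda>y. - 1 / (y - x)) y :> 1 / (y - x)\<^sup>2" if "1 \<le> y" for y
        using that x by (auto intro!: derivative_eq_intros simp: power2_eq_square)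
      show "((\<lambda>y. - 1 / (y - x)) \<longlongrightarrow> 0) at_top" by real_asymp
    qed auto
    then show ?thesis by simp
  qed
  have "(\<integral>\<^sup>+y. ennreal (1 / (x - y)\<^sup>2) * indicator {y. 1 \<le> \<bar>y\<bar>} y \<partial>lborel) =
     (\<integral>\<^sup>+y. ennreal (1 / (y - x)\<^sup>2) * indicator {1..} y + ennreal (1 / (x - y)\<^sup>2) * indicator {..-1} y \<partial>lborel)"
    by (intro nn_integral_cong) (auto simp: indicator_def power2_commute)
  also have "\<dots> = (\<integral>\<^sup>+y. ennreal (1 / (y - x)\<^sup>2) * indicator {1..} y \<partial>lborel) +
     (\<integral>\<^sup>+y. ennreal (1 / (x - y)\<^sup>2) * indicator {..-1} y \<partial>lborel)"
    by (intro nn_integral_add) measurable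
  also have "(\<integral>\<^sup>+y. ennreal (1 / (x - y)\<^sup>2) * indicator {..-1} y \<partial>lborel) =
     ennreal \<bar>-1\<bar> * (\<integral>\<^sup>+y. ennreal (1 / (x - (0 + (-1) * y))\<^sup>2) * indicator {..-1} (0 + (-1) * y) \<partial>lborel)"
    by (rule nn_integral_real_affine) measurable
  also have "\<dots> = (\<integral>\<^sup>+y. ennreal (1 / (y - (- x))\<^sup>2) * indicator {1..} y \<partial>lborel)"
  proof -
    have "ennreal (1 / (x - (0 + (-1) * y))\<^sup>2) * indicator {..-1} (0 + (-1) * y) =
        ennreal (1 / (y - (- x))\<^sup>2) * indicator {1..} y" for y
      by (auto simp: indicator_def add.commute)
    then show ?thesis by (simp only:) simp
  qed
  also have "\<dots> = ennreal (1 / (1 - (- x)))" using x by (intro right) simp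
  also have "(\<integral>\<^sup>+y. ennreal (1 / (y - x)\<^sup>2) * indicator {1..} y \<partial>lborel) = ennreal (1 / (1 - x))" by (rule right[OF x])
  also have "ennreal (1 / (1 - x)) + ennreal (1 / (1 - - x)) = ennreal (1 / (1 - x) + 1 / (1 - - x))"
    using x by (intro ennreal_plus[symmetric]) auto
  also have "1 / (1 - x) + 1 / (1 - - x) = 2 / (1 - x\<^sup>2)"
  proof -
    have "1 - x \<noteq> 0" "1 + x \<noteq> 0" "1 - x\<^sup>2 \<noteq> 0" using x by (auto simp: abs_square_eq_1 power2_eq_1_iff)
    moreover have "1 - x\<^sup>2 = (1 - x) * (1 + x)" by (simp add: power2_eq_square algebra_simps)
    ultimately show ?thesis by (simp add: divide_simps)
  qed
  finally show ?thesis .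
qed

text \<open>Only pairs with at least one point inside contribute. For two inner points,
  \<open>x hat y - y hat x = (x - y) (1 + x y)\<close> cancels the denominator.\<close>

lemma bubble_kernel_le:
  fixes x y :: real
  defines "a \<equiv> \<lambda>x. indicator {-1..1} x * (e / rho x)"
    and "c \<equiv> \<lambda>x. indicator {-1<..<1} x * (4 * e\<^sup>2 * (1 - x\<^sup>2)\<^sup>2 / rho x)"
    and "K \<equiv> \<lambda>x y. ennreal (1 / (x - y)\<^sup>2) * indicator {y. 1 \<le> \<bar>y\<bar>} y"
  shows "ennreal ((cmod (bubble e x - bubble e y))\<^sup>2 / (x - y)\<^sup>2) \<le>
    ennreal (4 * (a x * (a y * (1 + x * y)\<^sup>2))) + ennreal (c x) * K x y + ennreal (c y) * K y x"
proof -
  have c0: "0 \<le> c x" for x using rho_pos[of x] by (simp add: c_def)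
  have mixed: "ennreal ((cmod (bubble e x - bubble e y))\<^sup>2 / (x - y)\<^sup>2) \<le> ennreal (c x) * K x y"
    if x: "\<bar>x\<bar> \<le> 1" and y: "1 < \<bar>y\<bar>" for x y
  proof -
    have y0: "y\<^sup>2 > 0" using y by auto
    have "(cmod (bubble e x - bubble e y))\<^sup>2 = 4 * e\<^sup>2 * (y * hat x)\<^sup>2 / ((x\<^sup>2 + e\<^sup>2 * (hat x)\<^sup>2) * y\<^sup>2)"
      unfolding bubble_diff_sq[OF e(1)] using y by (simp add: hat_outside)
    also have "\<dots> = 4 * e\<^sup>2 * (1 - x\<^sup>2)\<^sup>2 / rho x"
      unfolding rho_def hat_inside[OF x] using y0 by (simp add: power_mult_distrib)
    also have "\<dots> = c x"
      using x by (auto simp: c_def indicator_def abs_le_iff not_less power2_eq_1_iff)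
    finally have eq: "(cmod (bubble e x - bubble e y))\<^sup>2 / (x - y)\<^sup>2 = c x * (1 / (x - y)\<^sup>2)" by simp
    show ?thesis unfolding eq K_def ennreal_mult'[OF c0[of x]] using y by simp
  qed
  consider "\<bar>x\<bar> \<le> 1" "\<bar>y\<bar> \<le> 1" | "\<bar>x\<bar> \<le> 1" "1 < \<bar>y\<bar>" | "1 < \<bar>x\<bar>" "\<bar>y\<bar> \<le> 1" | "1 < \<bar>x\<bar>" "1 < \<bar>y\<bar>"
    by linarith
  then show ?thesis
  proof cases
    case 1
    have "(cmod (bubble e x - bubble e y))\<^sup>2 / (x - y)\<^sup>2 \<le> 4 * (a x * (a y * (1 + x * y)\<^sup>2))"
    proof (cases "x = y")
      case True
      then show ?thesis using e rho_pos by (simp add: a_def less_imp_le)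
    next
      case False
      have "x * hat y - y * hat x = (x - y) * (1 + x * y)"
        using 1 by (simp add: hat_inside power2_eq_square algebra_simps)
      then have "(cmod (bubble e x - bubble e y))\<^sup>2 = 4 * e\<^sup>2 * ((x - y) * (1 + x * y))\<^sup>2 / (rho x * rho y)"
        unfolding bubble_diff_sq[OF e(1)] rho_def using 1 by (simp add: hat_inside)
      moreover have "a x = e / rho x" "a y = e / rho y" using 1 by (auto simp: a_def indicator_def abs_le_iff)
      ultimately show ?thesis using False by (simp add: power_mult_distrib power2_eq_square)
    qed
    then have "ennreal ((cmod (bubble e x - bubble e y))\<^sup>2 / (x - y)\<^sup>2) \<le> ennreal (4 * (a x * (a y * (1 + x * y)\<^sup>2)))"
      by (rule ennreal_leI)
    then show ?thesis by (simp add: add.assoc add_increasing2)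
  next
    case 2
    then show ?thesis using mixed[of x y] by (simp add: add.assoc add_increasing add_increasing2)
  next
    case 3
    then show ?thesis using mixed[of y x]
      by (simp add: norm_minus_commute power2_commute[of y x] add_increasing)
  next
    case 4
    then show ?thesis by (simp add: bubble_outside)
  qed
qed

text \<open>Pairs of inner points contribute \<open>4 (m\<^sub>0\<^sup>2 + 2 m\<^sub>1\<^sup>2 + m\<^sub>2\<^sup>2)\<close> in terms of the moments \<open>m\<^sub>k\<close>, and \<open>m\<^sub>1 = 0\<close> by symmetry. For mixed pairs the outer point is
  integrated first, by \<open>exterior_kernel_integral\<close>.\<close>

lemma gagliardo_bubble_le: "gagliardo_sq (bubble e) \<le> ennreal (4 * (bubble_moment 0)\<^sup>2 + 4 * (bubble_moment 2)\<^sup>2 + 16 * e * (bubble_moment 0 - bubble_moment 2))"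
proof -
  define a where "a x = indicator {-1..1} x * (e / rho x)" for x
  define c where "c x = indicator {-1<..<1} x * (4 * e\<^sup>2 * (1 - x\<^sup>2)\<^sup>2 / rho x)" for x
  define K where "K x y = ennreal (1 / (x - y)\<^sup>2) * indicator {y. 1 \<le> \<bar>y\<bar>} y" for x y :: real
  have am [measurable]: "a \<in> borel_measurable borel" unfolding a_def[abs_def] by measurable
  have cm [measurable]: "c \<in> borel_measurable borel" unfolding c_def[abs_def] by measurable
  have Km [measurable]: "(\<lambda>p. K (fst p) (snd p)) \<in> borel_measurable (lborel \<Otimes>\<^sub>M lborel)"
    "(\<lambda>p. K (snd p) (fst p)) \<in> borel_measurable (lborel \<Otimes>\<^sub>M lborel)"
    unfolding K_def by measurable
  have a0: "0 \<le> a x" for x using e less_imp_le[OF rho_pos[of x]] by (simp add: a_def)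
  have J: "integrable lborel (\<lambda>x. a x * x ^ k)" "(\<integral>x. a x * x ^ k \<partial>lborel) = bubble_moment k" for k
  proof -
    have eq: "a x * x ^ k = indicator {-1..1} x * (e * x ^ k / rho x)" for x by (simp add: a_def)
    show "integrable lborel (\<lambda>x. a x * x ^ k)" unfolding eq by (rule bubble_moment_integrable[OF bubble_moment_continuous])
    show "(\<integral>x. a x * x ^ k \<partial>lborel) = bubble_moment k" unfolding eq bubble_moment_def ..
  qed
  let ?F1 = "\<lambda>x y. ennreal (4 * (a x * (a y * (1 + x * y)\<^sup>2)))"
  let ?F2 = "\<lambda>x y. ennreal (c x) * K x y"
  have A1: "(\<integral>\<^sup>+x. (\<integral>\<^sup>+y. ?F1 x y \<partial>lborel) \<partial>lborel) = ennreal (4 * (bubble_moment 0)\<^sup>2 + 4 * (bubble_moment 2)\<^sup>2)"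
  proof -
    have "(\<integral>\<^sup>+y. ?F1 x y \<partial>lborel) = ennreal (4 * a x * (bubble_moment 0 + x\<^sup>2 * bubble_moment 2))" for x
    proof -
      have eq: "4 * (a x * (a y * (1 + x * y)\<^sup>2)) = 4 * a x * (a y * y ^ 0 + 2 * x * (a y * y ^ 1) + x\<^sup>2 * (a y * y ^ 2))" for y
        by (simp add: power2_eq_square algebra_simps)
      have i: "integrable lborel (\<lambda>y. 4 * (a x * (a y * (1 + x * y)\<^sup>2)))"
        unfolding eq by (intro integrable_mult_right Bochner_Integration.integrable_add J(1))
      have "(\<integral>\<^sup>+y. ?F1 x y \<partial>lborel) = ennreal (\<integral>y. 4 * (a x * (a y * (1 + x * y)\<^sup>2)) \<partial>lborel)"
        by (rule nn_integral_eq_integral[OF i]) (simp add: a0)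
      also have "(\<integral>y. 4 * (a x * (a y * (1 + x * y)\<^sup>2)) \<partial>lborel) = 4 * a x * (bubble_moment 0 + 2 * x * bubble_moment 1 + x\<^sup>2 * bubble_moment 2)"
        unfolding eq J(2)[symmetric]
        by (simp only: integral_mult_right_zero Bochner_Integration.integral_add
            Bochner_Integration.integrable_add integrable_mult_right J(1))
      finally show ?thesis using bubble_moment_1 by simp
    qed
    then have "(\<integral>\<^sup>+x. (\<integral>\<^sup>+y. ?F1 x y \<partial>lborel) \<partial>lborel) = (\<integral>\<^sup>+x. ennreal (4 * a x * (bubble_moment 0 + x\<^sup>2 * bubble_moment 2)) \<partial>lborel)"
      by simp
    also have "\<dots> = ennreal (\<integral>x. 4 * bubble_moment 0 * (a x * x ^ 0) + 4 * bubble_moment 2 * (a x * x ^ 2) \<partial>lborel)"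
    proof -
      have eq: "4 * a x * (bubble_moment 0 + x\<^sup>2 * bubble_moment 2) = 4 * bubble_moment 0 * (a x * x ^ 0) + 4 * bubble_moment 2 * (a x * x ^ 2)" for x
        by (simp add: algebra_simps)
      show ?thesis unfolding eq using a0 bubble_moment_nonneg
        by (intro nn_integral_eq_integral Bochner_Integration.integrable_add integrable_mult_right J(1)) auto
    qed
    also have "(\<integral>x. 4 * bubble_moment 0 * (a x * x ^ 0) + 4 * bubble_moment 2 * (a x * x ^ 2) \<partial>lborel) = 4 * (bubble_moment 0)\<^sup>2 + 4 * (bubble_moment 2)\<^sup>2"
      by (simp only: integral_mult_right_zero Bochner_Integration.integral_add integrable_mult_right J)
         (simp add: power2_eq_square)
    finally show ?thesis .
  qed
  have A2: "(\<integral>\<^sup>+x. (\<integral>\<^sup>+y. ?F2 x y \<partial>lborel) \<partial>lborel) \<le> ennreal (8 * e * (bubble_moment 0 - bubble_moment 2))"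
  proof -
    have inner: "(\<integral>\<^sup>+y. ?F2 x y \<partial>lborel) \<le> ennreal (8 * e * (a x * x ^ 0 - a x * x ^ 2))" for x
    proof (cases "\<bar>x\<bar> < 1")
      case True
      then have x: "0 < 1 - x\<^sup>2" by (simp add: abs_square_less_1)
      have "(\<integral>\<^sup>+y. ?F2 x y \<partial>lborel) = ennreal (c x) * (\<integral>\<^sup>+y. K x y \<partial>lborel)"
        unfolding K_def by (intro nn_integral_cmult) measurable
      also have "\<dots> = ennreal (c x * (2 / (1 - x\<^sup>2)))"
        unfolding K_def exterior_kernel_integral[OF True]
        using less_imp_le[OF rho_pos[of x]] by (intro ennreal_mult''[symmetric]) (use x in auto)
      also have "c x * (2 / (1 - x\<^sup>2)) = 8 * e * (a x * x ^ 0 - a x * x ^ 2)"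
      proof -
        have "c x = 4 * e\<^sup>2 * (1 - x\<^sup>2)\<^sup>2 / rho x" "a x = e / rho x"
          using True by (auto simp: c_def a_def indicator_def abs_less_iff)
        moreover have "(1 - x\<^sup>2)\<^sup>2 = (1 - x\<^sup>2) * (1 - x\<^sup>2)" by (simp add: power2_eq_square)
        moreover have "a x * x ^ 0 - a x * x ^ 2 = a x * (1 - x\<^sup>2)" by (simp add: algebra_simps)
        ultimately show ?thesis using x by (simp add: power2_eq_square[of e])
      qed
      finally show ?thesis by simp
    next
      case False
      then have "c x = 0" by (auto simp: c_def indicator_def)
      then show ?thesis by simp
    qed
    have nn: "0 \<le> 8 * e * (a x * x ^ 0 - a x * x ^ 2)" for x
    proof (cases "x \<in> {-1..1}")
      case True
      then have "\<bar>x\<bar> \<le> 1" by (simp add: abs_le_iff)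
      then have "a x * x\<^sup>2 \<le> a x * 1" using a0[of x] by (intro mult_left_mono) (simp_all add: abs_square_le_1)
      then show ?thesis using e by simp
    qed (simp add: a_def)
    have "(\<integral>\<^sup>+x. (\<integral>\<^sup>+y. ?F2 x y \<partial>lborel) \<partial>lborel) \<le> (\<integral>\<^sup>+x. ennreal (8 * e * (a x * x ^ 0 - a x * x ^ 2)) \<partial>lborel)"
      by (intro nn_integral_mono inner)
    also have "\<dots> = ennreal (\<integral>x. 8 * e * (a x * x ^ 0 - a x * x ^ 2) \<partial>lborel)"
      using nn by (intro nn_integral_eq_integral integrable_mult_right Bochner_Integration.integrable_diff J(1)) auto
    also have "(\<integral>x. 8 * e * (a x * x ^ 0 - a x * x ^ 2) \<partial>lborel) = 8 * e * (bubble_moment 0 - bubble_moment 2)"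
      by (simp only: integral_mult_right_zero Bochner_Integration.integral_diff J)
    finally show ?thesis .
  qed
  have A3: "(\<integral>\<^sup>+x. (\<integral>\<^sup>+y. ?F2 y x \<partial>lborel) \<partial>lborel) = (\<integral>\<^sup>+x. (\<integral>\<^sup>+y. ?F2 x y \<partial>lborel) \<partial>lborel)"
    by (rule lborel_pair.Fubini') (simp add: case_prod_beta)
  have Fm [measurable]: "(\<lambda>p. ?F1 (fst p) (snd p)) \<in> borel_measurable (lborel \<Otimes>\<^sub>M lborel)"
    "(\<lambda>p. ?F2 (fst p) (snd p)) \<in> borel_measurable (lborel \<Otimes>\<^sub>M lborel)"
    "(\<lambda>p. ?F2 (snd p) (fst p)) \<in> borel_measurable (lborel \<Otimes>\<^sub>M lborel)"
    by measurable
  have m1: "?F1 x \<in> borel_measurable lborel" "?F2 x \<in> borel_measurable lborel" "(\<lambda>y. ?F2 y x) \<in> borel_measurable lborel" for x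
    using measurable_Pair2[OF Fm(1), of x] measurable_Pair2[OF Fm(2), of x] measurable_Pair2[OF Fm(3), of x] by simp_all
  have m2: "(\<lambda>x. \<integral>\<^sup>+y. ?F1 x y \<partial>lborel) \<in> borel_measurable lborel"
    "(\<lambda>x. \<integral>\<^sup>+y. ?F2 x y \<partial>lborel) \<in> borel_measurable lborel"
    "(\<lambda>x. \<integral>\<^sup>+y. ?F2 y x \<partial>lborel) \<in> borel_measurable lborel"
    using lborel.borel_measurable_nn_integral_fst[OF Fm(1)] lborel.borel_measurable_nn_integral_fst[OF Fm(2)]
      lborel.borel_measurable_nn_integral_fst[OF Fm(3)] by simp_all
  have "gagliardo_sq (bubble e) = (\<integral>\<^sup>+x. (\<integral>\<^sup>+y. ennreal ((cmod (bubble e x - bubble e y))\<^sup>2 / (x - y)\<^sup>2) \<partial>lborel) \<partial>lborel)"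
    unfolding gagliardo_sq_def nn_integral_completion ..
  also have "\<dots> \<le> (\<integral>\<^sup>+x. (\<integral>\<^sup>+y. ?F1 x y + ?F2 x y + ?F2 y x \<partial>lborel) \<partial>lborel)"
    unfolding a_def c_def K_def by (intro nn_integral_mono bubble_kernel_le)
  also have "\<dots> = (\<integral>\<^sup>+x. (\<integral>\<^sup>+y. ?F1 x y \<partial>lborel) + (\<integral>\<^sup>+y. ?F2 x y \<partial>lborel) + (\<integral>\<^sup>+y. ?F2 y x \<partial>lborel) \<partial>lborel)"
    using m1 by (simp add: nn_integral_add)
  also have "\<dots> = (\<integral>\<^sup>+x. (\<integral>\<^sup>+y. ?F1 x y \<partial>lborel) \<partial>lborel) + (\<integral>\<^sup>+x. (\<integral>\<^sup>+y. ?F2 x y \<partial>lborel) \<partial>lborel)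
     + (\<integral>\<^sup>+x. (\<integral>\<^sup>+y. ?F2 y x \<partial>lborel) \<partial>lborel)"
    using m2 by (simp add: nn_integral_add)
  also have "\<dots> \<le> ennreal (4 * (bubble_moment 0)\<^sup>2 + 4 * (bubble_moment 2)\<^sup>2) + ennreal (8 * e * (bubble_moment 0 - bubble_moment 2)) + ennreal (8 * e * (bubble_moment 0 - bubble_moment 2))"
    unfolding A1 A3 by (intro add_mono A2 order_refl)
  also have "\<dots> = ennreal (4 * (bubble_moment 0)\<^sup>2 + 4 * (bubble_moment 2)\<^sup>2 + 16 * e * (bubble_moment 0 - bubble_moment 2))"
  proof -
    have "0 \<le> bubble_moment 0 - bubble_moment 2"
    proof -
      have "bubble_moment 2 \<le> bubble_moment 0" unfolding J(2)[symmetric]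
      proof (intro integral_mono J(1))
        fix x :: real
        show "a x * x ^ 2 \<le> a x * x ^ 0"
        proof (cases "x \<in> {-1..1}")
          case True
          then have "\<bar>x\<bar> \<le> 1" by (simp add: abs_le_iff)
          then show ?thesis using a0[of x] by (intro mult_left_mono) (simp_all add: abs_square_le_1)
        qed (simp add: a_def)
      qed
      then show ?thesis by simp
    qed
    then have "0 \<le> 8 * e * (bubble_moment 0 - bubble_moment 2)" using e by simp
    then show ?thesis by (simp add: ennreal_plus[symmetric] del: ennreal_plus)
  qed
  finally show ?thesis .
qed

text \<open>Since \<open>m\<^sub>0 = \<pi> - m\<^sub>2\<close> and \<open>m\<^sub>2 = 2 e + O(e\<^sup>2)\<close>, the terms of first order cancel in
  \<open>4 m\<^sub>0\<^sup>2 + 16 e (m\<^sub>0 - m\<^sub>2) = 4 \<pi>\<^sup>2 - 16 \<pi> e + 16 \<pi> e + O(e\<^sup>2)\<close>.\<close>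

lemma dirichlet_bubble_le: "line.dirichlet (bubble e) \<le> 1 + 3 * e\<^sup>2"
proof -
  note cm = bubble_circle_map(1)[OF e]
  let ?d = "line.dirichlet (bubble e)"
  have m: "bubble e \<in> borel_measurable lebesgue"
    using line.circle_mapD(3)[OF cm] by (simp add: borel_measurable_cauchy)
  have "(\<integral>\<^sup>+p. ennreal (line.quot (bubble e) p) \<partial>line.N) = ennreal ?d"
    unfolding line.dirichlet_def
    by (rule nn_integral_eq_integral[OF line.circle_mapD(4)[OF cm]]) (simp add: line.quot_nonneg)
  then have le1: "ennreal (4 * pi\<^sup>2 * ?d) \<le> ennreal (4 * (bubble_moment 0)\<^sup>2 + 4 * (bubble_moment 2)\<^sup>2 + 16 * e * (bubble_moment 0 - bubble_moment 2))"
    using gagliardo_bubble_le unfolding gagliardo_eq[OF m] by (simp add: ennreal_mult line.dirichlet_nonneg)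
  define j where "j = bubble_moment 2"
  have j: "j \<le> 2 * e" "2 * e - pi * e\<^sup>2 \<le> j" "0 \<le> j" and J0: "bubble_moment 0 = pi - j"
    using bubble_moment_2_bounds bubble_moment_nonneg bubble_moment_0_2 by (auto simp: j_def)
  have T: "4 * (bubble_moment 0)\<^sup>2 + 4 * (bubble_moment 2)\<^sup>2 + 16 * e * (bubble_moment 0 - bubble_moment 2) = 4 * pi\<^sup>2 - 8 * pi * j + 8 * j\<^sup>2 + 16 * e * pi - 32 * e * j"
    unfolding J0 j_def[symmetric] by (simp add: power2_eq_square algebra_simps)
  have le2: "4 * pi\<^sup>2 - 8 * pi * j + 8 * j\<^sup>2 + 16 * e * pi - 32 * e * j \<le> 4 * pi\<^sup>2 * (1 + 3 * e\<^sup>2)"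
  proof -
    have "8 * pi * (2 * e - pi * e\<^sup>2) \<le> 8 * pi * j" using j by (intro mult_left_mono) auto
    moreover have "j\<^sup>2 \<le> (2 * e)\<^sup>2" using j by (intro power_mono) auto
    moreover have "0 \<le> 32 * e * j" using j e by simp
    moreover have "8 * e\<^sup>2 \<le> pi\<^sup>2 * e\<^sup>2"
    proof (rule mult_right_mono)
      have "3\<^sup>2 \<le> pi\<^sup>2" using pi_gt3 by (intro power_mono) auto
      then show "8 \<le> pi\<^sup>2" by simp
    qed simp
    ultimately show ?thesis by (simp add: power_mult_distrib algebra_simps power2_eq_square[of pi])
  qed
  have "4 * pi\<^sup>2 * ?d \<le> 4 * pi\<^sup>2 * (1 + 3 * e\<^sup>2)"
  proof -
    have "0 \<le> 4 * pi\<^sup>2 * (1 + 3 * e\<^sup>2)" by simp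
    moreover have "ennreal (4 * pi\<^sup>2 * ?d) \<le> ennreal (4 * pi\<^sup>2 * (1 + 3 * e\<^sup>2))"
      using le1 ennreal_leI[OF le2] unfolding T by (rule order_trans)
    ultimately show ?thesis by (simp only: ennreal_le_iff)
  qed
  then show ?thesis by simp
qed

end

context circle_space
begin

text \<open>The mean square distance to a constant controls the mean square difference of two independent values, which does not depend
  on the constant and is positive for a non-constant map.\<close>

lemma mean_square_deviation_lower_bound:
  assumes u: "circle_map u" and A [measurable]: "A \<in> sets M"
    and nc: "\<not> (\<exists>c. AE x in M. x \<in> A \<longrightarrow> u x = c)"
  obtains \<kappa> where "\<kappa> > 0" "\<And>c. \<kappa> \<le> (\<integral>x. indicator A x * (cmod (c - u x))\<^sup>2 \<partial>M)"
proof -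
  note [measurable] = circle_mapD(3)[OF u]
  define G where "G p = indicator A (fst p) * (indicator A (snd p) * (cmod (u (fst p) - u (snd p)))\<^sup>2)" for p
  have Gm [measurable]: "G \<in> borel_measurable N" unfolding G_def[abs_def] by measurable
  have G0: "0 \<le> G p" for p by (simp add: G_def)
  have sq: "(cmod (c - u x))\<^sup>2 \<le> (cmod c + 1)\<^sup>2" for c x
    using norm_triangle_ineq4[of c "u x"] circle_mapD(5)[OF u, of x] by (intro power_mono) auto
  have iG: "integrable N G"
  proof (rule integrable_pairI[of _ 4])
    show "norm (G p) \<le> 4" for p
      using sq[of "u (fst p)" "snd p"] circle_mapD(5)[OF u, of "fst p"]
      by (simp add: G_def indicator_def)
  qed measurable
  have le: "(\<integral>p. G p \<partial>N) \<le> 4 * (\<integral>x. indicator A x * (cmod (c - u x))\<^sup>2 \<partial>M)" for c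
  proof -
    let ?f = "\<lambda>x. indicator A x * (cmod (c - u x))\<^sup>2"
    have fb: "norm (?f x) \<le> (cmod c + 1)\<^sup>2" for x using sq[of c x] by (simp add: indicator_def)
    have i1: "integrable N (\<lambda>p. ?f (fst p))" and i2: "integrable N (\<lambda>p. ?f (snd p))"
      by (rule integrable_pairI[OF _ fb], measurable)+
    have e1: "(\<integral>p. ?f (fst p) \<partial>N) = (\<integral>x. ?f x \<partial>M)" and e2: "(\<integral>p. ?f (snd p) \<partial>N) = (\<integral>x. ?f x \<partial>M)"
      using P.integral_fst'[OF i1] P.integral_fst'[OF i2] by (simp_all add: prob_space)
    have "G p \<le> 2 * ?f (fst p) + 2 * ?f (snd p)" for p
    proof (cases "fst p \<in> A \<and> snd p \<in> A")
      case True
      have "cmod (u (fst p) - u (snd p)) \<le> cmod (c - u (fst p)) + cmod (c - u (snd p))"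
        using norm_triangle_ineq4[of "c - u (snd p)" "c - u (fst p)"] by simp
      then have "(cmod (u (fst p) - u (snd p)))\<^sup>2 \<le> (cmod (c - u (fst p)) + cmod (c - u (snd p)))\<^sup>2"
        by (intro power_mono) auto
      also have "\<dots> \<le> 2 * (cmod (c - u (fst p)))\<^sup>2 + 2 * (cmod (c - u (snd p)))\<^sup>2"
        using zero_le_power2[of "cmod (c - u (fst p)) - cmod (c - u (snd p))"]
        by (simp add: power2_sum power2_diff)
      finally show ?thesis using True by (simp add: G_def)
    qed (auto simp: G_def indicator_def)
    then have "(\<integral>p. G p \<partial>N) \<le> (\<integral>p. 2 * ?f (fst p) + 2 * ?f (snd p) \<partial>N)"
      by (intro integral_mono iG Bochner_Integration.integrable_add integrable_mult_right i1 i2)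
    also have "\<dots> = 2 * (\<integral>p. ?f (fst p) \<partial>N) + 2 * (\<integral>p. ?f (snd p) \<partial>N)"
      by (simp only: Bochner_Integration.integral_add integral_mult_right_zero integrable_mult_right i1 i2)
    finally show ?thesis unfolding e1 e2 by simp
  qed
  have "(\<integral>p. G p \<partial>N) \<noteq> 0"
  proof
    assume "(\<integral>p. G p \<partial>N) = 0"
    then have "AE p in N. G p = 0" using integral_nonneg_eq_0_iff_AE[OF iG] G0 by simp
    then have ae: "AE x in M. AE y in M. G (x, y) = 0" by (rule P.AE_pair)
    show False
    proof (cases "AE x in M. x \<notin> A")
      case True
      then have "AE x in M. x \<in> A \<longrightarrow> u x = 0" by eventually_elim simp
      then show False using nc by blast
    next
      case False
      have "\<exists>x. x \<in> A \<and> (AE y in M. G (x, y) = 0)"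
      proof (rule ccontr)
        assume "\<nexists>x. x \<in> A \<and> (AE y in M. G (x, y) = 0)"
        then have no: "\<not> (AE y in M. G (x, y) = 0) \<or> x \<notin> A" for x by blast
        have "AE x in M. x \<notin> A" using ae by (rule eventually_mono) (use no in blast)
        then show False using False by blast
      qed
      then obtain x where x: "x \<in> A" "AE y in M. G (x, y) = 0" by blast
      have "AE y in M. y \<in> A \<longrightarrow> u y = u x"
        using x(2) by eventually_elim (use x(1) in \<open>auto simp: G_def\<close>)
      then show False using nc by blast
    qed
  qed
  moreover have "0 \<le> (\<integral>p. G p \<partial>N)" using G0 by (intro integral_nonneg_AE) auto
  ultimately show thesis using le by (intro that[of "(\<integral>p. G p \<partial>N) / 4"]) (auto simp: field_simps)
qed

end

section \<open>The interaction of the bubble with the boundary data\<close>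

lemma bubble_far_from_1:
  assumes e: "0 < e" "e \<le> 1 / 2" and x: "\<bar>x\<bar> < e" and y: "1 \<le> \<bar>y\<bar>"
  shows "1 \<le> (cmod (bubble e x - bubble e y))\<^sup>2"
proof -
  have y0: "y\<^sup>2 > 0" using y by auto
  have x2: "x\<^sup>2 \<le> e\<^sup>2" using x by (simp add: abs_le_square_iff[symmetric])
  have "e\<^sup>2 \<le> (1/2)\<^sup>2" using e by (intro power_mono) auto
  then have "3 / 4 \<le> hat x" unfolding hat_def using x2 by (simp add: power2_eq_square)
  then have "(3 / 4)\<^sup>2 \<le> (hat x)\<^sup>2" by (intro power_mono) auto
  then have 1: "e\<^sup>2 * (9 / 16) \<le> e\<^sup>2 * (hat x)\<^sup>2" by (intro mult_left_mono) (auto simp: power2_eq_square)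
  have "(hat x)\<^sup>2 \<le> 1" using hat_nonneg[of x] hat_le_1[of x] by (simp add: power_le_one)
  then have 2: "e\<^sup>2 * (hat x)\<^sup>2 \<le> e\<^sup>2 * 1" by (intro mult_left_mono) auto
  have pos: "0 < x\<^sup>2 + e\<^sup>2 * (hat x)\<^sup>2"
  proof -
    have "0 < e\<^sup>2" using e by simp
    then have "0 < e\<^sup>2 * (hat x)\<^sup>2" using 1 by linarith
    then show ?thesis by (simp add: add_nonneg_pos)
  qed
  have "(cmod (bubble e x - bubble e y))\<^sup>2 = 4 * e\<^sup>2 * (y * hat x)\<^sup>2 / ((x\<^sup>2 + e\<^sup>2 * (hat x)\<^sup>2) * y\<^sup>2)"
    unfolding bubble_diff_sq[OF e(1)] using y by (simp add: hat_outside)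
  also have "\<dots> = 4 * (e\<^sup>2 * (hat x)\<^sup>2) / (x\<^sup>2 + e\<^sup>2 * (hat x)\<^sup>2)"
    using y0 by (simp add: power_mult_distrib)
  also have "1 \<le> \<dots>" using pos x2 1 2 by (simp add: pos_le_divide_eq)
  finally show ?thesis .
qed

lemma cauchy_interval:
  assumes e: "0 < e" "e \<le> 1"
  shows "e / pi \<le> measure cauchy_measure {-e<..<e}"
proof -
  have "ennreal (1 / (2 * pi)) * emeasure lebesgue {-e<..<e} = (\<integral>\<^sup>+x. ennreal (1 / (2 * pi)) * indicator {-e<..<e} x \<partial>lebesgue)"
    by (subst nn_integral_cmult_indicator) auto
  also have "\<dots> \<le> (\<integral>\<^sup>+x. ennreal (1 / (pi * (1 + x\<^sup>2))) * indicator {-e<..<e} x \<partial>lebesgue)"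
  proof (intro nn_integral_mono)
    fix x :: real
    show "ennreal (1 / (2 * pi)) * indicator {-e<..<e} x \<le> ennreal (1 / (pi * (1 + x\<^sup>2))) * indicator {-e<..<e} x"
    proof (cases "x \<in> {-e<..<e}")
      case True
      then have "\<bar>x\<bar> \<le> 1" using e by auto
      then have "x\<^sup>2 \<le> 1" by (simp add: abs_square_le_1)
      then have "pi * (1 + x\<^sup>2) \<le> pi * 2" by (intro mult_left_mono) auto
      then have "1 / (2 * pi) \<le> 1 / (pi * (1 + x\<^sup>2))"
        using one_plus_sq_pos[of x] by (intro divide_left_mono mult_pos_pos) (auto simp: mult.commute)
      then show ?thesis using True by (simp add: ennreal_leI)
    qed simp
  qed
  also have "\<dots> = emeasure cauchy_measure {-e<..<e}"
    unfolding cauchy_measure_def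
    by (intro emeasure_density[symmetric] measurable_compose[OF cauchy_density_lebesgue measurable_ennreal]) auto
  also have "\<dots> = ennreal (measure cauchy_measure {-e<..<e})" by (rule line.emeasure_eq_measure)
  finally have "ennreal (1 / (2 * pi)) * emeasure lebesgue {-e<..<e} \<le> ennreal (measure cauchy_measure {-e<..<e})" .
  moreover have "emeasure lebesgue {-e<..<e} = ennreal (2 * e)" using e by simp
  moreover have "ennreal (1 / (2 * pi)) * ennreal (2 * e) = ennreal (1 / (2 * pi) * (2 * e))"
    using e by (intro ennreal_mult[symmetric]) auto
  ultimately have "ennreal (1 / (2 * pi) * (2 * e)) \<le> ennreal (measure cauchy_measure {-e<..<e})" by metis
  then have "1 / (2 * pi) * (2 * e) \<le> measure cauchy_measure {-e<..<e}" by (simp only: ennreal_le_iff measure_nonneg)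
  then show ?thesis by simp
qed

text \<open>Only pairs with \<open>\<bar>x\<bar> < e\<close> and \<open>y\<close> outside the interval are kept. There \<open>bubble e x\<close> is at distance at least one from \<open>bubble e y = 1\<close>,
  and the integral over \<open>y\<close> is bounded below uniformly in the value \<open>u x\<close>.\<close>

lemma bubble_interaction:
  assumes e: "0 < e" "e \<le> 1 / 2" and u: "line.circle_map u"
    and \<kappa>: "0 \<le> \<kappa>" "\<And>c. \<kappa> \<le> (\<integral>y. indicator (- {-1<..<1}) y * (cmod (c - u y))\<^sup>2 \<partial>cauchy_measure)"
  shows "\<kappa> * e / (4 * pi) \<le> (\<integral>p. (cmod (bubble e (fst p) - bubble e (snd p)))\<^sup>2 * line.quot u p \<partial>line.N)"
proof -
  note [measurable] = line.circle_mapD(3)[OF u]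
  have [measurable]: "{-e<..<e} \<in> sets cauchy_measure" "- {-1<..<1::real} \<in> sets cauchy_measure"
    by (simp_all add: sets_cauchy)
  let ?A = "- {-1<..<1::real}" and ?X = "{-e<..<e}"
  define H where "H p = 1 / 4 * (indicator ?X (fst p) * (indicator ?A (snd p) * (cmod (u (fst p) - u (snd p)))\<^sup>2))" for p
  have Hm [measurable]: "H \<in> borel_measurable line.N" unfolding H_def[abs_def] by measurable
  have iH: "integrable line.N H"
  proof (rule line.integrable_pairI[of _ 1])
    fix p
    have "cmod (u (fst p) - u (snd p)) \<le> 2"
      using norm_triangle_ineq4[of "u (fst p)" "u (snd p)"] by (simp add: line.circle_mapD(5)[OF u])
    then have "(cmod (u (fst p) - u (snd p)))\<^sup>2 \<le> 2\<^sup>2" by (intro power_mono) auto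
    then show "norm (H p) \<le> 1" by (simp add: H_def indicator_def)
  qed measurable
  have HB: "H p \<le> (cmod (bubble e (fst p) - bubble e (snd p)))\<^sup>2 * line.quot u p" for p
  proof (cases "fst p \<in> ?X \<and> snd p \<in> ?A")
    case True
    then have x: "\<bar>fst p\<bar> < e" and y: "1 \<le> \<bar>snd p\<bar>" by (auto simp: abs_less_iff)
    have "cayley (fst p) \<noteq> cayley (snd p)" using line.inj_b[of "fst p" "snd p"] x y e by auto
    then have b0: "0 < (cmod (cayley (fst p) - cayley (snd p)))\<^sup>2" by simp
    have "cmod (cayley (fst p) - cayley (snd p)) \<le> 2"
      using norm_triangle_ineq4[of "cayley (fst p)" "cayley (snd p)"] by (simp add: norm_cayley)
    then have b4: "(cmod (cayley (fst p) - cayley (snd p)))\<^sup>2 \<le> 2\<^sup>2" by (intro power_mono) auto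
    have "H p = (cmod (u (fst p) - u (snd p)))\<^sup>2 / 4" using True by (simp add: H_def)
    also have "\<dots> \<le> line.quot u p" unfolding line.quot_def using b0 b4 by (intro divide_left_mono) auto
    also have "\<dots> = 1 * line.quot u p" by simp
    also have "\<dots> \<le> (cmod (bubble e (fst p) - bubble e (snd p)))\<^sup>2 * line.quot u p"
      by (intro mult_right_mono bubble_far_from_1 e x y line.quot_nonneg)
    finally show ?thesis .
  next
    case False
    then have "H p = 0" by (auto simp: H_def)
    then show ?thesis by (simp add: line.quot_nonneg)
  qed
  have "\<kappa> * e / (4 * pi) = (\<kappa> / 4) * (e / pi)" by simp
  also have "\<dots> \<le> (\<kappa> / 4) * measure cauchy_measure ?X"
    using \<kappa>(1) e by (intro mult_left_mono cauchy_interval) auto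
  also have "\<dots> = (\<integral>x. (\<kappa> / 4) * indicator ?X x \<partial>cauchy_measure)" by simp
  also have "\<dots> \<le> (\<integral>x. (\<integral>y. H (x, y) \<partial>cauchy_measure) \<partial>cauchy_measure)"
  proof (rule integral_mono)
    show "integrable cauchy_measure (\<lambda>x. \<kappa> / 4 * indicator ?X x)"
      by (intro integrable_mult_right) (simp add: line.emeasure_eq_measure)
    show "integrable cauchy_measure (\<lambda>x. \<integral>y. H (x, y) \<partial>cauchy_measure)" by (rule line.P.integrable_fst'[OF iH])
    fix x
    have "(\<integral>y. H (x, y) \<partial>cauchy_measure) = 1 / 4 * (indicator ?X x * (\<integral>y. indicator ?A y * (cmod (u x - u y))\<^sup>2 \<partial>cauchy_measure))"
      unfolding H_def fst_conv snd_conv by (simp only: integral_mult_right_zero)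
    moreover have "indicator ?X x * \<kappa> \<le> indicator ?X x * (\<integral>y. indicator ?A y * (cmod (u x - u y))\<^sup>2 \<partial>cauchy_measure)"
      by (intro mult_left_mono \<kappa>(2)) simp
    ultimately show "\<kappa> / 4 * indicator ?X x \<le> (\<integral>y. H (x, y) \<partial>cauchy_measure)"
      by (simp add: mult.commute[of \<kappa>])
  qed
  also have "\<dots> = (\<integral>p. H p \<partial>line.N)" by (rule line.P.integral_fst'[OF iH])
  also have "\<dots> \<le> (\<integral>p. (cmod (bubble e (fst p) - bubble e (snd p)))\<^sup>2 * line.quot u p \<partial>line.N)"
    using line.dirichlet_mult_add_mult_cnj(2)[OF u bubble_circle_map(1)[OF e(1)]] e
    by (intro integral_mono iH HB) auto
  finally show ?thesis .
qed

section \<open>Test functions\<close>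

lemma test_function_lipschitz:
  assumes \<phi>: "\<phi> \<in> test_functions {-1<..<1}"
  obtains \<Lambda> where "\<Lambda> \<ge> 0" "\<And>x y. \<bar>x\<bar> \<le> 1 \<Longrightarrow> \<bar>y\<bar> \<le> 1 \<Longrightarrow> cmod (\<phi> x - \<phi> y) \<le> \<Lambda> * \<bar>x - y\<bar>"
proof -
  have sm: "((\<lambda>f t. vector_derivative f (at t)) ^^ k) \<phi> differentiable (at x)" for k x
    using \<phi> by (auto simp: test_functions_def smooth_def)
  have d0: "\<phi> differentiable (at x)" for x using sm[of 0 x] by simp
  let ?d = "\<lambda>t. vector_derivative \<phi> (at t)"
  have d1: "?d differentiable (at x)" for x using sm[of 1 x] by simp
  have "continuous_on {-1..1} ?d"
    using d1 differentiable_imp_continuous_within by (intro continuous_at_imp_continuous_on) blast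
  then have "compact (?d ` {-1..1})" by (intro compact_continuous_image) auto
  then have "bounded (?d ` {-1..1})" by (rule compact_imp_bounded)
  then obtain B where B0: "B > 0" "\<forall>z\<in>?d ` {-1..1}. norm z \<le> B" by (auto simp only: bounded_pos)
  then have B: "B > 0" "\<And>x. x \<in> {-1..1} \<Longrightarrow> norm (?d x) \<le> B" by auto
  have "cmod (\<phi> x - \<phi> y) \<le> B * \<bar>x - y\<bar>" if "\<bar>x\<bar> \<le> 1" "\<bar>y\<bar> \<le> 1" for x y
  proof -
    have "norm (\<phi> x - \<phi> y) \<le> B * norm (x - y)"
    proof (rule differentiable_bound[of "{-1..1}" \<phi> "\<lambda>x h. h *\<^sub>R ?d x"])
      show "(\<phi> has_derivative (\<lambda>h. h *\<^sub>R ?d z)) (at z within {-1..1})" for z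
        using d0[of z] vector_derivative_works has_vector_derivative_def has_derivative_at_withinI by blast
      show "onorm (\<lambda>h. h *\<^sub>R ?d z) \<le> B" if "z \<in> {-1..1}" for z
        using B(2)[OF that] by (intro onorm_le) (simp add: mult_left_mono mult.commute[of B])
    qed (use that in \<open>auto simp: abs_le_iff\<close>)
    then show ?thesis by simp
  qed
  then show thesis using that[of B] B(1) by auto
qed

lemma cayley_diff_ge:
  assumes "\<bar>x\<bar> \<le> 1" "\<bar>y\<bar> \<le> 1"
  shows "\<bar>x - y\<bar> \<le> cmod (cayley x - cayley y)"
proof (rule power2_le_imp_le)
  have "x\<^sup>2 \<le> 1" "y\<^sup>2 \<le> 1" using assms by (simp_all add: abs_square_le_1)
  then have "(1 + x\<^sup>2) * (1 + y\<^sup>2) \<le> 2 * 2" by (intro mult_mono) auto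
  then have "4 * (x - y)\<^sup>2 / (2 * 2) \<le> 4 * (x - y)\<^sup>2 / ((1 + x\<^sup>2) * (1 + y\<^sup>2))"
    using one_plus_sq_pos[of x] one_plus_sq_pos[of y] by (intro divide_left_mono mult_pos_pos) auto
  then show "\<bar>x - y\<bar>\<^sup>2 \<le> (cmod (cayley x - cayley y))\<^sup>2" unfolding cayley_diff_sq by simp
qed simp

lemma cayley_diff_endpoint_ge:
  assumes x: "\<bar>x\<bar> \<le> 1" and y: "1 < \<bar>y\<bar>"
  shows "\<bar>x - sgn y\<bar> \<le> 2 * cmod (cayley x - cayley y)"
proof (rule power2_le_imp_le)
  have x2: "x\<^sup>2 \<le> 1" using x by (simp add: abs_square_le_1)
  have s: "(x - sgn y)\<^sup>2 * (1 + y\<^sup>2) \<le> 8 * (x - y)\<^sup>2"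
  proof -
    have *: "(x - 1)\<^sup>2 * (1 + y\<^sup>2) \<le> 8 * (x - y)\<^sup>2" if x: "\<bar>x\<bar> \<le> 1" and y: "1 < y" for x y :: real
    proof (cases "0 \<le> x")
      case True
      have "x * 1 \<le> x * y" using True y by (intro mult_left_mono) auto
      then have "(1 - x) * y \<le> y - x" by (simp add: algebra_simps)
      then have "((1 - x) * y)\<^sup>2 \<le> (y - x)\<^sup>2" using x y by (intro power_mono) auto
      then have 1: "(x - 1)\<^sup>2 * y\<^sup>2 \<le> (x - y)\<^sup>2" by (simp add: power_mult_distrib power2_commute)
      have "1 \<le> y\<^sup>2" using y by simp
      then have "(x - 1)\<^sup>2 * (1 + y\<^sup>2) \<le> (x - 1)\<^sup>2 * (8 * y\<^sup>2)" by (intro mult_left_mono) auto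
      then show ?thesis using 1 by (simp add: mult_ac)
    next
      case False
      have "\<bar>x - 1\<bar> \<le> 2" using x by auto
      then have "\<bar>x - 1\<bar>\<^sup>2 \<le> 2\<^sup>2" by (intro power_mono) auto
      moreover have "1 + y\<^sup>2 \<le> 2 * y\<^sup>2" using y by simp
      ultimately have "(x - 1)\<^sup>2 * (1 + y\<^sup>2) \<le> 2\<^sup>2 * (2 * y\<^sup>2)" by (intro mult_mono) auto
      also have "y\<^sup>2 \<le> (y - x)\<^sup>2" using False y by (intro power_mono) auto
      finally show ?thesis by (simp add: power2_commute)
    qed
    show ?thesis
    proof (cases "0 < y")
      case True
      then show ?thesis using *[OF x, of y] y by simp
    next
      case False
      then have "1 < - y" "sgn y = - 1" using y by auto
      moreover have "\<bar>- x\<bar> \<le> 1" using x by simp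
      moreover have "(- x - 1)\<^sup>2 = (x - (- 1))\<^sup>2" "(- x - - y)\<^sup>2 = (x - y)\<^sup>2"
        by (simp_all add: power2_eq_square algebra_simps)
      ultimately show ?thesis using *[of "- x" "- y"] by simp
    qed
  qed
  have p: "0 < (1 + x\<^sup>2) * (1 + y\<^sup>2)" using one_plus_sq_pos[of x] one_plus_sq_pos[of y] by (rule mult_pos_pos)
  have "(x - sgn y)\<^sup>2 * ((1 + x\<^sup>2) * (1 + y\<^sup>2)) = ((x - sgn y)\<^sup>2 * (1 + y\<^sup>2)) * (1 + x\<^sup>2)" by simp
  also have "\<dots> \<le> (8 * (x - y)\<^sup>2) * 2" by (rule mult_mono[OF s]) (use x2 in auto)
  finally have "(x - sgn y)\<^sup>2 \<le> 16 * (x - y)\<^sup>2 / ((1 + x\<^sup>2) * (1 + y\<^sup>2))"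
    using p by (simp add: pos_le_divide_eq)
  then show "\<bar>x - sgn y\<bar>\<^sup>2 \<le> (2 * cmod (cayley x - cayley y))\<^sup>2"
    unfolding power_mult_distrib cayley_diff_sq by simp
qed simp

lemma test_function_zero:
  assumes "\<phi> \<in> test_functions {-1<..<1}" "x \<notin> {-1<..<1}"
  shows "\<phi> x = 0"
  using assms closure_subset[of "{x. \<phi> x \<noteq> 0}"] unfolding test_functions_def by blast

text \<open>A test function is Lipschitz for the chord distance: for an outer point the nearer end point of the interval serves as
  a substitute, since the test function vanishes at the outer point and at the end point.\<close>

lemma test_function_finite_dirichlet:
  assumes \<phi>: "\<phi> \<in> test_functions {-1<..<1}"
  shows "line.finite_dirichlet \<phi>"
proof -
  obtain \<Lambda> where \<Lambda>: "\<Lambda> \<ge> 0" "\<And>x y. \<bar>x\<bar> \<le> 1 \<Longrightarrow> \<bar>y\<bar> \<le> 1 \<Longrightarrow> cmod (\<phi> x - \<phi> y) \<le> \<Lambda> * \<bar>x - y\<bar>"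
    using test_function_lipschitz[OF \<phi>] by blast
  have z: "\<phi> x = 0" if "1 \<le> \<bar>x\<bar>" for x using test_function_zero[OF \<phi>] that by (auto simp: abs_if split: if_splits)
  have mixed: "cmod (\<phi> x - \<phi> y) \<le> 2 * \<Lambda> * cmod (cayley x - cayley y)" if x: "\<bar>x\<bar> \<le> 1" and y: "1 < \<bar>y\<bar>" for x y
  proof -
    have s: "\<bar>sgn y\<bar> = 1" using y by (auto simp: sgn_if)
    have "\<phi> y = \<phi> (sgn y)" using z[of y] z[of "sgn y"] y s by simp
    then have "cmod (\<phi> x - \<phi> y) \<le> \<Lambda> * \<bar>x - sgn y\<bar>" using \<Lambda>(2)[OF x, of "sgn y"] s by simp
    also have "\<dots> \<le> \<Lambda> * (2 * cmod (cayley x - cayley y))"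
      using \<Lambda>(1) by (intro mult_left_mono cayley_diff_endpoint_ge x y) auto
    finally show ?thesis by simp
  qed
  have lip: "cmod (\<phi> x - \<phi> y) \<le> 2 * \<Lambda> * cmod (cayley x - cayley y)" for x y
  proof -
    consider "\<bar>x\<bar> \<le> 1" "\<bar>y\<bar> \<le> 1" | "\<bar>x\<bar> \<le> 1" "1 < \<bar>y\<bar>" | "1 < \<bar>x\<bar>" "\<bar>y\<bar> \<le> 1" | "1 < \<bar>x\<bar>" "1 < \<bar>y\<bar>"
      by linarith
    then show ?thesis
    proof cases
      case 1
      have "cmod (\<phi> x - \<phi> y) \<le> \<Lambda> * \<bar>x - y\<bar>" by (rule \<Lambda>(2)[OF 1])
      also have "\<dots> \<le> \<Lambda> * cmod (cayley x - cayley y)" using \<Lambda>(1) by (intro mult_left_mono cayley_diff_ge 1)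
      also have "\<dots> \<le> 2 * \<Lambda> * cmod (cayley x - cayley y)" using \<Lambda>(1) by (intro mult_right_mono) auto
      finally show ?thesis .
    next
      case 2 then show ?thesis by (rule mixed)
    next
      case 3 then show ?thesis using mixed[of y x] by (simp add: norm_minus_commute)
    next
      case 4 then show ?thesis using z[of x] z[of y] \<Lambda>(1) by simp
    qed
  qed
  have "\<phi> differentiable (at x)" for x
  proof -
    have "((\<lambda>f t. vector_derivative f (at t)) ^^ 0) \<phi> differentiable (at x)"
      using \<phi> unfolding test_functions_def smooth_def by blast
    then show ?thesis by simp
  qed
  then have "continuous_on UNIV \<phi>"
    using differentiable_imp_continuous_within by (intro continuous_at_imp_continuous_on) blast
  then have m: "\<phi> \<in> borel_measurable borel" by (rule borel_measurable_continuous_onI)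
  have "cmod (\<phi> x) \<le> 2 * \<Lambda> * 2" for x
  proof -
    have "cmod (\<phi> x - \<phi> 1) \<le> 2 * \<Lambda> * cmod (cayley x - cayley 1)" by (rule lip)
    also have "\<dots> \<le> 2 * \<Lambda> * 2"
      using \<Lambda>(1) norm_triangle_ineq4[of "cayley x" "cayley 1"] by (intro mult_left_mono) (auto simp: norm_cayley)
    finally show ?thesis using z[of 1] by simp
  qed
  then have "line.bounded_map \<phi>" by (rule line.bounded_mapI[OF borel_imp_cauchy[OF m]])
  then show ?thesis by (rule line.finite_dirichlet_chord_lipschitz[OF _ lip])
qed

section \<open>The second half-harmonic map\<close>

lemma unimodular_representative:
  assumes u: "u \<in> Hdot_half_circle"
  obtains v where "line.circle_map v" "AE x in lebesgue. v x = u x"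
proof -
  define v where "v x = (if cmod (u x) = 1 then u x else 1)" for x
  have um [measurable]: "u \<in> borel_measurable lebesgue" and fin: "gagliardo_sq u < \<infinity>"
    and ae: "AE x in lebesgue. u x \<in> sphere 0 1"
    using u by (auto simp: Hdot_half_circle_def Hdot_half_def)
  have vm: "v \<in> borel_measurable lebesgue" unfolding v_def[abs_def] by measurable
  have uv: "AE x in lebesgue. v x = u x" using ae by eventually_elim (simp add: v_def)
  have v1: "cmod (v x) = 1" for x by (simp add: v_def)
  have "gagliardo_sq v < \<infinity>" using gagliardo_cong_AE[OF uv] fin by simp
  then have "line.finite_dirichlet v" using finite_dirichlet_iff[OF vm, of 1] v1 by simp
  then have "line.circle_map v" using v1 by (simp add: line.circle_map_def)
  then show thesis using uv by (rule that)
qed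

lemma circle_map_admissible:
  assumes w: "line.circle_map w" and ae: "AE x in lebesgue. x \<notin> I \<longrightarrow> w x = g x"
  shows "w \<in> admissible I g"
proof -
  have m: "w \<in> borel_measurable lebesgue" using line.circle_mapD(3)[OF w] by (simp add: borel_measurable_cauchy)
  have "gagliardo_sq w < \<infinity>"
    using finite_dirichlet_iff[OF m, of 1] line.circle_mapD(1,5)[OF w] by simp
  then show ?thesis using m ae line.circle_mapD(5)[OF w]
    by (simp add: admissible_def Hdot_half_circle_def Hdot_half_def)
qed

theorem theorem1p1:
  fixes I :: "real set" and g u0 :: "real \<Rightarrow> complex"
  assumes "I = {-1<..<1}"
    and "g \<in> Hdot_half_circle"
    and "\<not> ae_constant_on (- I) g"
    and "minimizer I g u0"
  shows "\<exists>ustar. critical_point I g ustar \<and> \<not> (AE x in lebesgue. ustar x = u0 x)"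
proof -
  have I: "I = {-1<..<1}" by (rule assms(1))
  have u0: "u0 \<in> Hdot_half_circle" "AE x in lebesgue. x \<notin> I \<longrightarrow> u0 x = g x"
    and min0: "\<And>v. v \<in> admissible I g \<Longrightarrow> energy u0 \<le> energy v"
    using assms(4) by (auto simp: minimizer_def admissible_def)
  obtain v where v: "line.circle_map v" and vu: "AE x in lebesgue. v x = u0 x"
    using unimodular_representative[OF u0(1)] by blast
  have vg: "AE x in lebesgue. x \<notin> I \<longrightarrow> v x = g x" using u0(2) vu by eventually_elim simp
  have bm: "w \<in> borel_measurable lebesgue" if "line.circle_map w" for w
    using line.circle_mapD(3)[OF that] by (simp add: borel_measurable_cauchy)
  have ev: "energy u0 = 2 * pi * line.dirichlet v"
    using energy_eq_dirichlet[OF bm[OF v]] gagliardo_cong_AE[OF vu] by (simp add: energy_def)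
  have min: "line.dirichlet v \<le> line.dirichlet w"
    if w: "line.circle_map w" "AE x in cauchy_measure. x \<in> - I \<longrightarrow> w x = v x" for w
  proof -
    have "AE x in lebesgue. x \<in> - I \<longrightarrow> w x = v x" using w(2) unfolding AE_cauchy .
    then have "AE x in lebesgue. x \<notin> I \<longrightarrow> w x = g x" using vg by eventually_elim simp
    then have "energy u0 \<le> energy w" by (intro min0 circle_map_admissible w(1))
    then show ?thesis unfolding ev energy_eq_dirichlet[OF bm[OF w(1)]] by simp
  qed
  have "\<not> (\<exists>c. AE x in cauchy_measure. x \<in> - I \<longrightarrow> v x = c)"
  proof
    assume "\<exists>c. AE x in cauchy_measure. x \<in> - I \<longrightarrow> v x = c"
    then obtain c where "AE x in lebesgue. x \<in> - I \<longrightarrow> v x = c" unfolding AE_cauchy by blast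
    then have "AE x in lebesgue. x \<in> - I \<longrightarrow> g x = c" using vg by eventually_elim simp
    then show False using assms(3) by (auto simp: ae_constant_on_def)
  qed
  then obtain \<kappa> where \<kappa>: "\<kappa> > 0" "\<And>c. \<kappa> \<le> (\<integral>y. indicator (- I) y * (cmod (c - v y))\<^sup>2 \<partial>cauchy_measure)"
    using line.mean_square_deviation_lower_bound[OF v, of "- I"] by (auto simp: I sets_cauchy)
  \<comment> \<open>then the excess \<open>6 e\<^sup>2\<close> of twice the energy is below the interaction \<open>\<kappa> e / (4 \<pi>)\<close>\<close>
  define e where "e = min (1 / 2) (\<kappa> / (48 * pi))"
  have e: "0 < e" "e \<le> 1 / 2" "e \<le> 1" and e\<kappa>: "e \<le> \<kappa> / (48 * pi)" using \<kappa>(1) by (auto simp: e_def)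
  have gain: "2 * line.dirichlet (bubble e) <
      2 + (\<integral>p. (cmod (bubble e (fst p) - bubble e (snd p)))\<^sup>2 * line.quot v p \<partial>line.N)"
  proof -
    have "2 * line.dirichlet (bubble e) \<le> 2 + 6 * e * e"
      using dirichlet_bubble_le[OF e(1,3)] by (simp add: power2_eq_square)
    also have "6 * e * e \<le> 6 * (\<kappa> / (48 * pi)) * e" using e e\<kappa> by (intro mult_right_mono mult_left_mono) auto
    also have "\<dots> < \<kappa> * e / (4 * pi)" using \<kappa>(1) e by (simp add: field_simps)
    also have "\<dots> \<le> (\<integral>p. (cmod (bubble e (fst p) - bubble e (snd p)))\<^sup>2 * line.quot v p \<partial>line.N)"
      using \<kappa> by (intro bubble_interaction e(1,2) v) (auto simp: I)
    finally show ?thesis by simp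
  qed
  have b1: "bubble e x = 1" if "x \<in> - I" for x
    using that by (intro bubble_outside) (auto simp: I abs_if)
  obtain u where u: "line.circle_map u" "AE x in cauchy_measure. x \<in> - I \<longrightarrow> u x = v x" "line.deg u \<noteq> line.deg v"
    and stat: "\<And>f. line.finite_dirichlet f \<Longrightarrow> (\<And>x. x \<in> - I \<Longrightarrow> f x = 0) \<Longrightarrow>
      ((\<lambda>t::real. line.dirichlet (\<lambda>x. sgn (u x + t * f x))) has_real_derivative 0) (at 0)"
    using line.second_critical_map[OF v min bubble_circle_map[OF e(1,3)] b1 gain] by blast
  have "AE x in lebesgue. x \<in> - I \<longrightarrow> u x = v x" using u(2) unfolding AE_cauchy .
  then have "AE x in lebesgue. x \<notin> I \<longrightarrow> u x = g x" using vg by eventually_elim simp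
  then have adm: "u \<in> admissible I g" by (rule circle_map_admissible[OF u(1)])
  have "half_harmonic_in I u" unfolding half_harmonic_in_def
  proof
    fix \<phi> assume "\<phi> \<in> test_functions I"
    then have \<phi>: "\<phi> \<in> test_functions {-1<..<1}" by (simp add: I)
    note f = test_function_finite_dirichlet[OF \<phi>]
    have z: "\<phi> x = 0" if "x \<in> - I" for x using test_function_zero[OF \<phi>] that by (auto simp: I)
    have "energy (\<lambda>x. (u x + of_real t * \<phi> x) / of_real (cmod (u x + of_real t * \<phi> x))) =
       2 * pi * line.dirichlet (\<lambda>x. sgn (u x + of_real t * \<phi> x))" for t :: real
    proof -
      have [measurable]: "u \<in> borel_measurable lebesgue" "\<phi> \<in> borel_measurable lebesgue"
        using bm[OF u(1)] line.bounded_map_measurable[OF line.finite_dirichlet_bounded[OF f]]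
        by (simp_all add: borel_measurable_cauchy)
      show ?thesis unfolding sgn_eq by (rule energy_eq_dirichlet) measurable
    qed
    then show "((\<lambda>t. energy (\<lambda>x. (u x + of_real t * \<phi> x) / of_real (cmod (u x + of_real t * \<phi> x))))
       has_real_derivative 0) (at 0)"
      using DERIV_cmult[OF stat[OF f z], of "2 * pi"] by simp
  qed
  moreover have "\<not> (AE x in lebesgue. u x = u0 x)"
  proof
    assume "AE x in lebesgue. u x = u0 x"
    then have "AE x in cauchy_measure. u x = v x" unfolding AE_cauchy using vu by eventually_elim simp
    then have "line.deg u = line.deg v"
      by (rule line.deg_cong_AE) (use line.circle_mapD(3) u(1) v in auto)
    then show False using u(3) by simp
  qed
  ultimately show ?thesis using adm unfolding critical_point_def by blast
qed

end
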